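(* Fix integers $N\ge1$, $\delta\in\{0,1\}$, $k\ge2$ and $1\le i\le k$. Let $\lambda$ be a partition with largest part $\le N-1$ and let $\sigma\in\{0,1\}$ be such that $|\lambda|+\sigma N$ is even. Then $$\frac{1}{(q)_\infty}\sum_{j=-\infty}^{\infty}(-1)^j q^{\left((2k+\delta-2+2/N)j+2k-2i+\delta\right)j/2}\sum_{\boldsymbol\eta\in\mathbb Z^{N-1}}^{(\sigma,j)}\frac{q^{\boldsymbol\eta\,C^{-1}(\boldsymbol\eta-\boldsymbol e_\lambda)}}{(q)_{\eta_1}\cdots(q)_{\eta_{N-1}}}$$ $$=\sum_{r_1\ge\cdots\ge r_{k-1}\ge0}\frac{q^{r_1^2/N+r_2^2+\cdots+r_{k-1}^2+r_i+\cdots+r_{k-1}}}{(q)_{r_1-r_2}\cdots(q)_{r_{k-2}-r_{k-1}}(q^{2-\delta};q^{2-\delta})_{r_{k-1}}}\sum_{\boldsymbol n\in\mathbb Z^{N-1}}^{(\sigma,r_1)}q^{\boldsymbol n\,C^{-1}(\boldsymbol n-\boldsymbol e_\lambda)}\prod_{j=1}^{N-1}\left[{m_j+n_j\atop n_j}\right],$$ where $\boldsymbol m=C^{-1}(2r_1\boldsymbol e_{N-1}+\boldsymbol e_\lambda-2\boldsymbol n)$.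
   Context: $q$ satisfies $0<|q|<1$, with rational powers of $q$ defined through a fixed choice of $\log q$. $(x;p)_\infty=\prod_{n\ge0}(1-xp^n)$, $(x;p)_n=(x;p)_\infty/(xp^n;p)_\infty$, $(x)_n=(x;q)_n$, $(x)_\infty=(x;q)_\infty$; so $1/(q)_n=0$ for integers $n<0$. For integers $m,n$: $\left[{m+n\atop n}\right]=\frac{(q)_{m+n}}{(q)_m(q)_n}$ if $m,n\ge0$ and $0$ otherwise. The linear term $r_i+\cdots+r_{k-1}$ is $0$ when $i=k$. Vectors $\boldsymbol v=(v_1,\dots,v_{N-1})\in\mathbb Z^{N-1}$; $\boldsymbol e_j$ is the $j$-th unit vector, $\boldsymbol e_0=\boldsymbol e_N=\boldsymbol 0$. $C$ is the Cartan matrix of $A_{N-1}$: $C_{j,k}=2\delta_{j,k}-\delta_{j,k-1}-\delta_{j,k+1}$, $1\le j,k\le N-1$ (here $\delta_{j,k}$ is the Kronecker delta). For vectors, $\boldsymbol v C^{-1}\boldsymbol w=\sum_{j,k}v_jC^{-1}_{j,k}w_k$. For a partition $\lambda=(\lambda_1,\lambda_2,\dots)$ with all parts $\le N-1$, $\boldsymbol e_\lambda=\boldsymbol e_{\lambda_1}+\boldsymbol e_{\lambda_2}+\cdots$ and $|\lambda|=\sum_i\lambda_i$. Restricted sums: for an integer $b$, $\sum^{(\sigma,b)}_{\boldsymbol n\in\mathbb Z^{N-1}}$ denotes the sum over those $\boldsymbol n\in\mathbb Z^{N-1}$ satisfying $\frac{b-|\lambda|/2}{N}-(C^{-1}\boldsymbol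 n)_1\in\mathbb Z+\frac{\sigma}{2}$ (this guarantees that $\boldsymbol m$ has integer entries). For $N=1$, $\mathbb Z^{0}$ is a single point, all vector expressions are $0$, and empty products equal $1$. *)

theory Defs
  imports
    "HOL-Analysis.Analysis"
    "Jordan_Normal_Form.Gauss_Jordan_Elimination"
begin

unbundle no inner_syntax
unbundle no vec_syntax

text \<open>Vectors in $\mathbb Z^{N-1}$ are integer vectors in \<open>carrier_vec (N - 1)\<close>, which makes sense
  for \<open>N = 1\<close> as well. Library vectors and matrices are indexed from \<open>0\<close>, so the component
  $v_j$ with $1 \le j \le N-1$ is \<open>v $ (j - 1)\<close>.\<close>

text \<open>Rational powers of \<open>q\<close>, where \<open>L\<close> is the chosen value of $\log q$ (so \<open>exp L = q\<close>).\<close>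

definition qpow :: "complex \<Rightarrow> real \<Rightarrow> complex" where
  "qpow L x = exp (of_real x * L)"

definition qpoch_inf :: "complex \<Rightarrow> complex \<Rightarrow> complex" where
  "qpoch_inf x p = (\<Prod>n. 1 - x * p ^ n)"

text \<open>For \<open>n < 0\<close> the infinite product \<open>qpoch_inf (p * p powi n) p\<close> has a vanishing factor.
  Since division by \<open>0\<close> yields \<open>0\<close>, then \<open>qpoch p p n = 0\<close> and \<open>1 / qpoch p p n = 0\<close>, the
  latter being the usual convention $1/(p;p)_n = 0$.\<close>

definition qpoch :: "complex \<Rightarrow> complex \<Rightarrow> int \<Rightarrow> complex" where
  "qpoch x p n = qpoch_inf x p / qpoch_inf (x * p powi n) p"

text \<open>\<open>qbinom q m n\<close> is the Gaussian polynomial with top entry \<open>m + n\<close> and bottom entry \<open>n\<close>.\<close>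

definition qbinom :: "complex \<Rightarrow> int \<Rightarrow> int \<Rightarrow> complex" where
  "qbinom q m n =
     (if m \<ge> 0 \<and> n \<ge> 0 then qpoch q q (m + n) / (qpoch q q m * qpoch q q n) else 0)"

definition cartan :: "nat \<Rightarrow> real Matrix.mat" where
  "cartan N = Matrix.mat (N - 1) (N - 1)
     (\<lambda>(j, k). 2 * of_bool (j = k) - of_bool (j + 1 = k) - of_bool (j = k + 1))"

definition cartan_inv :: "nat \<Rightarrow> real Matrix.mat" where
  "cartan_inv N = the (mat_inverse (cartan N))"

text \<open>The unit vector $e_j$, with $e_0 = e_N = 0$.\<close>

definition evec :: "nat \<Rightarrow> nat \<Rightarrow> int Matrix.vec" where
  "evec N j = (if 1 \<le> j \<and> j \<le> N - 1 then unit_vec (N - 1) (j - 1) else 0\<^sub>v (N - 1))"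

text \<open>A partition is the weakly decreasing list of its (positive) parts.\<close>

definition is_partition :: "nat list \<Rightarrow> bool" where
  "is_partition lam \<longleftrightarrow> sorted_wrt (\<ge>) lam \<and> (\<forall>p\<in>set lam. p > 0)"

definition evec_part :: "nat \<Rightarrow> nat list \<Rightarrow> int Matrix.vec" where
  "evec_part N lam = foldr (\<lambda>p v. evec N p + v) lam (0\<^sub>v (N - 1))"

abbreviation rvec :: "int Matrix.vec \<Rightarrow> real Matrix.vec" where
  "rvec v \<equiv> map_vec real_of_int v"

definition cform :: "nat \<Rightarrow> int Matrix.vec \<Rightarrow> int Matrix.vec \<Rightarrow> real" where
  "cform N v w = rvec v \<bullet> (cartan_inv N *\<^sub>v rvec w)"

text \<open>The range of the restricted sum with superscript $(\sigma, b)$. For \<open>N = 1\<close> the term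
  $(C^{-1}n)_1$ is read as \<open>0\<close>.\<close>

definition restricted :: "nat \<Rightarrow> nat list \<Rightarrow> nat \<Rightarrow> int \<Rightarrow> int Matrix.vec set" where
  "restricted N lam \<sigma> b =
     {n \<in> carrier_vec (N - 1). \<exists>z::int.
        (real_of_int b - real (sum_list lam) / 2) / real N
          - (if N = 1 then 0 else (cartan_inv N *\<^sub>v rvec n) $ 0)
        = real_of_int z + real \<sigma> / 2}"

definition eta_summand ::
  "complex \<Rightarrow> complex \<Rightarrow> nat \<Rightarrow> nat list \<Rightarrow> int Matrix.vec \<Rightarrow> complex" where
  "eta_summand q L N lam \<eta> =
     qpow L (cform N \<eta> (\<eta> - evec_part N lam)) / (\<Prod>j=1..N-1. qpoch q q (\<eta> $ (j - 1)))"

definition j_summand ::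
  "complex \<Rightarrow> complex \<Rightarrow> nat \<Rightarrow> nat \<Rightarrow> nat \<Rightarrow> nat \<Rightarrow> nat list \<Rightarrow> nat \<Rightarrow> int \<Rightarrow> complex" where
  "j_summand q L N \<delta> k i lam \<sigma> j =
     (-1) powi j
     * qpow L (((2 * real k + real \<delta> - 2 + 2 / real N) * real_of_int j
                + 2 * real k - 2 * real i + real \<delta>) * real_of_int j / 2)
     * (\<Sum>\<^sub>\<infinity>\<eta>\<in>restricted N lam \<sigma> j. eta_summand q L N lam \<eta>)"

definition mvec :: "nat \<Rightarrow> nat list \<Rightarrow> int \<Rightarrow> int Matrix.vec \<Rightarrow> real Matrix.vec" where
  "mvec N lam r1 n =
     cartan_inv N *\<^sub>v rvec ((2 * r1) \<cdot>\<^sub>v evec N (N - 1) + evec_part N lam - 2 \<cdot>\<^sub>v n)"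

text \<open>The floor is only a type conversion: the entries of \<open>mvec N lam r1 n\<close> are integers for
  \<open>n \<in> restricted N lam \<sigma> r1\<close>.\<close>

definition n_summand ::
  "complex \<Rightarrow> complex \<Rightarrow> nat \<Rightarrow> nat list \<Rightarrow> int \<Rightarrow> int Matrix.vec \<Rightarrow> complex" where
  "n_summand q L N lam r1 n =
     qpow L (cform N n (n - evec_part N lam))
     * (\<Prod>j=1..N-1. qbinom q \<lfloor>mvec N lam r1 n $ (j - 1)\<rfloor> (n $ (j - 1)))"

text \<open>The index set $r_1 \ge \dots \ge r_{k-1} \ge 0$; functions are fixed as \<open>undefined\<close>
  outside \<open>{1..k-1}\<close>, so that each sequence is counted exactly once.\<close>

definition r_chains :: "nat \<Rightarrow> (nat \<Rightarrow> int) set" where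
  "r_chains k = {r \<in> {1..k-1} \<rightarrow>\<^sub>E {0..}. \<forall>a. 1 \<le> a \<and> a + 1 \<le> k - 1 \<longrightarrow> r a \<ge> r (a + 1)}"

definition r_summand ::
  "complex \<Rightarrow> complex \<Rightarrow> nat \<Rightarrow> nat \<Rightarrow> nat \<Rightarrow> nat \<Rightarrow> nat list \<Rightarrow> nat \<Rightarrow> (nat \<Rightarrow> int) \<Rightarrow> complex"
  where
  "r_summand q L N \<delta> k i lam \<sigma> r =
     qpow L ((real_of_int (r 1))\<^sup>2 / real N + (\<Sum>a=2..k-1. (real_of_int (r a))\<^sup>2)
             + (\<Sum>a=i..k-1. real_of_int (r a)))
     / ((\<Prod>a=1..k-2. qpoch q q (r a - r (a + 1)))
        * qpoch (q ^ (2 - \<delta>)) (q ^ (2 - \<delta>)) (r (k - 1)))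
     * (\<Sum>\<^sub>\<infinity>n\<in>restricted N lam \<sigma> (r 1). n_summand q L N lam (r 1) n)"

end

theory Submission
  imports Defs
begin

text \<open>
  Bailey's lemma: if $\gamma_j = \sum_r \delta_r/((q)_{r-j}(q)_{r+j})$ and
  $\beta_r = \sum_j \alpha_j/((q)_{r-j}(q)_{r+j})$, then $\sum_j \alpha_j\gamma_j = \sum_r \beta_r\delta_r$.
  Here $\delta_{r}$ is the sum over $n$ and $\gamma_j$ the sum over $\eta$, and $\beta$ comes from iterating the Bailey
  chain of Andrews and Bressoud.

  The formula for $\gamma$ becomes transparent in coordinates $y \in \mathbb Z^N$ with
  $m_a = y_1+\dots+y_a$ and $n_a = (L_a + y_{a+1} - y_a)/2$ (and the same for $\eta_a$), where $L_a$ is the multiplicity of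
  $a$ in $\lambda$: up to a constant, the total quadratic exponent is then $\frac14\sum_a y_a^2$ on both sides.
  Expand every $q$-binomial coefficient and every $1/(q)_{\eta_a}$ by the $q$-binomial theorem in
  powers of $q^{n_a}$, $q^{\eta_a}$, with summation index $k_a$, and shift $y_a$ by $k_a - k_{a-1}$. Completing the
  square produces the same coefficient for both sides, and what remains is an identity between theta sums in which
  $1/\prod_a (q)_{m_a}$ takes the place of the $q$-binomials. It follows by summing out $y_N, y_{N-1}, \dots$
  with a finite form of Heine's transformation.
\<close>

text \<open>The shift by k changes the parities of the coordinates, so the theta identity is needed
  for every parity class, not only for the one attached to lambda and \<open>\<sigma>\<close>. Its
  right side sees y only through the total y_1 + ... + y_N, which the shift preserves because k_0 =
  k_N = 0; there the expansion simply resums to the reciprocals 1/(q)_{eta_a}. The obstacle is the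
  convention for Gaussian polynomials: their expansion in powers of q^n is nonzero when m >= 0 and m
  + n < 0, whereas \<open>qbinom\<close> is 0 there. The relation 2(m_a + n_a) = m_{a-1} + m_{a+1} +
  L_a excludes this case once all m_a >= 0. The last one, m_N = 2r, is nonnegative because of
  1/((q)_{r-j}(q)_{r+j}), and a negative m_a before it makes both products vanish. On the side of
  the chain, the coefficients alpha_j run over all integers. The linear term r_i + ... + r_{k-1}
  comes from changing at the i-th index from pairs relative to 1 to pairs relative to q, by adding
  the terms j and -1-j. The parameter \<open>\<delta>\<close> selects the pair that ends the chain:
  1/(q)_s for 1, 1/(q^2;q^2)_s for 0.\<close>

section \<open>Reciprocals of q-Pochhammer symbols at integer indices\<close>

lemma convergent_prod_qpoch:
  fixes p x :: complex
  assumes "norm p < 1"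
  shows "convergent_prod (\<lambda>n. 1 - x * p ^ n)"
proof -
  have "summable (\<lambda>n. norm x * norm p ^ n)"
    using assms by (intro summable_mult summable_geometric) auto
  hence "summable (\<lambda>n. norm ((1 - x * p ^ n) - 1))"
    by (simp add: norm_mult norm_power)
  from summable_imp_abs_convergent_prod[OF this] show ?thesis
    by (rule abs_convergent_prod_imp_convergent_prod)
qed

lemma qpoch_inf_rec:
  assumes "norm p < 1"
  shows "qpoch_inf x p = (1 - x) * qpoch_inf (x * p) p"
proof -
  have "(\<lambda>n. 1 - x * p * p ^ n) has_prod (qpoch_inf (x * p) p)"
    unfolding qpoch_inf_def
    by (rule convergent_prod_has_prod[OF convergent_prod_qpoch[OF assms]])
  hence "(\<lambda>n. 1 - x * p ^ Suc n) has_prod (qpoch_inf (x * p) p)"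
    by (simp add: mult.assoc)
  hence "(\<lambda>n. 1 - x * p ^ n) has_prod (qpoch_inf (x * p) p * (1 - x * p ^ 0))"
    by (rule has_prod_Suc_imp)
  thus ?thesis by (simp add: qpoch_inf_def has_prod_iff mult.commute)
qed

lemma qpoch_inf_nonzero:
  fixes p :: complex
  assumes "norm p < 1"
  shows "qpoch_inf p p \<noteq> 0"
  unfolding qpoch_inf_def
proof (rule prodinf_nonzero[OF convergent_prod_qpoch[OF assms]])
  fix i :: nat
  have "norm (p * p ^ i) < 1"
    using assms by (metis norm_power power_Suc power_less_one_iff norm_ge_zero zero_less_Suc)
  thus "1 - p * p ^ i \<noteq> 0" by (metis eq_iff_diff_eq_0 norm_one less_irrefl)
qed

text \<open>The reciprocal $1/(p;p)_n$. It satisfies the recurrence \<open>iqp_rec\<close> for all integers, which makes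
  the boundary terms of all sums below vanish automatically.\<close>

definition iqp :: "complex \<Rightarrow> int \<Rightarrow> complex" where
  "iqp p n = 1 / qpoch p p n"

lemma iqp_eq: "iqp p n = qpoch_inf (p * p powi n) p / qpoch_inf p p"
  by (simp add: iqp_def qpoch_def)

lemma iqp_0 [simp]: "norm p < 1 \<Longrightarrow> iqp p 0 = 1"
  by (simp add: iqp_eq qpoch_inf_nonzero)

lemma iqp_rec:
  assumes "norm p < 1" "p \<noteq> 0"
  shows "iqp p (n - 1) = (1 - p powi n) * iqp p n"
proof -
  have "p * p powi (n - 1) = p powi n"
    using assms by (simp add: power_int_diff)
  thus ?thesis
    using qpoch_inf_rec[OF assms(1), of "p powi n"] by (simp add: iqp_eq mult.commute)
qed

text \<open>At n = 0 the factor 1 - p^n in \<open>iqp_rec\<close> vanishes, which gives the value 0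
  at -1; the recurrence then carries the zero downwards.\<close>

lemma iqp_neg [simp]:
  assumes "norm p < 1" "p \<noteq> 0" "n < 0"
  shows "iqp p n = 0"
proof -
  have "iqp p (- int k - 1) = 0" for k
  proof (induction k)
    case 0
    show ?case using iqp_rec[OF assms(1,2), of 0] by simp
  next
    case (Suc k)
    show ?case using iqp_rec[OF assms(1,2), of "- int k - 1"] Suc by (simp add: algebra_simps)
  qed
  from this[of "nat (- n - 1)"] show ?thesis using assms(3) by simp
qed

lemma powi_neq_1:
  fixes p :: complex
  assumes "norm p < 1" "n > 0"
  shows "p powi n \<noteq> 1"
proof
  assume "p powi n = 1"
  hence "norm p ^ nat n = 1" using assms
    by (metis norm_one norm_power power_int_def less_imp_le)
  moreover have "norm p ^ nat n < 1" using assms by (simp add: power_less_one_iff)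
  ultimately show False by simp
qed

lemma iqp_nonzero:
  assumes "norm p < 1" "p \<noteq> 0" "n \<ge> 0"
  shows "iqp p n \<noteq> 0"
proof -
  have "iqp p (int k) \<noteq> 0" for k
  proof (induction k)
    case 0
    thus ?case using assms by simp
  next
    case (Suc k)
    have "int (Suc k) - 1 = int k" by simp
    with Suc show ?case using iqp_rec[OF assms(1,2), of "int (Suc k)"] by auto
  qed
  from this[of "nat n"] show ?thesis using assms by simp
qed

lemma iqp_prod:
  assumes "norm p < 1" "p \<noteq> 0"
  shows "iqp p (int n) * (\<Prod>k<n. 1 - p * p ^ k) = 1"
proof (induction n)
  case 0
  thus ?case using assms by simp
next
  case (Suc n)
  have "int (Suc n) - 1 = int n" by simp
  hence "iqp p (int n) = (1 - p * p ^ n) * iqp p (int (Suc n))"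
    using iqp_rec[OF assms, of "int (Suc n)"] by (simp only: power_int_of_nat power_Suc)
  with Suc show ?case by (simp add: mult_ac)
qed

lemma iqp_tendsto:
  assumes "norm p < 1" "p \<noteq> 0"
  shows "(\<lambda>n. iqp p (int n)) \<longlonglongrightarrow> 1 / qpoch_inf p p"
proof -
  have "(\<lambda>n. \<Prod>k\<le>n. 1 - p * p ^ k) \<longlonglongrightarrow> qpoch_inf p p"
    unfolding qpoch_inf_def by (rule convergent_prod_LIMSEQ[OF convergent_prod_qpoch[OF assms(1)]])
  hence "(\<lambda>n. \<Prod>k<Suc n. 1 - p * p ^ k) \<longlonglongrightarrow> qpoch_inf p p"
    by (simp only: lessThan_Suc_atMost)
  hence "(\<lambda>n. \<Prod>k<n. 1 - p * p ^ k) \<longlonglongrightarrow> qpoch_inf p p"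
    by (rule filterlim_sequentially_Suc[THEN iffD1])
  hence "(\<lambda>n. 1 / (\<Prod>k<n. 1 - p * p ^ k)) \<longlonglongrightarrow> 1 / qpoch_inf p p"
    by (intro tendsto_intros qpoch_inf_nonzero assms)
  moreover have "1 / (\<Prod>k<n. 1 - p * p ^ k) = iqp p (int n)" for n
    using iqp_prod[OF assms, of n] by (metis divide_eq_eq mult_zero_right zero_neq_one)
  ultimately show ?thesis by simp
qed

text \<open>Convergence to 1/(p;p)_infinity bounds the values at n >= 0, and all others are 0. This
  bound reduces the later summability questions to Gaussian exponents.\<close>

lemma iqp_bounded:
  assumes "norm p < 1" "p \<noteq> 0"
  obtains B where "B \<ge> 1" "\<And>n. norm (iqp p n) \<le> B"
proof -
  have "Bseq (\<lambda>n. iqp p (int n))"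
    by (rule convergent_imp_Bseq[OF convergentI[OF iqp_tendsto[OF assms]]])
  then obtain K where K: "K > 0" "\<And>n. norm (iqp p (int n)) \<le> K"
    by (auto simp: Bseq_def)
  have "norm (iqp p n) \<le> max 1 K" for n
  proof (cases "n < 0")
    case False
    thus ?thesis using K(2)[of "nat n"] by simp
  qed (use assms in simp)
  thus ?thesis using that[of "max 1 K"] by simp
qed

section \<open>Sums over the integers\<close>

lemma summable_on_int_power_abs:
  fixes r :: real
  assumes "0 \<le> r" "r < 1"
  shows "(\<lambda>x::int. r ^ nat \<bar>x\<bar>) summable_on UNIV"
proof -
  have *: "(\<lambda>n::nat. r ^ n) summable_on UNIV"
    using assms by (intro norm_summable_imp_summable_on) (auto simp: norm_power summable_geometric)
  have 1: "(\<lambda>x::int. r ^ nat \<bar>x\<bar>) summable_on range int"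
    by (subst summable_on_reindex) (auto simp: o_def *)
  have 2: "(\<lambda>x::int. r ^ nat \<bar>x\<bar>) summable_on range (\<lambda>n. - int n)"
    by (subst summable_on_reindex) (auto simp: o_def * inj_def)
  have "range int \<union> range (\<lambda>n. - int n) = UNIV"
    by (auto simp: image_iff) (metis int_cases)
  with summable_on_union[OF 1 2] show ?thesis by simp
qed

text \<open>Passage to ordinary series, for which Tannery's theorem is used below.\<close>

lemma infsum_int_suminf:
  fixes f :: "int \<Rightarrow> 'a :: banach"
  assumes "\<And>x. x < 0 \<Longrightarrow> f x = 0" "summable (\<lambda>n. norm (f (int n)))"
  shows "infsum f UNIV = (\<Sum>n. f (int n))"
proof -
  have "infsum f UNIV = infsum f (range int)"
    by (rule infsum_cong_neutral) (auto simp: image_iff intro!: assms(1) , metis nonneg_int_cases not_le)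
  also have "\<dots> = infsum (\<lambda>n. f (int n)) UNIV"
    by (subst infsum_reindex) (auto simp: o_def)
  also have "\<dots> = (\<Sum>n. f (int n))"
    using norm_summable_imp_has_sum[OF assms(2) summable_sums[OF summable_norm_cancel[OF assms(2)]]]
    by (rule infsumI)
  finally show ?thesis .
qed

lemma infsum_int_finite:
  fixes f :: "int \<Rightarrow> 'a :: {topological_comm_monoid_add, t2_space}"
  assumes "\<And>x. x < 0 \<or> x > int m \<Longrightarrow> f x = 0"
  shows "infsum f UNIV = (\<Sum>n\<le>m. f (int n))"
proof -
  have "infsum f UNIV = infsum f {0..int m}"
    by (rule infsum_cong_neutral) (use assms in auto)
  also have "\<dots> = (\<Sum>x\<in>{0..int m}. f x)" by simp
  also have "\<dots> = (\<Sum>n\<le>m. f (int n))"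
    by (rule sum.reindex_bij_witness[of _ int nat]) auto
  finally show ?thesis .
qed

lemma infsum_int_shift:
  fixes f :: "int \<Rightarrow> 'a :: {topological_comm_monoid_add, t2_space}"
  shows "infsum (\<lambda>x. f (x + c)) UNIV = infsum f UNIV"
  by (rule infsum_reindex_bij_witness[of _ "\<lambda>x. x - c" "\<lambda>x. x + c"]) auto

lemma summable_on_int_finite:
  fixes f :: "int \<Rightarrow> 'a :: {topological_comm_monoid_add, t2_space}"
  assumes "\<And>x. x < a \<or> x > b \<Longrightarrow> f x = 0"
  shows "f summable_on UNIV"
proof (rule finite_nonzero_values_imp_summable_on)
  have "{x \<in> UNIV. f x \<noteq> 0} \<subseteq> {a..b}" using assms by (auto simp: not_less[symmetric])
  thus "finite {x \<in> UNIV. f x \<noteq> 0}" by (rule finite_subset) simp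
qed

section \<open>Powers of q and domination by Gaussian series\<close>

locale nome =
  fixes q L :: complex
  assumes norm_q_pos: "0 < norm q" and norm_q_less: "norm q < 1" and exp_L: "exp L = q"
begin

abbreviation e :: "real \<Rightarrow> complex" where "e \<equiv> qpow L"
abbreviation iq :: "int \<Rightarrow> complex" where "iq \<equiv> iqp q"

lemma q_nonzero: "q \<noteq> 0" using norm_q_pos by auto

lemma e_add: "e (x + y) = e x * e y"
  by (simp add: qpow_def ring_distribs exp_add)

lemma e_0 [simp]: "e 0 = 1"
  by (simp add: qpow_def)

lemma e_nonzero [simp]: "e x \<noteq> 0"
  by (simp add: qpow_def)

lemma e_int: "e (of_int n) = q powi n"
proof -
  have "e (of_int n) = exp (of_int n * L)" by (simp add: qpow_def)
  also have "\<dots> = exp L powi n" by (simp add: exp_power_int)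
  finally show ?thesis by (simp add: exp_L)
qed

lemma norm_e: "norm (e x) = norm q powr x"
proof -
  have "norm q = exp (Re L)" by (simp flip: exp_L)
  thus ?thesis by (simp add: qpow_def norm_exp powr_def mult.commute)
qed

lemma norm_e_le_1: "x \<ge> 0 \<Longrightarrow> norm (e x) \<le> 1"
  using norm_q_pos norm_q_less by (simp add: norm_e powr_le1)

lemma norm_e_mono: "x \<le> y \<Longrightarrow> norm (e y) \<le> norm (e x)"
  using norm_q_pos norm_q_less by (simp add: norm_e powr_mono')

lemma iq_rec: "iq (n - 1) = (1 - e (of_int n)) * iq n"
  using iqp_rec[OF norm_q_less q_nonzero] by (simp add: e_int)

lemma iq_rec': "iq n = (1 - e (of_int n + 1)) * iq (n + 1)"
  using iq_rec[of "n + 1"] by simp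

lemma iq_0 [simp]: "iq 0 = 1"
  by (simp add: norm_q_less)

lemma iq_neg [simp]: "n < 0 \<Longrightarrow> iq n = 0"
  by (simp add: norm_q_less q_nonzero)

lemma iq_nonzero: "n \<ge> 0 \<Longrightarrow> iq n \<noteq> 0"
  by (simp add: iqp_nonzero norm_q_less q_nonzero)

definition iq_inf :: complex where "iq_inf = 1 / qpoch_inf q q"

lemma iq_inf_nonzero: "iq_inf \<noteq> 0"
  by (simp add: iq_inf_def qpoch_inf_nonzero norm_q_less)

lemma iq_tendsto: "(\<lambda>n. iq (int n)) \<longlonglongrightarrow> iq_inf"
  unfolding iq_inf_def by (rule iqp_tendsto[OF norm_q_less q_nonzero])

text \<open>Fixing one bound allows explicit domination constants such as
  \<open>iqB ^ M\<close>.\<close>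

definition iqB :: real where "iqB = (SOME B. B \<ge> 1 \<and> (\<forall>n. norm (iq n) \<le> B))"

lemma iqB: "iqB \<ge> 1" "norm (iq n) \<le> iqB"
proof -
  have "\<exists>B. B \<ge> 1 \<and> (\<forall>n. norm (iq n) \<le> B)"
    using iqp_bounded[OF norm_q_less q_nonzero] by metis
  hence "iqB \<ge> 1 \<and> (\<forall>n. norm (iq n) \<le> iqB)"
    unfolding iqB_def by (rule someI_ex)
  thus "iqB \<ge> 1" "norm (iq n) \<le> iqB" by auto
qed

lemma summable_gauss:
  fixes a b :: real
  assumes "a > 0"
  shows "(\<lambda>x::int. norm (e (a * (of_int x)\<^sup>2 + b * of_int x))) summable_on UNIV"
proof -
  \<comment> \<open>This is the maximum of (|b|+1) y - a y^2, attained at the \<open>t\<close>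
    below. The exponent is therefore at least |x| - c, and a geometric series dominates.\<close>
  define c where "c = (\<bar>b\<bar> + 1)\<^sup>2 / (4 * a)"
  have ineq: "a * (of_int x)\<^sup>2 + b * of_int x \<ge> - c + real (nat \<bar>x\<bar>)" for x :: int
  proof -
    define y :: real where "y = \<bar>of_int x\<bar>"
    define t where "t = (\<bar>b\<bar> + 1) / (2 * a)"
    have t: "2 * a * t = \<bar>b\<bar> + 1" "a * t\<^sup>2 = c"
      using assms by (simp_all add: t_def c_def power2_eq_square)
    have "0 \<le> a * (y - t)\<^sup>2" using assms by simp
    also have "\<dots> = a * y\<^sup>2 - (2 * a * t) * y + a * t\<^sup>2"
      by (simp add: power2_diff algebra_simps)
    also have "\<dots> = a * (of_int x)\<^sup>2 - \<bar>b\<bar> * y - y + c"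
      unfolding t by (simp add: y_def algebra_simps)
    also have "\<bar>b\<bar> * y = \<bar>b * of_int x\<bar>"
      by (simp add: y_def abs_mult)
    also have "a * (of_int x)\<^sup>2 - \<bar>b * of_int x\<bar> - y + c \<le> a * (of_int x)\<^sup>2 + b * of_int x - real (nat \<bar>x\<bar>) + c"
      by (simp add: y_def)
    finally show ?thesis by simp
  qed
  have "(\<lambda>x::int. norm (e (- c)) * norm q ^ nat \<bar>x\<bar>) summable_on UNIV"
    using norm_q_less by (intro summable_on_cmult_right summable_on_int_power_abs) auto
  thus ?thesis
  proof (rule summable_on_comparison_test)
    fix x :: int
    have "norm (e (a * (of_int x)\<^sup>2 + b * of_int x)) \<le> norm (e (- c + real (nat \<bar>x\<bar>)))"
      by (rule norm_e_mono[OF ineq])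
    also have "\<dots> = norm (e (- c)) * norm q ^ nat \<bar>x\<bar>"
      by (simp only: norm_e powr_add powr_realpow[OF norm_q_pos])
    finally show "norm (e (a * (of_int x)\<^sup>2 + b * of_int x)) \<le> norm (e (- c)) * norm q ^ nat \<bar>x\<bar>" .
  qed auto
qed

lemma summable_gauss_bounded:
  fixes a b :: real and f :: "int \<Rightarrow> complex"
  assumes "a > 0" "\<And>x. norm (f x) \<le> K * norm (e (a * (of_int x)\<^sup>2 + b * of_int x))"
  shows "f summable_on UNIV"
proof -
  have "(\<lambda>x. norm (f x)) summable_on UNIV"
    by (rule summable_on_comparison_test[OF summable_on_cmult_right[OF summable_gauss[OF assms(1)]]])
       (use assms(2) in auto)
  thus ?thesis by (rule abs_summable_summable)
qed

section \<open>Vandermonde and Heine sums\<close>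

text \<open>Split 1 - q^(n+1) as (1 - q^(n+1-k)) + q^(n+1-k) (1 - q^k) and absorb each bracket by
  \<open>iq_rec\<close>. This is the q-Pascal rule in a form valid for all integers n and k.\<close>

lemma iq_pascal:
  "(1 - e (of_int n + 1)) * (iq k * iq (n + 1 - k)) = iq k * iq (n - k) + e (of_int n + 1 - of_int k) * (iq (k - 1) * iq (n + 1 - k))"
proof -
  have 1: "iq (n - k) = (1 - e (of_int n + 1 - of_int k)) * iq (n + 1 - k)"
    using iq_rec[of "n + 1 - k"] by simp
  have 2: "e (of_int n + 1) = e (of_int n + 1 - of_int k) * e (of_int k)"
    by (simp flip: e_add)
  show ?thesis unfolding 1 iq_rec[of k] 2 by (simp add: algebra_simps)
qed

text \<open>The other q-Pascal rule, from the split q^k (1 - q^(n+1-k)) + (1 - q^k).\<close>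

lemma iq_pascal':
  "(1 - e (of_int n + 1)) * (iq k * iq (n + 1 - k)) = e (of_int k) * (iq k * iq (n - k)) + iq (k - 1) * iq (n + 1 - k)"
proof -
  have 1: "iq (n - k) = (1 - e (of_int n + 1 - of_int k)) * iq (n + 1 - k)"
    using iq_rec[of "n + 1 - k"] by simp
  have 2: "e (of_int n + 1) = e (of_int n + 1 - of_int k) * e (of_int k)"
    by (simp flip: e_add)
  show ?thesis unfolding 1 iq_rec[of k] 2 by (simp add: algebra_simps)
qed

lemma e_neq_1: "n > 0 \<Longrightarrow> e (of_int n) \<noteq> 1"
  using powi_neq_1[OF norm_q_less] by (simp add: e_int)

lemma e_Suc_neq_1: "1 - e (1 + real n) \<noteq> 0"
  using e_neq_1[of "int (Suc n)"] by simp

text \<open>The q-Chu-Vandermonde sum. Induction on n with d free: in the second Pascal term the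
  substitution t -> t + 1 raises d by one.\<close>

lemma q_vandermonde:
  "(\<Sum>t\<le>n. e (real t * (real t + of_int d)) * iq (int t) * iq (int t + d) * iq (int n - int t)) = iq (int n) * iq (int n + d)"
proof (induction n arbitrary: d)
  case 0
  show ?case by simp
next
  case (Suc n)
  let ?x = "1 - e (of_int (int n) + 1)"
  let ?f = "\<lambda>n d t. e (real t * (real t + of_int d)) * iq (int t) * iq (int t + d) * iq (int n - int t)"
  have "?x * (\<Sum>t\<le>Suc n. ?f (Suc n) d t) =
        (\<Sum>t\<le>Suc n. e (real t * (real t + of_int d)) * iq (int t + d) * (?x * (iq (int t) * iq (int n + 1 - int t))))"
    unfolding sum_distrib_left by (rule sum.cong) (auto simp: mult_ac add_ac)
  also have "\<dots> = (\<Sum>t\<le>Suc n. ?f n d t) +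
     (\<Sum>t\<le>Suc n. e (real t * (real t + of_int d) + (real n + 1 - real t)) * iq (int t + d) * (iq (int t - 1) * iq (int n + 1 - int t)))"
    unfolding iq_pascal sum.distrib[symmetric]
  proof (rule sum.cong[OF refl])
    fix t :: nat
    show "e (real t * (real t + of_int d)) * iq (int t + d) * (iq (int t) * iq (int n - int t) + e (of_int (int n) + 1 - of_int (int t)) * (iq (int t - 1) * iq (int n + 1 - int t)))
      = ?f n d t + e (real t * (real t + of_int d) + (real n + 1 - real t)) * iq (int t + d) * (iq (int t - 1) * iq (int n + 1 - int t))"
      unfolding e_add[of "real t * (real t + of_int d)"] by (simp add: ring_distribs mult_ac)
  qed
  also have "(\<Sum>t\<le>Suc n. ?f n d t) = (\<Sum>t\<le>n. ?f n d t)" by simp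
  also have "\<dots> = iq (int n) * iq (int n + d)" by (rule Suc.IH)
  also have "(\<Sum>t\<le>Suc n. e (real t * (real t + of_int d) + (real n + 1 - real t)) * iq (int t + d) * (iq (int t - 1) * iq (int n + 1 - int t)))
     = (\<Sum>t\<le>n. e (real (Suc t) * (real (Suc t) + of_int d) + (real n + 1 - real (Suc t))) * iq (int (Suc t) + d) * (iq (int (Suc t) - 1) * iq (int n + 1 - int (Suc t))))"
    by (subst sum.atMost_Suc_shift) simp
  also have "\<dots> = (\<Sum>t\<le>n. e (real n + 1 + of_int d) * ?f n (d + 1) t)"
  proof (rule sum.cong[OF refl])
    fix t
    have *: "real (Suc t) * (real (Suc t) + of_int d) + (real n + 1 - real (Suc t)) = (real n + 1 + of_int d) + real t * (real t + of_int (d + 1))"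
      by (simp add: algebra_simps)
    show "e (real (Suc t) * (real (Suc t) + of_int d) + (real n + 1 - real (Suc t))) * iq (int (Suc t) + d) * (iq (int (Suc t) - 1) * iq (int n + 1 - int (Suc t))) = e (real n + 1 + of_int d) * ?f n (d + 1) t"
      unfolding * e_add by (simp add: algebra_simps)
  qed
  also have "\<dots> = e (real n + 1 + of_int d) * (iq (int n) * iq (int n + d + 1))"
    unfolding sum_distrib_left[symmetric] Suc.IH by (simp add: add.assoc)
  also have "iq (int n) * iq (int n + d) + e (real n + 1 + of_int d) * (iq (int n) * iq (int n + d + 1))
     = iq (int n) * (iq (int n + d) + e (real n + 1 + of_int d) * iq (int n + d + 1))"
    by (simp add: algebra_simps)
  also have "iq (int n + d) + e (real n + 1 + of_int d) * iq (int n + d + 1) = iq (int n + d + 1)"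
    using iq_rec'[of "int n + d"] by (simp add: algebra_simps)
  also have "iq (int n) * iq (int n + d + 1) = ?x * (iq (int (Suc n)) * iq (int (Suc n) + d))"
    unfolding iq_rec'[of "int n"] by (simp add: mult_ac add_ac)
  finally show ?case using e_Suc_neq_1[of n] by (simp add: add.commute)
qed

lemma norm_iq_mult_le:
  assumes "norm a \<le> K"
  shows "norm (a * iq n) \<le> K * iqB"
  unfolding norm_mult using assms iqB by (intro mult_mono) (auto intro: order_trans[OF norm_ge_zero])

lemma durfee_aux:
  "(\<lambda>x::int. e ((of_int x)\<^sup>2 + c * of_int x) * iq x * iq (x + d)) summable_on UNIV"
proof (rule summable_gauss_bounded[of 1 _ "iqB * iqB" c])
  fix x :: int
  have "norm (e ((of_int x)\<^sup>2 + c * of_int x) * iq x * iq (x + d)) \<le> norm (e ((of_int x)\<^sup>2 + c * of_int x)) * iqB * iqB"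
    by (intro norm_iq_mult_le order_refl)
  thus "norm (e ((of_int x)\<^sup>2 + c * of_int x) * iq x * iq (x + d)) \<le> iqB * iqB * norm (e (1 * (of_int x)\<^sup>2 + c * of_int x))"
    by (simp add: mult_ac)
qed auto

lemma summable_int_nat: "f summable_on (UNIV :: int set) \<Longrightarrow> summable (\<lambda>n. norm (f (int n)))" for f :: "int \<Rightarrow> complex"
proof -
  assume "f summable_on UNIV"
  hence "f summable_on range int" by (rule summable_on_subset_banach) auto
  hence "(\<lambda>n. f (int n)) summable_on UNIV" by (subst (asm) summable_on_reindex) (auto simp: o_def)
  hence "(\<lambda>n. norm (f (int n))) summable_on UNIV"
    by (simp add: summable_on_iff_abs_summable_on_complex)
  thus ?thesis by (rule summable_on_imp_summable)
qed

text \<open>Tannery's theorem with majorant \<open>iqB\<close> times |b|. It sends n to infinity in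
  finite identities that contain 1/(q)_{n-k}.\<close>

lemma tendsto_infsum_iq:
  assumes b: "b summable_on UNIV" and neg: "\<And>x::int. x < 0 \<Longrightarrow> b x = 0"
  shows "(\<lambda>n. \<Sum>\<^sub>\<infinity>k. b k * iq (int n - k)) \<longlonglongrightarrow> infsum b UNIV * iq_inf"
proof -
  have sb: "summable (\<lambda>n. norm (b (int n)))" by (rule summable_int_nat[OF b])
  have lim: "(\<lambda>n. b (int k) * iq (int n - int k)) \<longlonglongrightarrow> b (int k) * iq_inf" for k
  proof (intro tendsto_intros)
    have "(\<lambda>n. iq (int (n + k) - int k)) \<longlonglongrightarrow> iq_inf"
      using iq_tendsto by simp
    thus "(\<lambda>n. iq (int n - int k)) \<longlonglongrightarrow> iq_inf"
      by (rule LIMSEQ_offset)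
  qed
  have "(\<lambda>n. \<Sum>k. b (int k) * iq (int n - int k)) \<longlonglongrightarrow> (\<Sum>k. b (int k) * iq_inf)"
  proof (rule conjunct2[OF conjunct2[OF tannerys_theorem]])
    show "\<forall>\<^sub>F (k, n) in at_top \<times>\<^sub>F sequentially. norm (b (int k) * iq (int n - int k)) \<le> norm (b (int k)) * iqB"
      by (intro always_eventually) (auto intro!: norm_iq_mult_le)
    show "summable (\<lambda>k. norm (b (int k)) * iqB)" by (rule summable_mult2[OF sb])
  qed (use lim in auto)
  moreover have "(\<Sum>k. b (int k) * iq (int n - int k)) = (\<Sum>\<^sub>\<infinity>k. b k * iq (int n - k))" for n
  proof (rule infsum_int_suminf[symmetric])
    show "summable (\<lambda>k. norm (b (int k) * iq (int n - int k)))"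
      by (rule summable_comparison_test'[OF summable_mult2[OF sb, of iqB]]) (auto intro!: norm_iq_mult_le)
  qed (auto simp: neg)
  moreover have "(\<Sum>k. b (int k) * iq_inf) = infsum b UNIV * iq_inf"
    using infsum_int_suminf[OF neg sb] suminf_mult2[OF summable_norm_cancel[OF sb]] by simp
  ultimately show ?thesis by simp
qed

lemma iq_tendsto_shift: "(\<lambda>n. iq (int n + d)) \<longlonglongrightarrow> iq_inf"
proof -
  have "(\<lambda>n. iq (int (n + nat \<bar>d\<bar>) + d)) = (\<lambda>n. iq (int (n + nat (\<bar>d\<bar> + d))))" by (simp add: add.assoc)
  also have "\<dots> \<longlonglongrightarrow> iq_inf" by (rule LIMSEQ_ignore_initial_segment[OF iq_tendsto])
  finally show "(\<lambda>n. iq (int n + d)) \<longlonglongrightarrow> iq_inf" by (rule LIMSEQ_offset)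
qed

text \<open>The limit n -> infinity of \<open>q_vandermonde\<close>, with one factor
  \<open>iq_inf\<close> cancelled; combinatorially, the dissection of partitions by Durfee
  rectangles.\<close>

lemma durfee:
  "(\<Sum>\<^sub>\<infinity>s::int. e ((of_int s)\<^sup>2 + of_int d * of_int s) * iq s * iq (s + d)) = iq_inf"
proof -
  define b where "b = (\<lambda>s::int. e ((of_int s)\<^sup>2 + of_int d * of_int s) * iq s * iq (s + d))"
  have "(\<lambda>n. \<Sum>\<^sub>\<infinity>k. b k * iq (int n - k)) \<longlonglongrightarrow> infsum b UNIV * iq_inf"
    by (rule tendsto_infsum_iq) (auto simp: b_def durfee_aux)
  moreover have "(\<Sum>\<^sub>\<infinity>k. b k * iq (int n - k)) = iq (int n) * iq (int n + d)" for n
  proof -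
    have "(\<Sum>\<^sub>\<infinity>k. b k * iq (int n - k)) = (\<Sum>k\<le>n. b (int k) * iq (int n - int k))"
      by (rule infsum_int_finite) (auto simp: b_def)
    also have "\<dots> = iq (int n) * iq (int n + d)"
      unfolding q_vandermonde[symmetric] b_def
      by (rule sum.cong) (auto simp: algebra_simps power2_eq_square)
    finally show ?thesis .
  qed
  moreover have "(\<lambda>n. iq (int n) * iq (int n + d)) \<longlonglongrightarrow> iq_inf * iq_inf"
    by (intro tendsto_intros iq_tendsto iq_tendsto_shift)
  ultimately have "infsum b UNIV * iq_inf = iq_inf * iq_inf" by (simp only: LIMSEQ_unique)
  thus ?thesis using iq_inf_nonzero by (simp add: b_def)
qed

text \<open>Both sides satisfy (1 - q^(p+1)) X(p+1,d) = X(p,d) + q^(p+1+d) X(p,d+1): the left one by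
  the Pascal rule, the right one by the recurrence for its last reciprocal. At p = 0 the claim is
  \<open>durfee\<close>.\<close>

lemma heine_finite:
  "iq_inf * (\<Sum>\<^sub>\<infinity>A::int. e ((of_int A)\<^sup>2 + of_int d * of_int A) * (iq A * iq (int p - A)))
   = iq (int p) * (\<Sum>\<^sub>\<infinity>s::int. e ((of_int s)\<^sup>2 + of_int d * of_int s) * iq s * iq (s + int p + d))"
proof (induction p arbitrary: d)
  case 0
  have "(\<Sum>\<^sub>\<infinity>A::int. e ((of_int A)\<^sup>2 + of_int d * of_int A) * (iq A * iq (int 0 - A))) =
       (\<Sum>A\<le>0. e ((of_int (int A))\<^sup>2 + of_int d * of_int (int A)) * (iq (int A) * iq (int 0 - int A)))"
    by (rule infsum_int_finite) auto
  thus ?case by (simp add: durfee)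
next
  case (Suc p)
  let ?x = "1 - e (of_int (int p) + 1)"
  let ?c = "e (1 + of_int d + real p)"
  define F where "F = (\<lambda>p d. \<Sum>\<^sub>\<infinity>A::int. e ((of_int A)\<^sup>2 + of_int d * of_int A) * (iq A * iq (int p - A)))"
  define G where "G = (\<lambda>p d. \<Sum>\<^sub>\<infinity>s::int. e ((of_int s)\<^sup>2 + of_int d * of_int s) * iq s * iq (s + int p + d))"
  have fin: "(\<lambda>A::int. e (g A) * (iq A * iq (m - A))) summable_on UNIV" for g m
    by (rule summable_on_int_finite[of 0 m]) auto
  have fin': "(\<lambda>A::int. e (g A) * (iq (A - 1) * iq (m - A))) summable_on UNIV" for g m
    by (rule summable_on_int_finite[of 0 m]) auto
  have "?x * F (Suc p) d = (\<Sum>\<^sub>\<infinity>A::int. ?x * (e ((of_int A)\<^sup>2 + of_int d * of_int A) * (iq A * iq (int (Suc p) - A))))"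
    unfolding F_def by (rule infsum_cmult_right'[symmetric])
  also have "\<dots> = (\<Sum>\<^sub>\<infinity>A::int. e ((of_int A)\<^sup>2 + of_int d * of_int A) * (iq A * iq (int p - A))
     + e ((of_int A)\<^sup>2 + of_int d * of_int A + (real p + 1 - of_int A)) * (iq (A - 1) * iq (int p + 1 - A)))"
  proof (rule infsum_cong)
    fix A :: int
    have "?x * (e ((of_int A)\<^sup>2 + of_int d * of_int A) * (iq A * iq (int (Suc p) - A)))
       = e ((of_int A)\<^sup>2 + of_int d * of_int A) * (?x * (iq A * iq (int p + 1 - A)))"
      by (simp add: mult_ac add_ac)
    also note iq_pascal
    finally show "?x * (e ((of_int A)\<^sup>2 + of_int d * of_int A) * (iq A * iq (int (Suc p) - A))) =
       e ((of_int A)\<^sup>2 + of_int d * of_int A) * (iq A * iq (int p - A))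
     + e ((of_int A)\<^sup>2 + of_int d * of_int A + (real p + 1 - of_int A)) * (iq (A - 1) * iq (int p + 1 - A))"
      unfolding e_add[of "(of_int A)\<^sup>2 + of_int d * of_int A"] by (simp add: ring_distribs mult_ac)
  qed
  also have "\<dots> = F p d + (\<Sum>\<^sub>\<infinity>A::int. e ((of_int A)\<^sup>2 + of_int d * of_int A + (real p + 1 - of_int A)) * (iq (A - 1) * iq (int p + 1 - A)))"
    unfolding F_def by (rule infsum_add[OF fin fin'])
  also have "(\<Sum>\<^sub>\<infinity>A::int. e ((of_int A)\<^sup>2 + of_int d * of_int A + (real p + 1 - of_int A)) * (iq (A - 1) * iq (int p + 1 - A)))
     = (\<Sum>\<^sub>\<infinity>A::int. ?c * (e ((of_int A)\<^sup>2 + of_int (d + 1) * of_int A) * (iq A * iq (int p - A))))"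
  proof (subst infsum_int_shift[of _ 1, symmetric], rule infsum_cong)
    fix A :: int
    have *: "(real_of_int (A + 1))\<^sup>2 + of_int d * of_int (A + 1) + (real p + 1 - of_int (A + 1)) = (1 + of_int d + real p) + ((of_int A)\<^sup>2 + of_int (d + 1) * of_int A)"
      by (simp add: algebra_simps power2_eq_square)
    show "e ((real_of_int (A + 1))\<^sup>2 + of_int d * of_int (A + 1) + (real p + 1 - of_int (A + 1))) * (iq (A + 1 - 1) * iq (int p + 1 - (A + 1))) = ?c * (e ((of_int A)\<^sup>2 + of_int (d + 1) * of_int A) * (iq A * iq (int p - A)))"
      unfolding * e_add[of "1 + of_int d + real p"] by simp
  qed
  also have "\<dots> = ?c * F p (d + 1)"
    unfolding F_def by (rule infsum_cmult_right')
  finally have F: "?x * F (Suc p) d = F p d + ?c * F p (d + 1)" .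
  have "G p d + ?c * G p (d + 1) = (\<Sum>\<^sub>\<infinity>s::int. e ((of_int s)\<^sup>2 + of_int d * of_int s) * iq s * iq (s + (int p + d))
     + ?c * (e ((of_int s)\<^sup>2 + of_int (d + 1) * of_int s) * iq s * iq (s + (int p + d + 1))))"
    unfolding G_def infsum_cmult_right'[symmetric] add.assoc
    by (subst infsum_add) (intro summable_on_cmult_right durfee_aux refl)+
  also have "\<dots> = G (Suc p) d"
    unfolding G_def
  proof (rule infsum_cong)
    fix s :: int
    have 1: "iq (s + (int p + d)) = (1 - e (of_int s + (1 + of_int d + real p))) * iq (s + int (Suc p) + d)"
      using iq_rec'[of "s + (int p + d)"] by (simp add: algebra_simps)
    have 2: "(of_int s)\<^sup>2 + of_int (d + 1) * of_int s = ((of_int s)\<^sup>2 + of_int d * of_int s) + real_of_int s"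
      by (simp add: algebra_simps)
    have 3: "s + (int p + d + 1) = s + int (Suc p) + d" by simp
    show "e ((of_int s)\<^sup>2 + of_int d * of_int s) * iq s * iq (s + (int p + d))
     + ?c * (e ((of_int s)\<^sup>2 + of_int (d + 1) * of_int s) * iq s * iq (s + (int p + d + 1))) = e ((of_int s)\<^sup>2 + of_int d * of_int s) * iq s * iq (s + int (Suc p) + d)"
      unfolding 1 2 3 e_add[of "of_int s" "1 + of_int d + real p"] e_add[of "(of_int s)\<^sup>2 + of_int d * of_int s" "of_int s"]
      by (simp only: ring_distribs mult_ac mult_1_right mult_1_left) simp
  qed
  finally have G: "G p d + ?c * G p (d + 1) = G (Suc p) d" .
  have IH: "iq_inf * F p d = iq (int p) * G p d" for d
    using Suc.IH unfolding F_def G_def .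
  have "?x * (iq_inf * F (Suc p) d) = iq_inf * (?x * F (Suc p) d)"
    by (simp only: mult_ac)
  also have "\<dots> = iq_inf * F p d + ?c * (iq_inf * F p (d + 1))"
    unfolding F by (simp add: ring_distribs mult_ac)
  also have "\<dots> = iq (int p) * G (Suc p) d"
    unfolding IH G[symmetric] by (simp add: algebra_simps)
  also have "iq (int p) = ?x * iq (int (Suc p))"
    using iq_rec'[of "int p"] by (simp add: add.commute)
  finally have "iq_inf * F (Suc p) d = iq (int (Suc p)) * G (Suc p) d"
    using e_Suc_neq_1[of p] by (simp add: add.commute)
  thus ?case unfolding F_def G_def .
qed

end

section \<open>Doubled variables and the transformation in one coordinate\<close>

lemma infsum_int_parity:
  fixes f :: "int \<Rightarrow> 'a :: {topological_comm_monoid_add, t2_space}"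
  assumes "\<And>y. odd (y - d) \<Longrightarrow> f y = 0"
  shows "infsum f UNIV = (\<Sum>\<^sub>\<infinity>s. f (d + 2 * s))"
proof -
  have "infsum f UNIV = infsum f (range (\<lambda>s. d + 2 * s))"
  proof (rule infsum_cong_neutral)
    fix y assume "y \<in> UNIV - range (\<lambda>s. d + 2 * s)"
    hence "y - d \<noteq> 2 * s" for s by (auto simp: image_iff algebra_simps)
    hence "odd (y - d)" unfolding dvd_def by blast
    thus "f y = 0" by (rule assms)
  qed auto
  also have "\<dots> = (\<Sum>\<^sub>\<infinity>s. f (d + 2 * s))"
    by (subst infsum_reindex) (auto simp: o_def inj_def)
  finally show ?thesis .
qed

lemma powi_minus1_Suc: "(-1) powi (k + 1) = - ((-1) powi k :: complex)"
  by (simp add: power_int_add)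

lemma norm_powi_minus1 [simp]: "norm ((-1) powi k :: complex) = 1"
  by (simp add: norm_power_int)

context nome
begin

text \<open>In \<open>E\<close> and \<open>theta\<close> all indices are doubled: \<open>E (2 * r) (2 * j)\<close> is $1/((q)_{r-j}(q)_{r+j})$,
  and \<open>\<epsilon>\<close> prescribes the parity of the doubled variable.\<close>

definition E :: "int \<Rightarrow> int \<Rightarrow> complex" where
  "E m J = (if even (m + J) then iq ((m - J) div 2) * iq ((m + J) div 2) else 0)"

definition theta :: "int \<Rightarrow> int \<Rightarrow> complex" where
  "theta \<epsilon> y = (if even (y - \<epsilon>) then e ((of_int y)\<^sup>2 / 4) else 0)"

lemma E_0: "E 0 J = of_bool (J = 0)"
  by (cases "J = 0"; cases "J > 0") (auto simp: E_def)

lemma E_neg: "m < 0 \<Longrightarrow> E m J = 0"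
  by (cases "J > 0") (auto simp: E_def)

lemma E_odd: "odd (m + J) \<Longrightarrow> E m J = 0"
  by (simp add: E_def)

lemma E_eq: "m - J = 2 * a \<Longrightarrow> m + J = 2 * b \<Longrightarrow> E m J = iq a * iq b"
  by (simp add: E_def)

lemma E_even: "E (2 * r) (2 * j) = iq (r - j) * iq (r + j)"
  by (rule E_eq) simp_all

lemma norm_E: "norm (E m J) \<le> iqB\<^sup>2"
proof -
  have "norm (iq a * iq b) \<le> iqB * iqB" for a b
    by (rule norm_iq_mult_le[OF iqB(2)])
  thus ?thesis by (simp add: E_def power2_eq_square)
qed

text \<open>With y = d + 2s and d = J - p the square y^2/4 becomes d^2/4 + s^2 + d s, and the claim
  is \<open>heine_finite\<close>; if p < 0 or the parities do not fit, all terms vanish. The point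
  is that y leaves the first argument of \<open>E\<close> and only moves the second, so the
  coordinate y can be summed out.\<close>

lemma conjugate_step:
  "iq p * (\<Sum>\<^sub>\<infinity>y. theta \<epsilon> y * E (p + y) J) = iq_inf * (\<Sum>\<^sub>\<infinity>y. theta \<epsilon> y * E p (J - y))"
proof -
  consider "p < 0" | "odd (J - p - \<epsilon>)" | "p \<ge> 0" "even (J - p - \<epsilon>)" by linarith
  thus ?thesis
  proof cases
    case 1
    thus ?thesis by (simp add: E_neg)
  next
    case 2
    have "theta \<epsilon> y * E (p + y) J = 0" "theta \<epsilon> y * E p (J - y) = 0" for y
      using 2 by (auto simp: theta_def E_def)
    thus ?thesis by (simp only: mult_zero_right infsum_0_simp)
  next
    case 3
    define d where "d = J - p"
    have J: "J = p + d" by (simp add: d_def)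
    have th: "theta \<epsilon> (d + 2 * s) = e ((of_int d)\<^sup>2 / 4) * e ((of_int s)\<^sup>2 + of_int d * of_int s)" for s
    proof -
      have "even (d + 2 * s - \<epsilon>)" using 3 by (simp add: d_def)
      moreover have "(real_of_int (d + 2 * s))\<^sup>2 = (of_int d)\<^sup>2 + 4 * ((of_int s)\<^sup>2 + of_int d * of_int s)"
        by (simp add: power2_eq_square algebra_simps)
      hence "(real_of_int (d + 2 * s))\<^sup>2 / 4 = (of_int d)\<^sup>2 / 4 + ((of_int s)\<^sup>2 + of_int d * of_int s)"
        by (simp only: add_divide_distrib) simp
      ultimately show ?thesis unfolding theta_def by (simp only: if_True e_add)
    qed
    have E1: "E (p + (d + 2 * s)) J = iq s * iq (s + p + d)" for s
    proof -
      show ?thesis by (rule E_eq) (simp_all add: J)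
    qed
    have E2: "E p (J - (d + 2 * s)) = iq s * iq (p - s)" for s
    proof -
      show ?thesis by (rule E_eq) (simp_all add: J)
    qed
    have "(\<Sum>\<^sub>\<infinity>y. theta \<epsilon> y * E (p + y) J) = (\<Sum>\<^sub>\<infinity>s. theta \<epsilon> (d + 2 * s) * E (p + (d + 2 * s)) J)"
      by (rule infsum_int_parity) (use 3 in \<open>auto simp: theta_def d_def\<close>)
    also have "\<dots> = e ((of_int d)\<^sup>2 / 4) * (\<Sum>\<^sub>\<infinity>s::int. e ((of_int s)\<^sup>2 + of_int d * of_int s) * iq s * iq (s + p + d))"
      unfolding th E1 by (simp add: mult.assoc infsum_cmult_right')
    finally have 1: "(\<Sum>\<^sub>\<infinity>y. theta \<epsilon> y * E (p + y) J) = \<dots>" .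
    have "(\<Sum>\<^sub>\<infinity>y. theta \<epsilon> y * E p (J - y)) = (\<Sum>\<^sub>\<infinity>s. theta \<epsilon> (d + 2 * s) * E p (J - (d + 2 * s)))"
      by (rule infsum_int_parity) (use 3 in \<open>auto simp: theta_def d_def\<close>)
    also have "\<dots> = e ((of_int d)\<^sup>2 / 4) * (\<Sum>\<^sub>\<infinity>s::int. e ((of_int s)\<^sup>2 + of_int d * of_int s) * (iq s * iq (p - s)))"
      unfolding th E2 by (simp add: mult.assoc infsum_cmult_right')
    finally have 2: "(\<Sum>\<^sub>\<infinity>y. theta \<epsilon> y * E p (J - y)) = \<dots>" .
    show ?thesis
      unfolding 1 2 using heine_finite[of d "nat p"] 3 by (simp add: mult.left_commute)
  qed
qed

section \<open>The $q$-binomial theorem\<close>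

text \<open>The expansion of $\left[{m+n\atop n}\right] = (q^{n+1};q)_m/(q)_m$ in powers of $q^n$.\<close>

definition qbs :: "int \<Rightarrow> int \<Rightarrow> complex" where
  "qbs m n = (\<Sum>\<^sub>\<infinity>k::int. (-1) powi k * e (of_int k * (of_int k + 1) / 2 + of_int k * of_int n) * (iq k * iq (m - k)))"

lemma qbs_summable: "(\<lambda>k::int. c k * (iq k * iq (m - k))) summable_on UNIV"
  by (rule summable_on_int_finite[of 0 m]) auto

lemma qbs_summable': "(\<lambda>k::int. c k * (iq (k - 1) * iq (m - k))) summable_on UNIV"
  by (rule summable_on_int_finite[of 0 m]) auto

text \<open>By \<open>iq_pascal'\<close> the first part is the series with n raised by one; the
  second part, reindexed by k -> k + 1, is -q^(n+1) times the same series.\<close>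

lemma qbs_rec: "(1 - e (of_int m + 1)) * qbs (m + 1) n = (1 - e (of_int n + 1)) * qbs m (n + 1)"
proof -
  define f where "f = (\<lambda>n k::int. (-1) powi k * e (of_int k * (of_int k + 1) / 2 + of_int k * of_int n))"
  have qbs: "qbs m n = (\<Sum>\<^sub>\<infinity>k. f n k * (iq k * iq (m - k)))" for m n
    by (simp add: qbs_def f_def)
  have "(1 - e (of_int m + 1)) * qbs (m + 1) n = (\<Sum>\<^sub>\<infinity>k. (1 - e (of_int m + 1)) * (f n k * (iq k * iq (m + 1 - k))))"
    unfolding qbs by (rule infsum_cmult_right'[symmetric])
  also have "\<dots> = (\<Sum>\<^sub>\<infinity>k. f (n + 1) k * (iq k * iq (m - k)) + f n k * (iq (k - 1) * iq (m + 1 - k)))"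
  proof (rule infsum_cong)
    fix k :: int
    have "(1 - e (of_int m + 1)) * (f n k * (iq k * iq (m + 1 - k))) = f n k * ((1 - e (of_int m + 1)) * (iq k * iq (m + 1 - k)))"
      by (simp only: mult_ac)
    also have "\<dots> = (f n k * e (of_int k)) * (iq k * iq (m - k)) + f n k * (iq (k - 1) * iq (m + 1 - k))"
      unfolding iq_pascal' by (simp only: ring_distribs mult_ac)
    also have "f n k * e (of_int k) = f (n + 1) k"
    proof -
      have "of_int k * (of_int k + 1) / 2 + of_int k * of_int (n + 1) = (of_int k * (of_int k + 1) / 2 + of_int k * of_int n) + real_of_int k"
        by (simp add: algebra_simps)
      thus ?thesis unfolding f_def by (simp only: e_add[of "of_int k * (of_int k + 1) / 2 + of_int k * of_int n" "of_int k"] mult.assoc)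
    qed
    finally show "(1 - e (of_int m + 1)) * (f n k * (iq k * iq (m + 1 - k))) = f (n + 1) k * (iq k * iq (m - k)) + f n k * (iq (k - 1) * iq (m + 1 - k))" .
  qed
  also have "\<dots> = qbs m (n + 1) + (\<Sum>\<^sub>\<infinity>k. f n k * (iq (k - 1) * iq (m + 1 - k)))"
    unfolding qbs by (rule infsum_add[OF qbs_summable qbs_summable'])
  also have "(\<Sum>\<^sub>\<infinity>k. f n k * (iq (k - 1) * iq (m + 1 - k))) = (\<Sum>\<^sub>\<infinity>k. (- e (of_int n + 1)) * (f (n + 1) k * (iq k * iq (m - k))))"
  proof (subst infsum_int_shift[of _ 1, symmetric], rule infsum_cong)
    fix k :: int
    have "f n (k + 1) = - e (of_int n + 1) * f (n + 1) k"
    proof -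
      have "of_int (k + 1) * (of_int (k + 1) + 1) = of_int k * (of_int k + 1) + 2 * (real_of_int k + 1)"
        by (simp add: algebra_simps)
      hence "of_int (k + 1) * (of_int (k + 1) + 1) / 2 = of_int k * (of_int k + 1) / 2 + (real_of_int k + 1)"
        by simp
      moreover have "of_int (k + 1) * of_int n + (real_of_int k + 1) = (of_int n + 1) + of_int k * real_of_int (n + 1)"
        by (simp add: algebra_simps)
      ultimately have "of_int (k + 1) * (of_int (k + 1) + 1) / 2 + of_int (k + 1) * of_int n = (of_int n + 1) + (of_int k * (of_int k + 1) / 2 + of_int k * real_of_int (n + 1))"
        by linarith
      thus ?thesis
        by (simp only: f_def e_add[of "of_int n + 1"] powi_minus1_Suc) (simp only: mult_ac mult_minus_left mult_minus_right)
    qed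
    thus "f n (k + 1) * (iq (k + 1 - 1) * iq (m + 1 - (k + 1))) = (- e (of_int n + 1)) * (f (n + 1) k * (iq k * iq (m - k)))"
      by simp
  qed
  also have "\<dots> = - e (of_int n + 1) * qbs m (n + 1)"
    unfolding qbs by (rule infsum_cmult_right')
  finally show ?thesis by (simp add: algebra_simps)
qed

lemma qbs_neg: "m < 0 \<Longrightarrow> qbs m n = 0"
proof -
  assume m: "m < 0"
  have "iq k * iq (m - k) = 0" for k using m by (cases "k < 0") auto
  thus ?thesis by (simp only: qbs_def mult_zero_right infsum_0_simp)
qed

text \<open>Stated as a product so that it holds for every integer n. For n + m < 0 it reads 0 = 0
  and says nothing about \<open>qbs\<close>, which is why \<open>qbinom_eq_qbs\<close> has a side
  condition.\<close>

lemma q_binomial: "qbs (int m) n * iq (n + int m) = iq (int m) * iq n"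
proof (induction m arbitrary: n)
  case 0
  have "qbs (int 0) n = (\<Sum>k\<le>0. (-1) powi (int k) * e (of_int (int k) * (of_int (int k) + 1) / 2 + of_int (int k) * of_int n) * (iq (int k) * iq (int 0 - int k)))"
    unfolding qbs_def by (rule infsum_int_finite) auto
  thus ?case by simp
next
  case (Suc m)
  let ?x = "1 - e (of_int (int m) + 1)"
  have "?x * (qbs (int (Suc m)) n * iq (n + int (Suc m))) = (?x * qbs (int m + 1) n) * iq (n + int (Suc m))"
    by (simp add: mult_ac add_ac)
  also have "\<dots> = (1 - e (of_int n + 1)) * (qbs (int m) (n + 1) * iq (n + 1 + int m))"
    unfolding qbs_rec by (simp add: mult_ac add_ac)
  also have "\<dots> = ((1 - e (of_int n + 1)) * iq (n + 1)) * iq (int m)"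
    unfolding Suc.IH by (simp only: mult_ac)
  also have "(1 - e (of_int n + 1)) * iq (n + 1) = iq n"
    by (rule iq_rec'[symmetric])
  also have "iq n * iq (int m) = ?x * (iq (int (Suc m)) * iq n)"
    unfolding iq_rec'[of "int m"] by (simp add: mult_ac add_ac)
  finally show ?case using e_Suc_neq_1[of m] by (simp add: add.commute)
qed

lemma euler_summable:
  "(\<lambda>k::int. (-1) powi k * e (of_int k * (of_int k + 1) / 2 + of_int k * of_int n) * iq k) summable_on UNIV"
proof (rule summable_gauss_bounded[of "1/2" _ iqB "of_int n + 1/2"])
  fix k :: int
  have "norm ((-1) powi k * e (of_int k * (of_int k + 1) / 2 + of_int k * of_int n) * iq k) \<le> norm (e (of_int k * (of_int k + 1) / 2 + of_int k * of_int n)) * iqB"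
    by (rule norm_iq_mult_le) (simp add: norm_mult)
  also have "\<dots> = iqB * norm (e (1/2 * (of_int k)\<^sup>2 + (of_int n + 1/2) * of_int k))"
  proof -
    have "of_int k * (of_int k + 1) = (of_int k)\<^sup>2 + real_of_int k"
      by (simp add: power2_eq_square algebra_simps)
    hence "of_int k * (of_int k + 1) / 2 + of_int k * of_int n = 1/2 * (of_int k)\<^sup>2 + (of_int n + 1/2) * real_of_int k"
      by (simp add: add_divide_distrib algebra_simps)
    thus ?thesis by (simp only: mult.commute)
  qed
  finally show "norm ((-1) powi k * e (of_int k * (of_int k + 1) / 2 + of_int k * of_int n) * iq k) \<le> iqB * norm (e (1/2 * (of_int k)\<^sup>2 + (of_int n + 1/2) * of_int k))" .
qed auto

text \<open>The limit m -> infinity of \<open>q_binomial\<close>: Euler's expansion of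
  (q^(n+1))_infinity, equal to (q)_infinity/(q)_n.\<close>

lemma euler:
  "iq_inf * (\<Sum>\<^sub>\<infinity>k::int. (-1) powi k * e (of_int k * (of_int k + 1) / 2 + of_int k * of_int n) * iq k) = iq n"
proof -
  define b where "b = (\<lambda>k::int. (-1) powi k * e (of_int k * (of_int k + 1) / 2 + of_int k * of_int n) * iq k)"
  have "(\<lambda>m. \<Sum>\<^sub>\<infinity>k. b k * iq (int m - k)) \<longlonglongrightarrow> infsum b UNIV * iq_inf"
    by (rule tendsto_infsum_iq) (auto simp: b_def euler_summable)
  hence "(\<lambda>m. qbs (int m) n) \<longlonglongrightarrow> infsum b UNIV * iq_inf"
    by (simp add: qbs_def b_def mult.assoc)
  hence "(\<lambda>m. qbs (int m) n * iq (int m + n)) \<longlonglongrightarrow> (infsum b UNIV * iq_inf) * iq_inf"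
    by (intro tendsto_mult iq_tendsto_shift)
  moreover have "(\<lambda>m. qbs (int m) n * iq (int m + n)) = (\<lambda>m. iq (int m) * iq n)"
    using q_binomial by (simp add: add.commute)
  moreover have "(\<lambda>m. iq (int m) * iq n) \<longlonglongrightarrow> iq_inf * iq n"
    by (intro tendsto_intros iq_tendsto)
  ultimately have "(infsum b UNIV * iq_inf) * iq_inf = iq_inf * iq n"
    using LIMSEQ_unique by metis
  thus ?thesis using iq_inf_nonzero by (simp add: b_def mult_ac)
qed

lemma qbinom_eq: "qbinom q m n = (if m \<ge> 0 \<and> n \<ge> 0 then iq m * iq n / iq (m + n) else 0)"
  by (simp add: qbinom_def iqp_def)

text \<open>For n < 0 <= m + n both are 0, since (q^(n+1);q)_m then contains the factor 1 - q^0. For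
  m >= 0 and m + n < 0 no factor vanishes, and the two sides really differ.\<close>

lemma qbinom_eq_qbs:
  assumes "m < 0 \<or> m + n \<ge> 0"
  shows "qbinom q m n = qbs m n"
proof (cases "m < 0")
  case True
  thus ?thesis by (simp add: qbs_neg qbinom_def)
next
  case False
  with assms have "m \<ge> 0" "m + n \<ge> 0" by auto
  hence "qbs m n * iq (m + n) = iq m * iq n" "iq (m + n) \<noteq> 0"
    using q_binomial[of "nat m" n] by (auto simp: add.commute iq_nonzero)
  hence "qbs m n = iq m * iq n / iq (m + n)" by (simp add: field_simps)
  thus ?thesis using \<open>m \<ge> 0\<close> by (auto simp: qbinom_eq)
qed

end

section \<open>Sums over integer lattices\<close>

lemma summable_on_norm_bound:
  fixes f :: "'a \<Rightarrow> complex" and g :: "'a \<Rightarrow> real"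
  assumes "g summable_on A" "\<And>x. x \<in> A \<Longrightarrow> norm (f x) \<le> g x"
  shows "f summable_on A"
proof -
  have "(\<lambda>x. norm (f x)) summable_on A"
    by (rule summable_on_comparison_test[OF assms(1)]) (use assms(2) in auto)
  thus ?thesis by (rule abs_summable_summable)
qed

lemma summable_on_mult_bounded:
  fixes f w :: "'a \<Rightarrow> complex"
  assumes "f summable_on A" "\<And>x. x \<in> A \<Longrightarrow> norm (w x) \<le> K"
  shows "(\<lambda>x. f x * w x) summable_on A"
proof (rule summable_on_norm_bound)
  show "(\<lambda>x. norm (f x) * K) summable_on A"
    using assms(1) by (intro summable_on_cmult_left) (simp add: summable_on_iff_abs_summable_on_complex)
  show "norm (f x * w x) \<le> norm (f x) * K" if "x \<in> A" for x
    using assms(2)[OF that] by (simp add: norm_mult mult_left_mono)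
qed

lemma summable_on_times:
  fixes f :: "'a \<Rightarrow> complex" and g :: "'b \<Rightarrow> complex"
  assumes "f summable_on A" "g summable_on B"
  shows "(\<lambda>(x, y). f x * g y) summable_on (A \<times> B)"
proof -
  have f: "(\<lambda>x. norm (f x)) summable_on A" and g: "(\<lambda>x. norm (g x)) summable_on B"
    using assms by (simp_all add: summable_on_iff_abs_summable_on_complex)
  have *: "(\<Sum>\<^sub>\<infinity>y\<in>B. norm (f x * g y)) = norm (f x) * (\<Sum>\<^sub>\<infinity>y\<in>B. norm (g y))" for x
    by (simp add: norm_mult infsum_cmult_right')
  have "0 \<le> (\<Sum>\<^sub>\<infinity>y\<in>B. norm (g y))" by (rule infsum_nonneg) auto
  hence "(\<lambda>x. norm (\<Sum>\<^sub>\<infinity>y\<in>B. norm (f x * g y))) summable_on A"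
    unfolding * using f by (simp add: abs_mult summable_on_cmult_left)
  moreover have "(\<lambda>y. norm (f x * g y)) summable_on B" for x
    unfolding norm_mult using g by (rule summable_on_cmult_right)
  ultimately have "(\<lambda>z. norm ((\<lambda>(x, y). f x * g y) z)) summable_on (A \<times> B)"
    unfolding Infinite_Sum.abs_summable_on_Sigma_iff by simp
  thus ?thesis by (rule abs_summable_summable)
qed

lemma infsum_times:
  fixes f :: "'a \<Rightarrow> complex" and g :: "'b \<Rightarrow> complex"
  assumes "f summable_on A" "g summable_on B"
  shows "infsum (\<lambda>(x, y). f x * g y) (A \<times> B) = infsum f A * infsum g B"
  by (subst infsum_Sigma'_banach[OF summable_on_times[OF assms], symmetric])
     (simp add: infsum_cmult_left' infsum_cmult_right')

text \<open>Vectors in $\mathbb Z^n$ with components $1,\dots,n$, padded by \<open>0\<close> so that boundary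
  conventions like $k_0 = k_N = 0$ hold by themselves.\<close>

definition Zn :: "nat \<Rightarrow> (nat \<Rightarrow> int) set" where
  "Zn n = {f. \<forall>a. a \<notin> {1..n} \<longrightarrow> f a = 0}"

lemma Zn_D: "f \<in> Zn n \<Longrightarrow> a < 1 \<or> a > n \<Longrightarrow> f a = 0"
  by (auto simp: Zn_def)

lemma Zn_0: "Zn 0 = {\<lambda>_. 0}"
  by (auto simp: Zn_def)

lemma bij_betw_Zn_Suc: "bij_betw (\<lambda>(f, x). f(Suc n := x)) (Zn n \<times> UNIV) (Zn (Suc n))"
proof (rule bij_betw_byWitness[where f' = "\<lambda>g. (g(Suc n := 0), g (Suc n))"])
  show "\<forall>z\<in>Zn n \<times> UNIV. (((case z of (f, x) \<Rightarrow> f(Suc n := x))(Suc n := 0)), (case z of (f, x) \<Rightarrow> f(Suc n := x)) (Suc n)) = z"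
    by (auto simp: Zn_def fun_upd_idem)
qed (auto simp: Zn_def)

lemma summable_on_Zn_Suc:
  "F summable_on Zn (Suc n) \<longleftrightarrow> (\<lambda>(f, x). F (f(Suc n := x))) summable_on (Zn n \<times> UNIV)"
  using summable_on_reindex_bij_betw[OF bij_betw_Zn_Suc, of F n] by (simp add: case_prod_unfold)

lemma infsum_Zn_Suc:
  "infsum F (Zn (Suc n)) = infsum (\<lambda>(f, x). F (f(Suc n := x))) (Zn n \<times> UNIV)"
  using infsum_reindex_bij_betw[OF bij_betw_Zn_Suc, of F n] by (simp add: case_prod_unfold)

lemma prod_fun_upd_Suc:
  "(\<Prod>a=1..Suc n. g a ((f(Suc n := x)) a)) = (\<Prod>a=1..n. g a (f a)) * g (Suc n) x"
  for g :: "nat \<Rightarrow> int \<Rightarrow> 'a :: comm_monoid_mult"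
proof -
  have "(\<Prod>a=1..n. g a ((f(Suc n := x)) a)) = (\<Prod>a=1..n. g a (f a))"
    by (rule prod.cong) auto
  thus ?thesis by simp
qed

lemma Zn_prod:
  fixes g :: "nat \<Rightarrow> int \<Rightarrow> complex"
  assumes "\<And>a. a \<in> {1..n} \<Longrightarrow> g a summable_on UNIV"
  shows "(\<lambda>f. \<Prod>a=1..n. g a (f a)) summable_on Zn n"
    and "(\<Sum>\<^sub>\<infinity>f\<in>Zn n. \<Prod>a=1..n. g a (f a)) = (\<Prod>a=1..n. infsum (g a) UNIV)"
proof -
  have "(\<lambda>f. \<Prod>a=1..n. g a (f a)) summable_on Zn n \<and>
        (\<Sum>\<^sub>\<infinity>f\<in>Zn n. \<Prod>a=1..n. g a (f a)) = (\<Prod>a=1..n. infsum (g a) UNIV)"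
    using assms
  proof (induction n)
    case 0
    show ?case by (simp add: Zn_0)
  next
    case (Suc n)
    hence IH: "(\<lambda>f. \<Prod>a=1..n. g a (f a)) summable_on Zn n"
       "(\<Sum>\<^sub>\<infinity>f\<in>Zn n. \<Prod>a=1..n. g a (f a)) = (\<Prod>a=1..n. infsum (g a) UNIV)" by auto
    have g: "g (Suc n) summable_on UNIV" using Suc.prems by simp
    show ?case
      unfolding summable_on_Zn_Suc infsum_Zn_Suc prod_fun_upd_Suc
      using summable_on_times[OF IH(1) g] infsum_times[OF IH(1) g] by (simp add: IH(2) del: One_nat_def)
  qed
  thus "(\<lambda>f. \<Prod>a=1..n. g a (f a)) summable_on Zn n"
    and "(\<Sum>\<^sub>\<infinity>f\<in>Zn n. \<Prod>a=1..n. g a (f a)) = (\<Prod>a=1..n. infsum (g a) UNIV)" by auto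
qed

section \<open>Products of theta terms on the lattice\<close>

definition psum :: "(nat \<Rightarrow> int) \<Rightarrow> nat \<Rightarrow> int" where
  "psum y a = (\<Sum>b=1..a. y b)"

lemma psum_0 [simp]: "psum y 0 = 0" by (simp add: psum_def)

lemma psum_Suc [simp]: "psum y (Suc a) = psum y a + y (Suc a)" by (simp add: psum_def)

lemma psum_fun_upd: "a \<le> n \<Longrightarrow> psum (f(Suc n := x)) a = psum f a"
  by (auto simp: psum_def intro!: sum.cong)

context nome
begin

definition Theta :: "(nat \<Rightarrow> int) \<Rightarrow> nat \<Rightarrow> (nat \<Rightarrow> int) \<Rightarrow> complex" where
  "Theta \<epsilon> N y = (\<Prod>a=1..N. theta (\<epsilon> a) (y a))"

lemma norm_theta_le: "norm (theta \<epsilon> y) \<le> norm (e (1/4 * (of_int y)\<^sup>2 + 0 * of_int y))"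
  by (simp add: theta_def)

lemma summable_theta: "theta \<epsilon> summable_on UNIV"
  by (rule summable_gauss_bounded[of "1/4" _ 1 0]) (use norm_theta_le in auto)

lemma summable_Theta: "Theta \<epsilon> N summable_on Zn N"
  unfolding Theta_def[abs_def] by (rule Zn_prod) (rule summable_theta)

lemma Theta_Suc: "Theta \<epsilon> (Suc N) (f(Suc N := x)) = Theta \<epsilon> N f * theta (\<epsilon> (Suc N)) x"
  unfolding Theta_def by (rule prod_fun_upd_Suc)

lemma norm_prod_iq: "norm (\<Prod>a\<in>A. iq (h a)) \<le> iqB ^ card A"
proof (cases "finite A")
  case True
  have "norm (\<Prod>a\<in>A. iq (h a)) \<le> (\<Prod>a\<in>A. iqB)"
    unfolding prod_norm[symmetric] by (rule prod_mono) (auto simp: iqB)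
  with True show ?thesis by simp
qed auto

lemma norm_prod_iq_E: "norm ((\<Prod>a\<in>A. iq (h a)) * E m J) \<le> iqB ^ card A * iqB\<^sup>2"
  unfolding norm_mult by (intro mult_mono norm_prod_iq norm_E) (use iqB in auto)

lemma summable_ThetaE:
  "(\<lambda>y. Theta \<epsilon> N y * ((\<Prod>a<N. iq (psum y a)) * E (psum y N) J)) summable_on Zn N"
  by (rule summable_on_mult_bounded[OF summable_Theta]) (rule norm_prod_iq_E)

lemma summable_ThetaI:
  "(\<lambda>y. Theta \<epsilon> N y * of_bool (psum y N = J)) summable_on Zn N"
  by (rule summable_on_mult_bounded[OF summable_Theta, where K = 1]) auto

text \<open>Summing out $y_N, y_{N-1}, \dots$ one after the other, each by \<open>conjugate_step\<close>.\<close>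

lemma multi_theta_identity:
  "(\<Sum>\<^sub>\<infinity>y\<in>Zn N. Theta \<epsilon> N y * ((\<Prod>a<N. iq (psum y a)) * E (psum y N) J))
   = iq_inf ^ N * (\<Sum>\<^sub>\<infinity>y\<in>Zn N. Theta \<epsilon> N y * of_bool (psum y N = J))"
proof (induction N arbitrary: J)
  case 0
  show ?case by (cases "J = 0") (simp_all add: Zn_0 Theta_def E_0)
next
  case (Suc N)
  let ?t = "theta (\<epsilon> (Suc N))"
  define P where "P = (\<lambda>f. Theta \<epsilon> N f * (\<Prod>a<N. iq (psum f a)))"
  have prod: "(\<Prod>a<Suc N. iq (psum (f(Suc N := x)) a)) = (\<Prod>a<N. iq (psum f a)) * iq (psum f N)" for f x
  proof -
    have "(\<Prod>a<Suc N. iq (psum (f(Suc N := x)) a)) = (\<Prod>a<Suc N. iq (psum f a))"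
      by (rule prod.cong) (auto simp: psum_fun_upd)
    thus ?thesis by simp
  qed
  have sum1: "(\<lambda>(f, x). P f * ?t x * (iq (psum f N) * E (psum f N + x) J)) summable_on (Zn N \<times> UNIV)"
    using summable_ThetaE[of \<epsilon> "Suc N" J]
    unfolding summable_on_Zn_Suc prod Theta_Suc psum_Suc by (simp add: P_def psum_fun_upd mult_ac)
  have "P summable_on Zn N"
    unfolding P_def by (rule summable_on_mult_bounded[OF summable_Theta]) (rule norm_prod_iq)
  hence "(\<lambda>(f, x). P f * ?t x) summable_on (Zn N \<times> UNIV)"
    by (rule summable_on_times[OF _ summable_theta])
  hence "(\<lambda>z. (case z of (f, x) \<Rightarrow> P f * ?t x) * (case z of (f, x) \<Rightarrow> E (psum f N) (J - x))) summable_on (Zn N \<times> UNIV)"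
    by (rule summable_on_mult_bounded[where K = "iqB\<^sup>2"]) (auto simp: norm_E)
  hence sum2: "(\<lambda>(f, x). P f * ?t x * E (psum f N) (J - x)) summable_on (Zn N \<times> UNIV)"
    by (simp add: case_prod_unfold)
  have sum3: "(\<lambda>(f, x). Theta \<epsilon> N f * ?t x * of_bool (psum f N + x = J)) summable_on (Zn N \<times> UNIV)"
    using summable_ThetaI[of \<epsilon> "Suc N" J]
    unfolding summable_on_Zn_Suc Theta_Suc psum_Suc by (simp add: psum_fun_upd)
  have "(\<Sum>\<^sub>\<infinity>y\<in>Zn (Suc N). Theta \<epsilon> (Suc N) y * ((\<Prod>a<Suc N. iq (psum y a)) * E (psum y (Suc N)) J))
      = infsum (\<lambda>(f, x). P f * ?t x * (iq (psum f N) * E (psum f N + x) J)) (Zn N \<times> UNIV)"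
    unfolding infsum_Zn_Suc prod Theta_Suc psum_Suc by (simp add: P_def psum_fun_upd mult_ac)
  also have "\<dots> = (\<Sum>\<^sub>\<infinity>f\<in>Zn N. \<Sum>\<^sub>\<infinity>x. P f * ?t x * (iq (psum f N) * E (psum f N + x) J))"
    by (rule infsum_Sigma'_banach[OF sum1, symmetric])
  \<comment> \<open>For fixed f the last reciprocal \<open>iq (psum f N)\<close> is the prefactor
    that \<open>conjugate_step\<close> needs; it is traded for one factor
    \<open>iq_inf\<close>.\<close>
  also have "\<dots> = (\<Sum>\<^sub>\<infinity>f\<in>Zn N. \<Sum>\<^sub>\<infinity>x. iq_inf * (P f * ?t x * E (psum f N) (J - x)))"
  proof (rule infsum_cong)
    fix f
    have "(\<Sum>\<^sub>\<infinity>x. P f * ?t x * (iq (psum f N) * E (psum f N + x) J))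
        = (\<Sum>\<^sub>\<infinity>x. P f * iq (psum f N) * (?t x * E (psum f N + x) J))"
      by (simp add: mult_ac)
    also have "\<dots> = P f * (iq (psum f N) * (\<Sum>\<^sub>\<infinity>x. ?t x * E (psum f N + x) J))"
      by (simp only: infsum_cmult_right' mult.assoc)
    also have "\<dots> = (P f * iq_inf) * (\<Sum>\<^sub>\<infinity>x. ?t x * E (psum f N) (J - x))"
      by (simp only: conjugate_step mult.assoc)
    also have "\<dots> = (\<Sum>\<^sub>\<infinity>x. (P f * iq_inf) * (?t x * E (psum f N) (J - x)))"
      by (rule infsum_cmult_right'[symmetric])
    finally show "(\<Sum>\<^sub>\<infinity>x. P f * ?t x * (iq (psum f N) * E (psum f N + x) J)) = (\<Sum>\<^sub>\<infinity>x. iq_inf * (P f * ?t x * E (psum f N) (J - x)))"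
      by (simp only: mult_ac)
  qed
  also have "\<dots> = iq_inf * (\<Sum>\<^sub>\<infinity>f\<in>Zn N. \<Sum>\<^sub>\<infinity>x. P f * ?t x * E (psum f N) (J - x))"
    by (simp only: infsum_cmult_right')
  \<comment> \<open>After the exchange the last coordinate x is fixed, and the induction hypothesis
    applies with J - x in place of J.\<close>
  also have "(\<Sum>\<^sub>\<infinity>f\<in>Zn N. \<Sum>\<^sub>\<infinity>x. P f * ?t x * E (psum f N) (J - x)) = (\<Sum>\<^sub>\<infinity>x. \<Sum>\<^sub>\<infinity>f\<in>Zn N. P f * ?t x * E (psum f N) (J - x))"
    by (rule infsum_swap_banach[OF sum2])
  also have "\<dots> = (\<Sum>\<^sub>\<infinity>x. \<Sum>\<^sub>\<infinity>f\<in>Zn N. iq_inf ^ N * (Theta \<epsilon> N f * ?t x * of_bool (psum f N + x = J)))"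
  proof (rule infsum_cong)
    fix x
    have "(\<Sum>\<^sub>\<infinity>f\<in>Zn N. P f * ?t x * E (psum f N) (J - x)) = (\<Sum>\<^sub>\<infinity>f\<in>Zn N. ?t x * (Theta \<epsilon> N f * ((\<Prod>a<N. iq (psum f a)) * E (psum f N) (J - x))))"
      by (simp add: P_def mult_ac)
    also have "\<dots> = ?t x * (iq_inf ^ N * (\<Sum>\<^sub>\<infinity>y\<in>Zn N. Theta \<epsilon> N y * of_bool (psum y N = J - x)))"
      by (simp only: infsum_cmult_right' Suc.IH)
    also have "\<dots> = (\<Sum>\<^sub>\<infinity>y\<in>Zn N. ?t x * (iq_inf ^ N * (Theta \<epsilon> N y * of_bool (psum y N = J - x))))"
      by (simp only: infsum_cmult_right')
    also have "\<dots> = (\<Sum>\<^sub>\<infinity>f\<in>Zn N. iq_inf ^ N * (Theta \<epsilon> N f * ?t x * of_bool (psum f N + x = J)))"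
      by (rule infsum_cong) (auto simp: algebra_simps)
    finally show "(\<Sum>\<^sub>\<infinity>f\<in>Zn N. P f * ?t x * E (psum f N) (J - x)) = (\<Sum>\<^sub>\<infinity>f\<in>Zn N. iq_inf ^ N * (Theta \<epsilon> N f * ?t x * of_bool (psum f N + x = J)))" .
  qed
  also have "\<dots> = iq_inf ^ N * (\<Sum>\<^sub>\<infinity>x. \<Sum>\<^sub>\<infinity>f\<in>Zn N. Theta \<epsilon> N f * ?t x * of_bool (psum f N + x = J))"
    by (simp only: infsum_cmult_right')
  also have "(\<Sum>\<^sub>\<infinity>x. \<Sum>\<^sub>\<infinity>f\<in>Zn N. Theta \<epsilon> N f * ?t x * of_bool (psum f N + x = J))
      = (\<Sum>\<^sub>\<infinity>f\<in>Zn N. \<Sum>\<^sub>\<infinity>x. Theta \<epsilon> N f * ?t x * of_bool (psum f N + x = J))"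
    by (rule infsum_swap_banach[OF sum3, symmetric])
  also have "\<dots> = infsum (\<lambda>(f, x). Theta \<epsilon> N f * ?t x * of_bool (psum f N + x = J)) (Zn N \<times> UNIV)"
    by (rule infsum_Sigma'_banach[OF sum3])
  also have "\<dots> = (\<Sum>\<^sub>\<infinity>y\<in>Zn (Suc N). Theta \<epsilon> (Suc N) y * of_bool (psum y (Suc N) = J))"
    unfolding infsum_Zn_Suc Theta_Suc psum_Suc by (simp add: psum_fun_upd)
  finally show ?case by (simp add: mult_ac)
qed

end

section \<open>The shifted expansions\<close>

text \<open>Adding \<open>bdiff k\<close> to y raises each partial sum m_a by k_a and fixes the
  total when k_0 = k_N = 0. At a = 0 truncated subtraction gives 0, in accordance with the
  padding.\<close>

definition bdiff :: "(nat \<Rightarrow> int) \<Rightarrow> nat \<Rightarrow> int" where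
  "bdiff k a = k a - k (a - 1)"

lemma bdiff_Zn: "k \<in> Zn M \<Longrightarrow> bdiff k \<in> Zn (Suc M)"
proof -
  assume k: "k \<in> Zn M"
  have "bdiff k a = 0" if "a \<notin> {1..Suc M}" for a
    using that by (cases "a = 0") (auto simp: bdiff_def Zn_D[OF k])
  thus ?thesis by (simp add: Zn_def)
qed

lemma psum_diff: "psum (\<lambda>a. y a - z a) n = psum y n - psum z n"
  by (simp add: psum_def sum_subtractf)

lemma psum_bdiff: "psum (bdiff k) a = k a - k 0"
  by (induction a) (auto simp: bdiff_def)

lemma Zn_add: "y \<in> Zn n \<Longrightarrow> z \<in> Zn n \<Longrightarrow> (\<lambda>a. y a + z a) \<in> Zn n"
  by (auto simp: Zn_def)

lemma Zn_diff: "y \<in> Zn n \<Longrightarrow> z \<in> Zn n \<Longrightarrow> (\<lambda>a. y a - z a) \<in> Zn n"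
  by (auto simp: Zn_def)

text \<open>The occupation numbers $n_a$, respectively $\eta_a$, of a lattice point \<open>y\<close>; the corresponding $m_a$ are the
  partial sums of \<open>y\<close>.\<close>

definition occ :: "(nat \<Rightarrow> int) \<Rightarrow> (nat \<Rightarrow> int) \<Rightarrow> nat \<Rightarrow> int" where
  "occ l y a = (l a + y (Suc a) - y a) div 2"

text \<open>The mixed terms k_a y_b from the squares cancel against those from the Euler exponents,
  so that the y-part and the k-part separate. The terms with k_{M+1} are needed for the induction
  only up to the end, where k_{M+1} = 0 for k in \<open>Zn M\<close>.\<close>

lemma square_completion:
  fixes y k :: "nat \<Rightarrow> real"
  assumes "k 0 = 0"
  shows "(\<Sum>a=1..Suc M. (y a + (k a - k (a - 1)))\<^sup>2 / 4)
       + (\<Sum>a=1..M. k a * (k a + 1) / 2 + k a * ((l a + (y (Suc a) + (k (Suc a) - k a)) - (y a + (k a - k (a - 1)))) / 2))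
       = (\<Sum>a=1..Suc M. (y a)\<^sup>2 / 4) + (\<Sum>a=1..M. k a * (1 + l a) / 2 + k a * k (Suc a) / 2)
         + (k (Suc M))\<^sup>2 / 4 + y (Suc M) * k (Suc M) / 2 - k (Suc M) * k M / 2"
proof (induction M)
  case 0
  show ?case using assms by (simp add: power2_eq_square algebra_simps add_divide_distrib)
next
  case (Suc M)
  show ?case
    unfolding sum.cl_ivl_Suc[of _ 1 "Suc M"] sum.cl_ivl_Suc[of _ 1 "Suc (Suc M)"] sum.cl_ivl_Suc[of _ 1 M]
    using Suc.IH[unfolded sum.cl_ivl_Suc[of _ 1 M]]
    by (simp add: power2_eq_square algebra_simps add_divide_distrib diff_divide_distrib)
qed

context nome
begin

lemma prod_e: "(\<Prod>a\<in>A. e (f a)) = e (\<Sum>a\<in>A. f a)"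
  by (induction A rule: infinite_finite_induct) (auto simp: e_add)

lemma Theta_eq:
  "Theta \<epsilon> N y = (if \<forall>a\<in>{1..N}. even (y a - \<epsilon> a) then e (\<Sum>a=1..N. (of_int (y a))\<^sup>2 / 4) else 0)"
proof (cases "\<forall>a\<in>{1..N}. even (y a - \<epsilon> a)")
  case True
  hence "Theta \<epsilon> N y = (\<Prod>a=1..N. e ((of_int (y a))\<^sup>2 / 4))"
    unfolding Theta_def by (intro prod.cong) (auto simp: theta_def)
  thus ?thesis unfolding if_P[OF True] by (simp only: prod_e)
next
  case False
  then obtain a where a: "a \<in> {1..N}" "odd (y a - \<epsilon> a)" by blast
  hence "Theta \<epsilon> N y = 0" unfolding Theta_def by (intro prod_zero bexI[of _ a]) (auto simp: theta_def)
  thus ?thesis unfolding if_not_P[OF False] .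
qed

text \<open>The part of the completed square that involves k alone, together with the signs and
  reciprocals of the Euler series.\<close>

definition shift_coeff :: "(nat \<Rightarrow> int) \<Rightarrow> nat \<Rightarrow> (nat \<Rightarrow> int) \<Rightarrow> complex" where
  "shift_coeff l M k = (\<Prod>a=1..M. (-1) powi (k a) * iq (k a)) *
     e (\<Sum>a=1..M. of_int (k a) * (1 + of_int (l a)) / 2 + of_int (k a) * of_int (k (Suc a)) / 2)"

text \<open>The common core of \<open>euler\<close> and \<open>qbs\<close>, which differ by a factor
  1/(q)_{m-k} only; hence both sides of the main identity lead to the same
  \<open>shift_coeff\<close>.\<close>

definition euler_term :: "int \<Rightarrow> int \<Rightarrow> complex" where
  "euler_term n k = (-1) powi k * e (of_int k * (of_int k + 1) / 2 + of_int k * of_int n) * iq k"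

text \<open>The shift moves the parity class by \<open>bdiff k\<close>. The parity hypothesis makes
  the halving in \<open>occ\<close> exact wherever \<open>Theta\<close> is nonzero, so that
  \<open>square_completion\<close> applies.\<close>

lemma shift_identity:
  assumes k: "k \<in> Zn M" and par: "\<And>a. a \<in> {1..M} \<Longrightarrow> even (l a + \<epsilon> (Suc a) - \<epsilon> a)"
  shows "Theta \<epsilon> (Suc M) (\<lambda>a. y a + bdiff k a) * (\<Prod>a=1..M. euler_term (occ l (\<lambda>a. y a + bdiff k a) a) (k a))
       = shift_coeff l M k * Theta (\<lambda>a. \<epsilon> a - bdiff k a) (Suc M) y"
proof -
  have eq: "y a + bdiff k a - \<epsilon> a = y a - (\<epsilon> a - bdiff k a)" for a by simp
  show ?thesis
  proof (cases "\<forall>a\<in>{1..Suc M}. even (y a - (\<epsilon> a - bdiff k a))")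
    case False
    show ?thesis unfolding Theta_eq eq if_not_P[OF False] by (simp only: mult_zero_left mult_zero_right)
  next
    case True
    define Y where "Y = (\<lambda>a. y a + bdiff k a)"
    have occ: "real_of_int (occ l Y a) = (of_int (l a) + of_int (Y (Suc a)) - of_int (Y a)) / 2" if "a \<in> {1..M}" for a
    proof -
      have "even (Y (Suc a) - \<epsilon> (Suc a))" "even (Y a - \<epsilon> a)"
        using True that unfolding Y_def eq by auto
      with par[OF that] have "even (l a + Y (Suc a) - Y a)" by presburger
      hence "2 * occ l Y a = l a + Y (Suc a) - Y a" by (simp add: occ_def)
      hence "2 * real_of_int (occ l Y a) = of_int (l a) + of_int (Y (Suc a)) - of_int (Y a)" by linarith
      thus ?thesis by simp
    qed
    have "(\<Prod>a=1..M. euler_term (occ l Y a) (k a)) = (\<Prod>a=1..M. ((-1) powi (k a) * iq (k a)) * e (of_int (k a) * (of_int (k a) + 1) / 2 + of_int (k a) * of_int (occ l Y a)))"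
      by (rule prod.cong) (simp_all only: euler_term_def mult_ac)
    also have "\<dots> = (\<Prod>a=1..M. (-1) powi (k a) * iq (k a)) * e (\<Sum>a=1..M. of_int (k a) * (of_int (k a) + 1) / 2 + of_int (k a) * of_int (occ l Y a))"
      by (simp only: prod.distrib prod_e)
    finally have 1: "(\<Prod>a=1..M. euler_term (occ l Y a) (k a)) = \<dots>" .
    have 2: "Theta \<epsilon> (Suc M) Y = e (\<Sum>a=1..Suc M. (of_int (Y a))\<^sup>2 / 4)"
      unfolding Theta_eq Y_def eq by (rule if_P[OF True])
    have 3: "Theta (\<lambda>a. \<epsilon> a - bdiff k a) (Suc M) y = e (\<Sum>a=1..Suc M. (of_int (y a))\<^sup>2 / 4)"
      unfolding Theta_eq by (rule if_P[OF True])
    have k0: "k 0 = 0" "k (Suc M) = 0" using Zn_D[OF k] by auto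
    have 4: "(\<Sum>a=1..Suc M. (real_of_int (Y a))\<^sup>2 / 4) + (\<Sum>a=1..M. of_int (k a) * (of_int (k a) + 1) / 2 + of_int (k a) * of_int (occ l Y a))
       = (\<Sum>a=1..M. of_int (k a) * (1 + of_int (l a)) / 2 + of_int (k a) * of_int (k (Suc a)) / 2) + (\<Sum>a=1..Suc M. (of_int (y a))\<^sup>2 / 4)"
    proof -
      have a: "(\<Sum>a=1..Suc M. (real_of_int (Y a))\<^sup>2 / 4) = (\<Sum>a=1..Suc M. (real_of_int (y a) + (real_of_int (k a) - real_of_int (k (a - 1))))\<^sup>2 / 4)"
        by (rule sum.cong) (simp_all add: Y_def bdiff_def)
      have b: "(\<Sum>a=1..M. of_int (k a) * (of_int (k a) + 1) / 2 + of_int (k a) * of_int (occ l Y a))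
         = (\<Sum>a=1..M. of_int (k a) * (of_int (k a) + 1) / 2 + of_int (k a) * ((real_of_int (l a) + (of_int (y (Suc a)) + (of_int (k (Suc a)) - of_int (k a))) - (of_int (y a) + (of_int (k a) - of_int (k (a - 1))))) / 2))"
        by (rule sum.cong[OF refl]) (simp only: occ, simp add: Y_def bdiff_def)
      show ?thesis unfolding a b
        using square_completion[of "\<lambda>a. real_of_int (k a)" "\<lambda>a. real_of_int (y a)" M "\<lambda>a. real_of_int (l a)"] k0
        by simp
    qed
    show ?thesis
      unfolding Y_def[symmetric] 1 2 3 shift_coeff_def
      using 4 by (metis (no_types, lifting) e_add mult.assoc mult.left_commute)
  qed
qed

text \<open>Negative k_a are removed by the reciprocals. For k >= 0 and l >= 0 the exponent is at
  least the sum of the k_a/2, whence the ratio |q|^(1/2) in the majorant.\<close>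

lemma summable_shift_coeff:
  assumes "\<And>a. a \<in> {1..M} \<Longrightarrow> l a \<ge> 0"
  shows "shift_coeff l M summable_on Zn M"
proof -
  define g :: "int \<Rightarrow> complex" where "g = (\<lambda>x. of_real (iqB * (norm q powr (1/2)) ^ nat \<bar>x\<bar>))"
  have r: "norm q powr (1/2) < 1" using powr_less_mono2[of "1/2" "norm q" 1] norm_q_less by simp
  have "(\<lambda>x::int. iqB * (norm q powr (1/2)) ^ nat \<bar>x\<bar>) summable_on UNIV"
    by (intro summable_on_cmult_right summable_on_int_power_abs r) simp
  hence g: "g summable_on UNIV"
    unfolding g_def by (rule summable_on_of_real)
  have "(\<lambda>f. \<Prod>a=1..M. g (f a)) summable_on Zn M"
    by (rule Zn_prod(1)) (rule g)
  hence "(\<lambda>f. norm (\<Prod>a=1..M. g (f a))) summable_on Zn M"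
    by (simp only: summable_on_iff_abs_summable_on_complex)
  thus ?thesis
  proof (rule summable_on_norm_bound)
    fix k assume k: "k \<in> Zn M"
    show "norm (shift_coeff l M k) \<le> norm (\<Prod>a=1..M. g (k a))"
    proof (cases "\<forall>a\<in>{1..M}. k a \<ge> 0")
      case False
      then obtain a where "a \<in> {1..M}" "k a < 0" by auto
      hence "(\<Prod>a=1..M. (-1) powi (k a) * iq (k a)) = 0" by (intro prod_zero bexI[of _ a]) auto
      thus ?thesis by (simp only: shift_coeff_def mult_zero_left norm_zero norm_ge_zero)
    next
      case True
      have nn: "k a \<ge> 0" for a using True k by (cases "a \<in> {1..M}") (auto simp: Zn_def)
      have "norm (shift_coeff l M k) \<le> iqB ^ M * norm (e (\<Sum>a=1..M. real (nat \<bar>k a\<bar>) / 2))"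
        unfolding shift_coeff_def norm_mult
      proof (rule mult_mono)
        have "norm (\<Prod>a=1..M. (-1) powi (k a) * iq (k a)) = norm (\<Prod>a=1..M. iq (k a))"
          by (simp add: norm_mult flip: prod_norm)
        also have "\<dots> \<le> iqB ^ M" using norm_prod_iq[of k "{1..M}"] by simp
        finally show "norm (\<Prod>a=1..M. (-1) powi (k a) * iq (k a)) \<le> iqB ^ M" .
        show "norm (e (\<Sum>a=1..M. of_int (k a) * (1 + of_int (l a)) / 2 + of_int (k a) * of_int (k (Suc a)) / 2)) \<le> norm (e (\<Sum>a=1..M. real (nat \<bar>k a\<bar>) / 2))"
        proof (intro norm_e_mono sum_mono)
          fix a assume a: "a \<in> {1..M}"
          have "real (nat \<bar>k a\<bar>) / 2 = of_int (k a) * 1 / 2" using nn[of a] by simp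
          also have "\<dots> \<le> of_int (k a) * (1 + of_int (l a)) / 2" using nn[of a] assms[OF a] by (intro divide_right_mono mult_left_mono) auto
          also have "\<dots> \<le> of_int (k a) * (1 + of_int (l a)) / 2 + of_int (k a) * of_int (k (Suc a)) / 2"
            using nn by simp
          finally show "real (nat \<bar>k a\<bar>) / 2 \<le> of_int (k a) * (1 + of_int (l a)) / 2 + of_int (k a) * of_int (k (Suc a)) / 2" .
        qed
      qed (use iqB in auto)
      also have "\<dots> = norm (\<Prod>a=1..M. g (k a))"
      proof -
        have "norm (g x) = iqB * norm (e (real (nat \<bar>x\<bar>) / 2))" for x
        proof -
          have "(norm q powr (1/2)) ^ nat \<bar>x\<bar> = norm (e (real (nat \<bar>x\<bar>) / 2))"
            using norm_q_pos by (simp only: norm_e powr_powr powr_gt_zero powr_realpow[symmetric]) (simp add: powr_powr)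
          thus ?thesis using iqB(1) by (simp only: g_def norm_of_real abs_mult) simp
        qed
        hence "norm (\<Prod>a=1..M. g (k a)) = iqB ^ M * (\<Prod>a=1..M. norm (e (real (nat \<bar>k a\<bar>) / 2)))"
          by (simp add: prod.distrib flip: prod_norm)
        thus ?thesis by (simp only: prod_norm prod_e)
      qed
      finally show ?thesis .
    qed
  qed
qed

text \<open>A majorant of \<open>theta\<close> free of parities: in the double sum over y and k the
  parity class varies with k.\<close>

definition theta0 :: "int \<Rightarrow> complex" where "theta0 y = e ((of_int y)\<^sup>2 / 4)"

lemma summable_theta0: "(\<lambda>y. \<Prod>a=1..N. theta0 (y a)) summable_on Zn N"
proof (rule Zn_prod(1))
  show "theta0 summable_on UNIV"
    by (rule summable_gauss_bounded[of "1/4" _ 1 0]) (auto simp: theta0_def)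
qed

lemma norm_Theta_le: "norm (Theta \<epsilon> N y) \<le> norm (\<Prod>a=1..N. theta0 (y a))"
  unfolding Theta_def prod_norm[symmetric] by (rule prod_mono) (auto simp: theta_def theta0_def)

lemma bij_shift_bdiff:
  "bij_betw (\<lambda>(y, k). ((\<lambda>a. y a + bdiff k a), k)) (Zn (Suc M) \<times> Zn M) (Zn (Suc M) \<times> Zn M)"
proof (rule bij_betw_byWitness[where f' = "\<lambda>(y, k). ((\<lambda>a. y a - bdiff k a), k)"])
  show "(\<lambda>(y, k). ((\<lambda>a. y a + bdiff k a), k)) ` (Zn (Suc M) \<times> Zn M) \<subseteq> Zn (Suc M) \<times> Zn M"
    by (clarsimp simp: Zn_add bdiff_Zn)
  show "(\<lambda>(y, k). ((\<lambda>a. y a - bdiff k a), k)) ` (Zn (Suc M) \<times> Zn M) \<subseteq> Zn (Suc M) \<times> Zn M"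
    by (clarsimp simp: Zn_diff bdiff_Zn)
qed simp_all

text \<open>The coefficients \<open>shift_coeff\<close> do not depend on the weight \<open>w\<close>. Hence two weights with equal theta sums
  for all parities give equal sums on the left.\<close>

lemma shift_sum:
  assumes par: "\<And>a. a \<in> {1..M} \<Longrightarrow> even (l a + \<epsilon> (Suc a) - \<epsilon> a)"
    and nonneg: "\<And>a. a \<in> {1..M} \<Longrightarrow> l a \<ge> 0" and w: "\<And>y. norm (w y) \<le> K"
  shows "(\<Sum>\<^sub>\<infinity>y\<in>Zn (Suc M). \<Sum>\<^sub>\<infinity>k\<in>Zn M. Theta \<epsilon> (Suc M) y * (\<Prod>a=1..M. euler_term (occ l y a) (k a)) * w (\<lambda>a. y a - bdiff k a))
     = (\<Sum>\<^sub>\<infinity>k\<in>Zn M. shift_coeff l M k * (\<Sum>\<^sub>\<infinity>y\<in>Zn (Suc M). Theta (\<lambda>a. \<epsilon> a - bdiff k a) (Suc M) y * w y))"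
proof -
  define G where "G = (\<lambda>y k. Theta \<epsilon> (Suc M) y * (\<Prod>a=1..M. euler_term (occ l y a) (k a)) * w (\<lambda>a. y a - bdiff k a))"
  define H where "H = (\<lambda>y k. shift_coeff l M k * Theta (\<lambda>a. \<epsilon> a - bdiff k a) (Suc M) y * w y)"
  have GH: "G (\<lambda>a. y a + bdiff k a) k = H y k" if "k \<in> Zn M" for y k
    using shift_identity[where l = l and \<epsilon> = \<epsilon>, OF that par] by (simp add: G_def H_def)
  have "(\<lambda>(y, k). (\<Prod>a=1..Suc M. theta0 (y a)) * shift_coeff l M k) summable_on (Zn (Suc M) \<times> Zn M)"
    by (intro summable_on_times summable_theta0 summable_shift_coeff nonneg)
  hence "(\<lambda>z. K * norm (case z of (y, k) \<Rightarrow> (\<Prod>a=1..Suc M. theta0 (y a)) * shift_coeff l M k)) summable_on (Zn (Suc M) \<times> Zn M)"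
    by (intro summable_on_cmult_right) (simp only: summable_on_iff_abs_summable_on_complex)
  \<comment> \<open>Summability is checked for H, where the majorant is a product of a function of y
    and one of k; the bijection then carries it over to G.\<close>
  hence H: "(\<lambda>(y, k). H y k) summable_on (Zn (Suc M) \<times> Zn M)"
  proof (rule summable_on_norm_bound, clarify)
    fix y k
    have "norm (H y k) = norm (w y) * (norm (Theta (\<lambda>a. \<epsilon> a - bdiff k a) (Suc M) y) * norm (shift_coeff l M k))"
      by (simp add: H_def norm_mult mult_ac)
    also have "\<dots> \<le> K * (norm (\<Prod>a=1..Suc M. theta0 (y a)) * norm (shift_coeff l M k))"
      by (intro mult_mono mult_right_mono w norm_Theta_le) (auto intro: order_trans[OF norm_ge_zero w])
    finally show "norm (H y k) \<le> K * norm ((\<Prod>a=1..Suc M. theta0 (y a)) * shift_coeff l M k)"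
      by (simp only: norm_mult)
  qed
  have *: "(\<lambda>(y, k). G y k) (case z of (y, k) \<Rightarrow> ((\<lambda>a. y a + bdiff k a), k)) = (\<lambda>(y, k). H y k) z"
    if "z \<in> Zn (Suc M) \<times> Zn M" for z
    using that by (auto simp: GH)
  have G: "(\<lambda>(y, k). G y k) summable_on (Zn (Suc M) \<times> Zn M)"
  proof (rule summable_on_reindex_bij_betw[OF bij_shift_bdiff, THEN iffD1])
    show "(\<lambda>z. (\<lambda>(y, k). G y k) (case z of (y, k) \<Rightarrow> ((\<lambda>a. y a + bdiff k a), k))) summable_on (Zn (Suc M) \<times> Zn M)"
      using H by (subst summable_on_cong[OF *])
  qed
  have "(\<Sum>\<^sub>\<infinity>y\<in>Zn (Suc M). \<Sum>\<^sub>\<infinity>k\<in>Zn M. G y k) = infsum (\<lambda>(y, k). G y k) (Zn (Suc M) \<times> Zn M)"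
    by (rule infsum_Sigma'_banach[OF G])
  also have "\<dots> = infsum (\<lambda>(y, k). H y k) (Zn (Suc M) \<times> Zn M)"
    by (subst infsum_reindex_bij_betw[OF bij_shift_bdiff, symmetric]) (rule infsum_cong, rule *)
  also have "\<dots> = (\<Sum>\<^sub>\<infinity>k\<in>Zn M. \<Sum>\<^sub>\<infinity>y\<in>Zn (Suc M). H y k)"
    unfolding infsum_Sigma'_banach[OF H, symmetric] by (rule infsum_swap_banach[OF H])
  also have "\<dots> = (\<Sum>\<^sub>\<infinity>k\<in>Zn M. shift_coeff l M k * (\<Sum>\<^sub>\<infinity>y\<in>Zn (Suc M). Theta (\<lambda>a. \<epsilon> a - bdiff k a) (Suc M) y * w y))"
    unfolding H_def by (simp only: mult.assoc infsum_cmult_right')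
  finally show ?thesis unfolding G_def .
qed

lemma summable_euler_term: "euler_term n summable_on UNIV"
  using euler_summable[of n] by (simp add: euler_term_def[abs_def])

lemma infsum_euler_term: "iq_inf * infsum (euler_term n) UNIV = iq n"
  using euler[of n] by (simp add: euler_term_def[abs_def])

lemma qbs_euler_term: "(\<lambda>k. euler_term n k * iq (m - k)) summable_on UNIV" "qbs m n = (\<Sum>\<^sub>\<infinity>k. euler_term n k * iq (m - k))"
proof -
  show "(\<lambda>k. euler_term n k * iq (m - k)) summable_on UNIV"
    by (rule summable_on_mult_bounded[OF summable_euler_term]) (rule iqB(2))
qed (simp add: qbs_def euler_term_def mult_ac)

text \<open>Both sides are instances of \<open>shift_sum\<close>. The weight \<open>w1\<close>
  contains the 1/(q)_{m_a}, so undoing the shift produces the \<open>qbs\<close>; \<open>w2\<close>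
  depends on the total only, so the Euler series sum to 1/(q)_{n_a}. The theta sums of the two
  weights agree by \<open>multi_theta_identity\<close>.\<close>

lemma string_function_identity:
  assumes par: "\<And>a. a \<in> {1..M} \<Longrightarrow> even (l a + \<epsilon> (Suc a) - \<epsilon> a)"
    and nonneg: "\<And>a. a \<in> {1..M} \<Longrightarrow> l a \<ge> 0"
  shows "(\<Sum>\<^sub>\<infinity>y\<in>Zn (Suc M). Theta \<epsilon> (Suc M) y * (\<Prod>a=1..M. qbinom q (psum y a) (occ l y a)) * E (psum y (Suc M)) J)
     = iq_inf * (\<Sum>\<^sub>\<infinity>y\<in>Zn (Suc M). Theta \<epsilon> (Suc M) y * (\<Prod>a=1..M. iq (occ l y a)) * of_bool (psum y (Suc M) = J))"
proof -
  define w1 where "w1 = (\<lambda>y. (\<Prod>a<Suc M. iq (psum y a)) * E (psum y (Suc M)) J)"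
  define w2 :: "(nat \<Rightarrow> int) \<Rightarrow> complex" where "w2 = (\<lambda>y. iq_inf ^ Suc M * of_bool (psum y (Suc M) = J))"
  let ?S = "\<lambda>w. (\<Sum>\<^sub>\<infinity>y\<in>Zn (Suc M). \<Sum>\<^sub>\<infinity>k\<in>Zn M. Theta \<epsilon> (Suc M) y * (\<Prod>a=1..M. euler_term (occ l y a) (k a)) * w (\<lambda>a. y a - bdiff k a))"
  have w1: "norm (w1 y) \<le> iqB ^ card {..<Suc M} * iqB\<^sup>2" for y
    unfolding w1_def by (rule norm_prod_iq_E)
  have w2: "norm (w2 y) \<le> norm (iq_inf ^ Suc M)" for y by (simp add: w2_def)
  have "?S w1 = (\<Sum>\<^sub>\<infinity>k\<in>Zn M. shift_coeff l M k * (\<Sum>\<^sub>\<infinity>y\<in>Zn (Suc M). Theta (\<lambda>a. \<epsilon> a - bdiff k a) (Suc M) y * w1 y))"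
    by (rule shift_sum[where l = l and \<epsilon> = \<epsilon>, OF par nonneg w1])
  also have "\<dots> = (\<Sum>\<^sub>\<infinity>k\<in>Zn M. shift_coeff l M k * (\<Sum>\<^sub>\<infinity>y\<in>Zn (Suc M). Theta (\<lambda>a. \<epsilon> a - bdiff k a) (Suc M) y * w2 y))"
  proof (rule infsum_cong)
    fix k
    have "(\<Sum>\<^sub>\<infinity>y\<in>Zn (Suc M). Theta (\<lambda>a. \<epsilon> a - bdiff k a) (Suc M) y * w1 y)
       = iq_inf ^ Suc M * (\<Sum>\<^sub>\<infinity>y\<in>Zn (Suc M). Theta (\<lambda>a. \<epsilon> a - bdiff k a) (Suc M) y * of_bool (psum y (Suc M) = J))"
      unfolding w1_def by (rule multi_theta_identity)
    also have "\<dots> = (\<Sum>\<^sub>\<infinity>y\<in>Zn (Suc M). Theta (\<lambda>a. \<epsilon> a - bdiff k a) (Suc M) y * w2 y)"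
      unfolding w2_def infsum_cmult_right'[symmetric] by (rule infsum_cong) (rule mult.left_commute)
    finally show "shift_coeff l M k * (\<Sum>\<^sub>\<infinity>y\<in>Zn (Suc M). Theta (\<lambda>a. \<epsilon> a - bdiff k a) (Suc M) y * w1 y)
       = shift_coeff l M k * (\<Sum>\<^sub>\<infinity>y\<in>Zn (Suc M). Theta (\<lambda>a. \<epsilon> a - bdiff k a) (Suc M) y * w2 y)"
      by (simp only:)
  qed
  also have "\<dots> = ?S w2"
    by (rule shift_sum[where l = l and \<epsilon> = \<epsilon>, OF par nonneg w2, symmetric])
  finally have eq: "?S w1 = ?S w2" .
  have "?S w1 = (\<Sum>\<^sub>\<infinity>y\<in>Zn (Suc M). Theta \<epsilon> (Suc M) y * (\<Prod>a=1..M. qbinom q (psum y a) (occ l y a)) * E (psum y (Suc M)) J)"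
  proof (rule infsum_cong)
    fix y
    \<comment> \<open>The index 0 contributes 1/(q)_0 = 1, so the product over a < N is one over
      1..M, as for the q-binomials.\<close>
    have set: "{..<Suc M} = insert 0 {1..M}" by auto
    have "(\<Sum>\<^sub>\<infinity>k\<in>Zn M. Theta \<epsilon> (Suc M) y * (\<Prod>a=1..M. euler_term (occ l y a) (k a)) * w1 (\<lambda>a. y a - bdiff k a))
        = (\<Sum>\<^sub>\<infinity>k\<in>Zn M. (Theta \<epsilon> (Suc M) y * E (psum y (Suc M)) J) * (\<Prod>a=1..M. euler_term (occ l y a) (k a) * iq (psum y a - k a)))"
    proof (rule infsum_cong)
      fix k assume "k \<in> Zn M"
      hence "k 0 = 0" "k (Suc M) = 0" by (auto simp: Zn_def)
      hence "w1 (\<lambda>a. y a - bdiff k a) = (\<Prod>a=1..M. iq (psum y a - k a)) * E (psum y (Suc M)) J"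
        unfolding w1_def set psum_diff psum_bdiff by simp
      thus "Theta \<epsilon> (Suc M) y * (\<Prod>a=1..M. euler_term (occ l y a) (k a)) * w1 (\<lambda>a. y a - bdiff k a)
         = (Theta \<epsilon> (Suc M) y * E (psum y (Suc M)) J) * (\<Prod>a=1..M. euler_term (occ l y a) (k a) * iq (psum y a - k a))"
        by (simp only: prod.distrib mult_ac)
    qed
    also have "\<dots> = (Theta \<epsilon> (Suc M) y * E (psum y (Suc M)) J) * (\<Prod>a=1..M. qbs (psum y a) (occ l y a))"
      unfolding infsum_cmult_right' qbs_euler_term(2) by (subst Zn_prod(2)[OF qbs_euler_term(1)]) simp
    also have "\<dots> = (Theta \<epsilon> (Suc M) y * E (psum y (Suc M)) J) * (\<Prod>a=1..M. qbinom q (psum y a) (occ l y a))"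
    \<comment> \<open>If \<open>E\<close> is nonzero, then m_N >= 0. Either some earlier m_a is
      negative and both products vanish, or all are nonnegative and 2 m_a + (l_a + y_{a+1} - y_a) =
      m_{a-1} + m_{a+1} + l_a gives m_a + n_a >= 0.\<close>
    proof (cases "E (psum y (Suc M)) J = 0")
      case False
      hence N: "psum y (Suc M) \<ge> 0" using E_neg not_less by blast
      have "(\<Prod>a=1..M. qbs (psum y a) (occ l y a)) = (\<Prod>a=1..M. qbinom q (psum y a) (occ l y a))"
      proof (cases "\<exists>a\<in>{1..M}. psum y a < 0")
        case True
        then obtain a where a: "a \<in> {1..M}" "psum y a < 0" by blast
        hence "qbs (psum y a) (occ l y a) = 0" "qbinom q (psum y a) (occ l y a) = 0"
          by (simp_all add: qbs_neg qbinom_def)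
        with a have "(\<Prod>a=1..M. qbs (psum y a) (occ l y a)) = 0" "(\<Prod>a=1..M. qbinom q (psum y a) (occ l y a)) = 0"
          by (intro prod_zero bexI[of _ a]; simp)+
        thus ?thesis by (simp only:)
      next
        case False
        with N have nn: "psum y a \<ge> 0" if "a \<le> Suc M" for a
          using that by (cases "a = 0"; cases "a = Suc M") (auto simp: not_less le_Suc_eq)
        show ?thesis
        proof (intro prod.cong refl qbinom_eq_qbs[symmetric] disjI2)
          fix a assume a: "a \<in> {1..M}"
          then obtain b where b: "a = Suc b" by (cases a) auto
          have "psum y b \<ge> 0" "psum y (Suc a) \<ge> 0" by (rule nn, use a b in simp)+
          moreover have "psum y a = psum y b + y a" "psum y (Suc a) = psum y a + y (Suc a)" by (simp_all only: b psum_Suc)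
          ultimately have "0 \<le> 2 * psum y a + (l a + y (Suc a) - y a)"
            using nonneg[OF a] by linarith
          hence "0 \<le> (2 * psum y a + (l a + y (Suc a) - y a)) div 2" by simp
          thus "0 \<le> psum y a + occ l y a" unfolding occ_def by simp
        qed
      qed
      thus ?thesis by (simp only:)
    qed (simp only: mult_zero_right mult_zero_left)
    finally show "(\<Sum>\<^sub>\<infinity>k\<in>Zn M. Theta \<epsilon> (Suc M) y * (\<Prod>a=1..M. euler_term (occ l y a) (k a)) * w1 (\<lambda>a. y a - bdiff k a))
      = Theta \<epsilon> (Suc M) y * (\<Prod>a=1..M. qbinom q (psum y a) (occ l y a)) * E (psum y (Suc M)) J"
      by (simp only: mult_ac)
  qed
  moreover have "?S w2 = (\<Sum>\<^sub>\<infinity>y\<in>Zn (Suc M). iq_inf * (Theta \<epsilon> (Suc M) y * (\<Prod>a=1..M. iq (occ l y a)) * of_bool (psum y (Suc M) = J)))"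
  proof (rule infsum_cong)
    fix y
    have "(\<Sum>\<^sub>\<infinity>k\<in>Zn M. Theta \<epsilon> (Suc M) y * (\<Prod>a=1..M. euler_term (occ l y a) (k a)) * w2 (\<lambda>a. y a - bdiff k a))
       = (\<Sum>\<^sub>\<infinity>k\<in>Zn M. (Theta \<epsilon> (Suc M) y * w2 y) * (\<Prod>a=1..M. euler_term (occ l y a) (k a)))"
    proof (rule infsum_cong)
      fix k assume "k \<in> Zn M"
      hence "k 0 = 0" "k (Suc M) = 0" by (auto simp: Zn_def)
      hence "w2 (\<lambda>a. y a - bdiff k a) = w2 y"
        unfolding w2_def psum_diff psum_bdiff by simp
      thus "Theta \<epsilon> (Suc M) y * (\<Prod>a=1..M. euler_term (occ l y a) (k a)) * w2 (\<lambda>a. y a - bdiff k a) = (Theta \<epsilon> (Suc M) y * w2 y) * (\<Prod>a=1..M. euler_term (occ l y a) (k a))"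
        by (simp only: mult_ac)
    qed
    also have "\<dots> = (Theta \<epsilon> (Suc M) y * w2 y) * (\<Prod>a=1..M. infsum (euler_term (occ l y a)) UNIV)"
      unfolding infsum_cmult_right' by (subst Zn_prod(2)[OF summable_euler_term]) simp
    \<comment> \<open>Of the M + 1 factors \<open>iq_inf\<close> in \<open>w2\<close>, M complete
      the Euler series and one stays in front.\<close>
    also have "\<dots> = iq_inf * (Theta \<epsilon> (Suc M) y * (\<Prod>a=1..M. iq_inf * infsum (euler_term (occ l y a)) UNIV) * of_bool (psum y (Suc M) = J))"
      unfolding w2_def prod.distrib by (simp add: mult_ac)
    finally show "(\<Sum>\<^sub>\<infinity>k\<in>Zn M. Theta \<epsilon> (Suc M) y * (\<Prod>a=1..M. euler_term (occ l y a) (k a)) * w2 (\<lambda>a. y a - bdiff k a))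
       = iq_inf * (Theta \<epsilon> (Suc M) y * (\<Prod>a=1..M. iq (occ l y a)) * of_bool (psum y (Suc M) = J))"
      unfolding infsum_euler_term .
  qed
  ultimately show ?thesis using eq by (simp only: infsum_cmult_right')
qed

end

section \<open>Bressoud chains\<close>

lemma powi_minus1_reflect: "(-1) powi (- 1 - j) = - ((-1) powi j :: complex)"
  by (simp add: power_int_minus_left)

lemma infsum_int_reflect:
  fixes f :: "int \<Rightarrow> 'a :: {topological_comm_monoid_add, t2_space}"
  shows "infsum (\<lambda>j. f (c - j)) UNIV = infsum f UNIV"
  by (rule infsum_reindex_bij_witness[of _ "\<lambda>x. c - x" "\<lambda>x. c - x"]) auto

context nome
begin

text \<open>This is \<open>q_vandermonde\<close> after the translation by a, with n = s - a and d =
  a - b; d may be negative, so a and b need no ordering.\<close>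

lemma q_vandermonde_int:
  "(\<Sum>\<^sub>\<infinity>t::int. e (of_int ((t - a) * (t - b))) * (iq (s - t) * (iq (t - a) * iq (t - b)))) = iq (s - a) * iq (s - b)"
proof (cases "s < a")
  case True
  have "iq (s - t) * iq (t - a) = 0" for t using True by (cases "t < a") auto
  hence "e (of_int ((t - a) * (t - b))) * (iq (s - t) * (iq (t - a) * iq (t - b))) = 0" for t by auto
  thus ?thesis using True by (simp only: infsum_0_simp) simp
next
  case False
  define n where "n = nat (s - a)"
  have n: "s - a = int n" "s = int n + a" using False by (auto simp: n_def)
  hence sb: "s - b = int n + (a - b)" by simp
  have "(\<Sum>\<^sub>\<infinity>t::int. e (of_int ((t - a) * (t - b))) * (iq (s - t) * (iq (t - a) * iq (t - b))))
      = (\<Sum>\<^sub>\<infinity>t::int. e (of_int (t * (t + (a - b)))) * (iq (int n - t) * (iq t * iq (t + (a - b)))))"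
    by (subst infsum_int_shift[of _ a, symmetric]) (simp add: n algebra_simps)
  also have "\<dots> = (\<Sum>t\<le>n. e (of_int (int t * (int t + (a - b)))) * (iq (int n - int t) * (iq (int t) * iq (int t + (a - b)))))"
    by (rule infsum_int_finite) auto
  also have "\<dots> = (\<Sum>t\<le>n. e (real t * (real t + of_int (a - b))) * iq (int t) * iq (int t + (a - b)) * iq (int n - int t))"
    by (intro sum.cong refl) (simp only: of_int_mult of_int_add of_int_of_nat_eq mult_ac)
  also have "\<dots> = iq (int n) * iq (int n + (a - b))" by (rule q_vandermonde)
  finally show ?thesis unfolding sb n(1) .
qed

text \<open>The Bailey transform relative to \<open>1\<close> for \<open>c = 0\<close> and, up to a factor, relative to \<open>q\<close> for \<open>c = 1\<close>.\<close>

definition bsum :: "int \<Rightarrow> (int \<Rightarrow> complex) \<Rightarrow> int \<Rightarrow> complex" where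
  "bsum c \<alpha> s = (\<Sum>\<^sub>\<infinity>j. \<alpha> j * (iq (s - j) * iq (s + j + c)))"

lemma bsum_summable: "(\<lambda>j. \<alpha> j * (iq (s - j) * iq (s + j + c))) summable_on UNIV"
  by (rule summable_on_int_finite[of "- s - c" s]) auto

lemma bsum_neg: "2 * s + c < 0 \<Longrightarrow> bsum c \<alpha> s = 0"
proof -
  assume "2 * s + c < 0"
  hence "iq (s - j) * iq (s + j + c) = 0" for j by (cases "s < j") auto
  thus ?thesis by (simp only: bsum_def mult_zero_right infsum_0_simp)
qed

text \<open>Since (t^2 + c t) - (j^2 + c j) = (t - j)(t + j + c), the sum over t is
  \<open>q_vandermonde_int\<close> with a = j and b = -j - c. This is Bailey's lemma with both
  parameters sent to infinity.\<close>

lemma bailey_step: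
  "(\<Sum>\<^sub>\<infinity>t. iq (s - t) * e (of_int (t\<^sup>2 + c * t)) * bsum c \<alpha> t) = bsum c (\<lambda>j. \<alpha> j * e (of_int (j\<^sup>2 + c * j))) s"
proof -
  define G where "G = (\<lambda>t j. iq (s - t) * e (of_int (t\<^sup>2 + c * t)) * (\<alpha> j * (iq (t - j) * iq (t + j + c))))"
  have zero: "G t j = 0" if "t > s \<or> t < - \<bar>c\<bar> \<or> j > s \<or> j < - s - c" for t j
  proof -
    have "t > s \<or> t < j \<or> t + j + c < 0" using that by linarith
    thus ?thesis by (auto simp: G_def)
  qed
  \<comment> \<open>From t <= s, j <= t and t + j + c >= 0 the support lies in a box, so the sums
    may be exchanged for arbitrary coefficients \<open>\<alpha>\<close>.\<close>
  have "{z \<in> UNIV \<times> UNIV. (\<lambda>(t, j). G t j) z \<noteq> 0} \<subseteq> {- \<bar>c\<bar>..s} \<times> {- s - c..s}"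
  proof (intro subsetI)
    fix z assume "z \<in> {z \<in> UNIV \<times> UNIV. (\<lambda>(t, j). G t j) z \<noteq> 0}"
    then obtain t j where z: "z = (t, j)" "G t j \<noteq> 0" by (cases z) simp
    hence "\<not> (t > s \<or> t < - \<bar>c\<bar> \<or> j > s \<or> j < - s - c)" using zero[of t j] by argo
    thus "z \<in> {- \<bar>c\<bar>..s} \<times> {- s - c..s}" by (simp add: z(1))
  qed
  hence "finite {z \<in> UNIV \<times> UNIV. (\<lambda>(t, j). G t j) z \<noteq> 0}" by (rule finite_subset) simp
  hence G: "(\<lambda>(t, j). G t j) summable_on (UNIV \<times> UNIV)" by (rule finite_nonzero_values_imp_summable_on)
  have "(\<Sum>\<^sub>\<infinity>t. iq (s - t) * e (of_int (t\<^sup>2 + c * t)) * bsum c \<alpha> t) = (\<Sum>\<^sub>\<infinity>t. \<Sum>\<^sub>\<infinity>j. G t j)"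
    unfolding bsum_def G_def by (simp only: infsum_cmult_right')
  also have "\<dots> = (\<Sum>\<^sub>\<infinity>j. \<Sum>\<^sub>\<infinity>t. G t j)" by (rule infsum_swap_banach[OF G])
  also have "\<dots> = bsum c (\<lambda>j. \<alpha> j * e (of_int (j\<^sup>2 + c * j))) s"
    unfolding bsum_def
  proof (rule infsum_cong)
    fix j
    have "(\<Sum>\<^sub>\<infinity>t. G t j) = (\<Sum>\<^sub>\<infinity>t. (\<alpha> j * e (of_int (j\<^sup>2 + c * j))) * (e (of_int ((t - j) * (t - (- j - c)))) * (iq (s - t) * (iq (t - j) * iq (t - (- j - c))))))"
    proof (rule infsum_cong)
      fix t
      have "t\<^sup>2 + c * t = (j\<^sup>2 + c * j) + (t - j) * (t - (- j - c))"
        by (simp add: power2_eq_square algebra_simps)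
      hence "e (of_int (t\<^sup>2 + c * t)) = e (of_int (j\<^sup>2 + c * j)) * e (of_int ((t - j) * (t - (- j - c))))"
        by (simp only: of_int_add e_add)
      moreover have "t + j + c = t - (- j - c)" by simp
      ultimately show "G t j = (\<alpha> j * e (of_int (j\<^sup>2 + c * j))) * (e (of_int ((t - j) * (t - (- j - c)))) * (iq (s - t) * (iq (t - j) * iq (t - (- j - c)))))"
        unfolding G_def by (simp only: mult_ac)
    qed
    also have "\<dots> = \<alpha> j * e (of_int (j\<^sup>2 + c * j)) * (iq (s - j) * iq (s - (- j - c)))"
      by (simp only: infsum_cmult_right' q_vandermonde_int)
    finally show "(\<Sum>\<^sub>\<infinity>t. G t j) = \<alpha> j * e (of_int (j\<^sup>2 + c * j)) * (iq (s - j) * iq (s + j + c))" by (simp add: algebra_simps)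
  qed
  finally show ?thesis .
qed

lemma bsum_reflect:
  "bsum 1 \<alpha> s = bsum 1 (\<lambda>j. \<alpha> (- 1 - j)) s"
  unfolding bsum_def by (subst infsum_int_reflect[of _ "-1", symmetric]) (simp add: algebra_simps)

lemma bsum_minus: "bsum c (\<lambda>j. - \<alpha> j) s = - bsum c \<alpha> s"
  unfolding bsum_def by (simp add: infsum_uminus)

lemma bsum_cmult: "bsum c (\<lambda>j. x * \<alpha> j) s = x * bsum c \<alpha> s"
  unfolding bsum_def by (simp add: infsum_cmult_right' mult.assoc)

text \<open>For c = 1 the involution j -> -1 - j swaps the two reciprocals.\<close>

lemma bsum_antisym:
  assumes "\<And>j. \<alpha> (- 1 - j) = - \<alpha> j"
  shows "bsum 1 \<alpha> s = 0"
proof -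
  have "bsum 1 \<alpha> s = - bsum 1 \<alpha> s"
    using bsum_reflect[of \<alpha> s] unfolding assms bsum_minus .
  thus ?thesis by simp
qed

lemma bsum_0_1: "bsum 0 \<alpha> s = bsum 1 \<alpha> s - bsum 1 (\<lambda>j. \<alpha> j * e (of_int (s + j + 1))) s"
proof -
  have "bsum 0 \<alpha> s = (\<Sum>\<^sub>\<infinity>j. \<alpha> j * (iq (s - j) * iq (s + j + 1)) - \<alpha> j * e (of_int (s + j + 1)) * (iq (s - j) * iq (s + j + 1)))"
    unfolding bsum_def
  proof (rule infsum_cong)
    fix j
    have "iq (s + j + 0) = (1 - e (of_int (s + j + 1))) * iq (s + j + 1)" using iq_rec'[of "s + j"] by simp
    thus "\<alpha> j * (iq (s - j) * iq (s + j + 0)) = \<alpha> j * (iq (s - j) * iq (s + j + 1)) - \<alpha> j * e (of_int (s + j + 1)) * (iq (s - j) * iq (s + j + 1))"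
      by (simp only: ring_distribs mult_ac mult_1_left mult_1_right)
  qed
  also have "\<dots> = bsum 1 \<alpha> s - bsum 1 (\<lambda>j. \<alpha> j * e (of_int (s + j + 1))) s"
  proof -
    let ?f = "\<lambda>j. \<alpha> j * (iq (s - j) * iq (s + j + 1))"
    let ?g = "\<lambda>j. \<alpha> j * e (of_int (s + j + 1)) * (iq (s - j) * iq (s + j + 1))"
    have "(\<Sum>\<^sub>\<infinity>j. ?f j + - ?g j) = infsum ?f UNIV + (\<Sum>\<^sub>\<infinity>j. - ?g j)"
      by (rule infsum_add[OF bsum_summable]) (rule summable_on_uminus[THEN iffD2, OF bsum_summable])
    thus ?thesis unfolding bsum_def by (simp only: infsum_uminus diff_conv_add_uminus)
  qed
  finally show ?thesis .
qed

text \<open>Adding up the terms \<open>j\<close> and \<open>- 1 - j\<close> turns a Bailey pair relative to \<open>1\<close> into one relative to \<open>q\<close>.\<close>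

lemma bsum_convert:
  "bsum 0 (\<lambda>j. (-1) powi j * e (c * of_int (j\<^sup>2 + j))) s
   = e (of_int s) * bsum 1 (\<lambda>j. (-1) powi j * e (c * of_int (j\<^sup>2 + j) - of_int j)) s"
proof -
  have sym: "(- 1 - j)\<^sup>2 + (- 1 - j) = j\<^sup>2 + j" for j :: int by (simp add: power2_eq_square algebra_simps)
  have "bsum 1 (\<lambda>j. (-1) powi j * e (c * of_int (j\<^sup>2 + j))) s = 0"
    by (rule bsum_antisym) (simp only: powi_minus1_reflect sym mult_minus_left)
  hence "bsum 0 (\<lambda>j. (-1) powi j * e (c * of_int (j\<^sup>2 + j))) s
     = - bsum 1 (\<lambda>j. (-1) powi j * e (c * of_int (j\<^sup>2 + j)) * e (of_int (s + j + 1))) s"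
    unfolding bsum_0_1 by simp
  also have "\<dots> = bsum 1 (\<lambda>j. e (of_int s) * ((-1) powi j * e (c * of_int (j\<^sup>2 + j) - of_int j))) s"
    unfolding bsum_minus[symmetric]
  proof (subst bsum_reflect, rule arg_cong[where f = "\<lambda>f. bsum 1 f s"], rule ext)
    fix j :: int
    have "e (c * of_int (j\<^sup>2 + j)) * e (of_int (s + (- 1 - j) + 1)) = e (of_int s) * e (c * of_int (j\<^sup>2 + j) - of_int j)"
      unfolding e_add[symmetric] by (rule arg_cong[where f = e]) simp
    thus "- ((-1) powi (- 1 - j) * e (c * of_int ((- 1 - j)\<^sup>2 + (- 1 - j))) * e (of_int (s + (- 1 - j) + 1)))
       = e (of_int s) * ((-1) powi j * e (c * of_int (j\<^sup>2 + j) - of_int j))"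
      by (simp only: powi_minus1_reflect sym mult_minus_left minus_minus mult.assoc mult.left_commute[of "e (of_int s)"])
  qed
  finally show ?thesis by (simp only: bsum_cmult)
qed

text \<open>In \<open>bsum_0_1\<close> the factor q^(s+j+1) cancels the linear term -j of the
  exponent, which leaves an antisymmetric sum. The same coefficients thus serve relative to 1 and
  relative to q.\<close>

lemma bsum_base_0_1:
  "bsum 0 (\<lambda>j. (-1) powi j * e (c * of_int (j\<^sup>2 + j) - of_int j)) s
   = bsum 1 (\<lambda>j. (-1) powi j * e (c * of_int (j\<^sup>2 + j) - of_int j)) s"
proof -
  have sym: "(- 1 - j)\<^sup>2 + (- 1 - j) = j\<^sup>2 + j" for j :: int by (simp add: power2_eq_square algebra_simps)
  have eq: "(\<lambda>j. (-1) powi j * e (c * of_int (j\<^sup>2 + j) - of_int j) * e (of_int (s + j + 1)))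
    = (\<lambda>j. e (of_int s + 1) * ((-1) powi j * e (c * of_int (j\<^sup>2 + j))))"
  proof
    fix j
    have "e (c * of_int (j\<^sup>2 + j) - of_int j) * e (of_int (s + j + 1)) = e (of_int s + 1) * e (c * of_int (j\<^sup>2 + j))"
      unfolding e_add[symmetric] by (rule arg_cong[where f = e]) simp
    thus "(-1) powi j * e (c * of_int (j\<^sup>2 + j) - of_int j) * e (of_int (s + j + 1))
      = e (of_int s + 1) * ((-1) powi j * e (c * of_int (j\<^sup>2 + j)))"
      by (simp only: mult.assoc mult.left_commute[of "e (of_int s + 1)"])
  qed
  have "bsum 1 (\<lambda>j. (-1) powi j * e (c * of_int (j\<^sup>2 + j))) s = 0"
    by (rule bsum_antisym) (simp only: powi_minus1_reflect sym mult_minus_left)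
  thus ?thesis unfolding bsum_0_1[of "\<lambda>j. (-1) powi j * e (c * of_int (j\<^sup>2 + j) - of_int j)"] eq bsum_cmult by simp
qed

text \<open>The unit Bailey pair. Reversed by j -> t - j, the sum is a multiple of
  \<open>qbs (2 * t + 1) (- t)\<close>, that is (q^(1-t);q)_{2t+1}/(q)_{2t+1}, which contains the
  factor 1 - q^0 once t > 0.\<close>

lemma bsum_base_1_aux:
  "bsum 1 (\<lambda>j. (-1) powi j * e (1/2 * of_int (j\<^sup>2 + j) - of_int j)) t = of_bool (t = 0)"
proof (cases "t < 0")
  case True
  thus ?thesis by (simp add: bsum_neg)
next
  case False
  define u where "u = bsum 1 (\<lambda>j. (-1) powi j * e (1/2 * of_int (j\<^sup>2 + j) - of_int j)) t"
  have "qbs (2 * t + 1) (- t) = (\<Sum>\<^sub>\<infinity>j. ((-1) powi t * e (of_int (t - t\<^sup>2) / 2)) * ((-1) powi j * e (1/2 * of_int (j\<^sup>2 + j) - of_int j) * (iq (t - j) * iq (t + j + 1))))"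
    unfolding qbs_def
  proof (subst infsum_int_reflect[of _ t, symmetric], rule infsum_cong)
    fix j :: int
    have "(t - j) * ((t - j) + 1) + 2 * ((t - j) * (- t)) = (t - t\<^sup>2) + ((j\<^sup>2 + j) - 2 * j)"
      by (simp add: power2_eq_square algebra_simps)
    hence "real_of_int ((t - j) * ((t - j) + 1) + 2 * ((t - j) * (- t))) / 2 = of_int ((t - t\<^sup>2) + ((j\<^sup>2 + j) - 2 * j)) / 2"
      by (rule arg_cong)
    hence "of_int (t - j) * (of_int (t - j) + 1) / 2 + of_int (t - j) * real_of_int (- t) = of_int (t - t\<^sup>2) / 2 + (1/2 * of_int (j\<^sup>2 + j) - of_int j)"
      unfolding of_int_add of_int_diff of_int_mult add_divide_distrib diff_divide_distrib by simp
    hence 1: "e (of_int (t - j) * (of_int (t - j) + 1) / 2 + of_int (t - j) * of_int (- t)) = e (of_int (t - t\<^sup>2) / 2) * e (1/2 * of_int (j\<^sup>2 + j) - of_int j)"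
      by (simp only: e_add)
    have 2: "(-1) powi (t - j) = (-1) powi t * ((-1) powi j :: complex)"
      by (simp add: power_int_minus_left)
    have 3: "2 * t + 1 - (t - j) = t + j + 1" by simp
    show "(-1) powi (t - j) * e (of_int (t - j) * (of_int (t - j) + 1) / 2 + of_int (t - j) * of_int (- t)) * (iq (t - j) * iq (2 * t + 1 - (t - j)))
      = ((-1) powi t * e (of_int (t - t\<^sup>2) / 2)) * ((-1) powi j * e (1/2 * of_int (j\<^sup>2 + j) - of_int j) * (iq (t - j) * iq (t + j + 1)))"
      unfolding 1 2 3 by (simp only: mult_ac)
  qed
  also have "\<dots> = ((-1) powi t * e (of_int (t - t\<^sup>2) / 2)) * u"
    by (simp only: infsum_cmult_right' u_def bsum_def)
  finally have qu: "qbs (2 * t + 1) (- t) = ((-1) powi t * e (of_int (t - t\<^sup>2) / 2)) * u" .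
  have "qbs (2 * t + 1) (- t) * iq (t + 1) = iq (2 * t + 1) * iq (- t)"
    using q_binomial[of "nat (2 * t + 1)" "- t"] False by (simp add: add.commute)
  moreover have "iq (t + 1) \<noteq> 0" using False by (intro iq_nonzero) simp
  ultimately have "u = of_bool (t = 0)"
    using False qu by (cases "t = 0") (auto simp: power_int_not_zero)
  thus ?thesis by (simp only: u_def)
qed

text \<open>One Bailey step applied to the unit pair raises the exponent 1/2 to 3/2. This pair ends
  the chain for \<open>\<delta> = 1\<close>.\<close>

lemma bsum_base_1:
  "bsum 1 (\<lambda>j. (-1) powi j * e (3/2 * of_int (j\<^sup>2 + j) - of_int j)) s = iq s"
proof -
  let ?\<alpha> = "\<lambda>j. (-1) powi j * e (1/2 * of_int (j\<^sup>2 + j) - of_int j)"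
  have "iq s = (\<Sum>\<^sub>\<infinity>t\<in>{0}. iq (s - t) * e (of_int (t\<^sup>2 + 1 * t)) * bsum 1 ?\<alpha> t)"
    unfolding bsum_base_1_aux by simp
  also have "\<dots> = (\<Sum>\<^sub>\<infinity>t. iq (s - t) * e (of_int (t\<^sup>2 + 1 * t)) * bsum 1 ?\<alpha> t)"
    unfolding bsum_base_1_aux by (rule infsum_cong_neutral) auto
  also have "\<dots> = bsum 1 (\<lambda>j. ?\<alpha> j * e (of_int (j\<^sup>2 + 1 * j))) s"
    by (rule bailey_step)
  also have "(\<lambda>j. ?\<alpha> j * e (of_int (j\<^sup>2 + 1 * j))) = (\<lambda>j. (-1) powi j * e (3/2 * of_int (j\<^sup>2 + j) - of_int j))"
  proof
    fix j :: int
    have "e (1/2 * of_int (j\<^sup>2 + j) - of_int j) * e (of_int (j\<^sup>2 + 1 * j)) = e (3/2 * of_int (j\<^sup>2 + j) - of_int j)"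
      unfolding e_add[symmetric] by (rule arg_cong[where f = e]) (simp add: field_simps)
    thus "?\<alpha> j * e (of_int (j\<^sup>2 + 1 * j)) = (-1) powi j * e (3/2 * of_int (j\<^sup>2 + j) - of_int j)"
      by (simp only: mult.assoc)
  qed
  finally show ?thesis by simp
qed

lemma bsum_add: "bsum c (\<lambda>j. \<alpha> j + \<beta> j) s = bsum c \<alpha> s + bsum c \<beta> s"
  unfolding bsum_def ring_distribs by (rule infsum_add[OF bsum_summable bsum_summable])

text \<open>This pair ends the chain for \<open>\<delta> = 0\<close>. Expanding (1 - q^(s-j)) (1 -
  q^(s+j)), the mixed terms are sums without the linear exponent, each equal to q^s h(s) by
  \<open>bsum_convert\<close>. Hence h(s-1) = (1 + q^(2s) - 2 q^(2s)) h(s), the recurrence of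
  1/(q^2;q^2)_s.\<close>

lemma bsum_base_0:
  "bsum 0 (\<lambda>j. (-1) powi j * e (1 * of_int (j\<^sup>2 + j) - of_int j)) s = iqp (q ^ 2) s"
proof -
  define h where "h = bsum 0 (\<lambda>j. (-1) powi j * e (1 * of_int (j\<^sup>2 + j) - of_int j))"
  have rec: "h (s - 1) = (1 - e (2 * of_int s)) * h s" for s
  proof -
    let ?a = "\<lambda>j. (-1) powi j * e (1 * of_int (j\<^sup>2 + j) - of_int j)"
    let ?b = "\<lambda>j. (-1) powi j * e (1 * of_int (j\<^sup>2 + j))"
    have b: "bsum 0 ?b s = e (of_int s) * h s"
      unfolding bsum_convert h_def bsum_base_0_1 ..
    have b': "bsum 0 (\<lambda>j. ?b (- j)) s = bsum 0 ?b s"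
      unfolding bsum_def by (subst infsum_int_reflect[of _ 0, symmetric]) (simp add: mult_ac)
    have "h (s - 1) = (\<Sum>\<^sub>\<infinity>j. (?a j * (1 + e (2 * of_int s)) + (- e (of_int s)) * (?b j + ?b (- j))) * (iq (s - j) * iq (s + j + 0)))"
      unfolding h_def bsum_def
    proof (rule infsum_cong)
      fix j :: int
      have 1: "iq (s - 1 - j) = (1 - e (of_int s - of_int j)) * iq (s - j)" using iq_rec[of "s - j"] by (simp add: algebra_simps)
      have 2: "iq (s - 1 + j + 0) = (1 - e (of_int s + of_int j)) * iq (s + j + 0)" using iq_rec[of "s + j"] by (simp add: algebra_simps)
      have 3: "e (of_int s - of_int j) * e (of_int s + of_int j) = e (2 * of_int s)"
        unfolding e_add[symmetric] by (rule arg_cong[where f = e]) simp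
      have 4: "(-1) powi (- j) = ((-1) powi j :: complex)" by (simp add: power_int_minus_left)
      have 5: "e (1 * of_int (j\<^sup>2 + j) - of_int j) * e (of_int s - of_int j) = e (of_int s) * e (1 * of_int ((- j)\<^sup>2 + (- j)))"
        unfolding e_add[symmetric] by (rule arg_cong[where f = e]) simp
      have 6: "e (1 * of_int (j\<^sup>2 + j) - of_int j) * e (of_int s + of_int j) = e (of_int s) * e (1 * of_int (j\<^sup>2 + j))"
        unfolding e_add[symmetric] by (rule arg_cong[where f = e]) simp
      have "?a j * ((1 - e (of_int s - of_int j)) * (1 - e (of_int s + of_int j)))
         = ?a j * (1 + e (of_int s - of_int j) * e (of_int s + of_int j)) - (-1) powi j * (e (1 * of_int (j\<^sup>2 + j) - of_int j) * e (of_int s - of_int j)) - (-1) powi j * (e (1 * of_int (j\<^sup>2 + j) - of_int j) * e (of_int s + of_int j))"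
        by (simp add: ring_distribs mult_ac)
      also have "\<dots> = ?a j * (1 + e (2 * of_int s)) + (- e (of_int s)) * (?b j + ?b (- j))"
        unfolding 3 4 5 6 by (simp add: ring_distribs mult_ac)
      finally have "?a j * ((1 - e (of_int s - of_int j)) * (1 - e (of_int s + of_int j))) * (iq (s - j) * iq (s + j + 0)) = (?a j * (1 + e (2 * of_int s)) + (- e (of_int s)) * (?b j + ?b (- j))) * (iq (s - j) * iq (s + j + 0))"
        by (rule arg_cong)
      thus "?a j * (iq (s - 1 - j) * iq (s - 1 + j + 0)) = (?a j * (1 + e (2 * of_int s)) + (- e (of_int s)) * (?b j + ?b (- j))) * (iq (s - j) * iq (s + j + 0))"
        unfolding 1 2 by (simp only: mult_ac)
    qed
    also have "\<dots> = bsum 0 (\<lambda>j. (1 + e (2 * of_int s)) * ?a j + (- e (of_int s)) * (?b j + ?b (- j))) s"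
      unfolding bsum_def by (simp only: mult.commute)
    also have "\<dots> = (1 + e (2 * of_int s)) * h s + (- e (of_int s)) * (e (of_int s) * h s + e (of_int s) * h s)"
      unfolding bsum_add bsum_cmult b' b h_def[symmetric] ..
    also have "\<dots> = (1 + e (2 * of_int s) - 2 * (e (of_int s) * e (of_int s))) * h s"
      by (simp add: ring_distribs mult_ac)
    also have "e (of_int s) * e (of_int s) = e (2 * of_int s)" by (simp flip: e_add)
    finally show ?thesis by simp
  qed
  have q2: "norm (q ^ 2) < 1" "q ^ 2 \<noteq> 0"
    using norm_q_less q_nonzero by (auto simp: norm_power power_less_one_iff)
  have e2: "(q ^ 2) powi s = e (2 * of_int s)" for s
  proof -
    have "(q ^ 2) powi s = (q powi 2) powi s" by simp
    also have "\<dots> = q powi (2 * s)" by (rule power_int_mult[symmetric])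
    also have "\<dots> = e (of_int (2 * s))" by (rule e_int[symmetric])
    finally show ?thesis by (simp only: of_int_mult of_int_numeral)
  qed
  have "h (int n) = iqp (q ^ 2) (int n)" for n
  proof (induction n)
    case 0
    have "h 0 = (\<Sum>\<^sub>\<infinity>j\<in>{0}. (-1) powi j * e (1 * of_int (j\<^sup>2 + j) - of_int j) * (iq (0 - j) * iq (0 + j + 0)))"
      unfolding h_def bsum_def by (rule infsum_cong_neutral) (auto simp: neq_iff)
    also have "\<dots> = 1" by simp
    finally show ?case using q2 by simp
  next
    case (Suc n)
    have ne: "1 - e (2 * of_int (int (Suc n))) \<noteq> 0"
      using e_neq_1[of "2 * int (Suc n)"] by simp
    have "(1 - e (2 * of_int (int (Suc n)))) * h (int (Suc n)) = h (int n)"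
      using rec[of "int (Suc n)"] by simp
    also have "\<dots> = (1 - e (2 * of_int (int (Suc n)))) * iqp (q ^ 2) (int (Suc n))"
      using Suc iqp_rec[OF q2, of "int (Suc n)"] by (simp only: e2) simp
    finally show ?case using ne by (simp only: mult_cancel_left) simp
  qed
  from this[of "nat s"] have "h s = iqp (q ^ 2) s" if "s \<ge> 0" using that by simp
  moreover have "h s = iqp (q ^ 2) s" if "s < 0" using that q2 by (simp add: h_def bsum_neg)
  ultimately show ?thesis unfolding h_def by linarith
qed

end

section \<open>Summing the chain over the indices r\<close>

locale bressoud = nome +
  fixes k i \<delta> :: nat
begin

text \<open>The bilateral form of the sum over $r_{a+1} \ge \dots \ge r_{k-1}$ with $r_a = s$ fixed. At \<open>a = i\<close> the chain
  switches from Bailey pairs relative to \<open>1\<close> to pairs relative to \<open>q\<close>.\<close>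

definition bressoud_sum :: "nat \<Rightarrow> int \<Rightarrow> complex" where
  "bressoud_sum a s = (if a \<le> i
     then bsum 0 (\<lambda>j. (-1) powi j * e ((real k - real i + real \<delta> / 2) * of_int (j\<^sup>2 + j) + (real i - real a) * of_int (j\<^sup>2))) s
     else e (of_int s) * bsum 1 (\<lambda>j. (-1) powi j * e ((real k - real a + real \<delta> / 2) * of_int (j\<^sup>2 + j) - of_int j)) s)"

definition lin_factor :: "nat \<Rightarrow> int \<Rightarrow> complex" where
  "lin_factor a s = (if i \<le> a then e (of_int s) else 1)"

text \<open>At a = i both forms agree by \<open>bsum_convert\<close>; this is the change from pairs
  relative to 1 to pairs relative to q.\<close>

lemma bressoud_sum_alt:
  assumes "i \<le> a"
  shows "bressoud_sum a s = e (of_int s) * bsum 1 (\<lambda>j. (-1) powi j * e ((real k - real a + real \<delta> / 2) * of_int (j\<^sup>2 + j) - of_int j)) s"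
proof (cases "a = i")
  case True
  thus ?thesis unfolding bressoud_sum_def bsum_convert[symmetric] by simp
next
  case False
  with assms have "\<not> a \<le> i" by simp
  thus ?thesis unfolding bressoud_sum_def by (simp only: if_False)
qed

lemma bressoud_sum_neg: "s < 0 \<Longrightarrow> bressoud_sum a s = 0"
  by (simp add: bressoud_sum_def bsum_neg)

text \<open>A Bailey step relative to 1 below i. From i on it is a step relative to q, whose
  exponent t^2 + t uses up the factor q^t in front of the next sum.\<close>

lemma bressoud_sum_step: "bressoud_sum a s = (\<Sum>\<^sub>\<infinity>t. lin_factor a s * iq (s - t) * e (of_int (t\<^sup>2)) * bressoud_sum (Suc a) t)"
proof (cases "i \<le> a")
  case False
  let ?\<alpha> = "\<lambda>j. (-1) powi j * e ((real k - real i + real \<delta> / 2) * of_int (j\<^sup>2 + j) + (real i - real (Suc a)) * of_int (j\<^sup>2))"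
  have "(\<Sum>\<^sub>\<infinity>t. lin_factor a s * iq (s - t) * e (of_int (t\<^sup>2)) * bressoud_sum (Suc a) t) = (\<Sum>\<^sub>\<infinity>t. iq (s - t) * e (of_int (t\<^sup>2 + 0 * t)) * bsum 0 ?\<alpha> t)"
    using False by (simp add: lin_factor_def bressoud_sum_def)
  also have "\<dots> = bsum 0 (\<lambda>j. ?\<alpha> j * e (of_int (j\<^sup>2 + 0 * j))) s"
    by (rule bailey_step)
  also have "(\<lambda>j. ?\<alpha> j * e (of_int (j\<^sup>2 + 0 * j))) = (\<lambda>j. (-1) powi j * e ((real k - real i + real \<delta> / 2) * of_int (j\<^sup>2 + j) + (real i - real a) * of_int (j\<^sup>2)))"
    unfolding mult.assoc e_add[symmetric] by (rule ext, rule arg_cong2[where f = "(*)"], rule refl, rule arg_cong[where f = e]) (simp add: ring_distribs)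
  finally show ?thesis using False by (simp add: bressoud_sum_def)
next
  case True
  let ?\<alpha> = "\<lambda>j. (-1) powi j * e ((real k - real (Suc a) + real \<delta> / 2) * of_int (j\<^sup>2 + j) - of_int j)"
  have "(\<Sum>\<^sub>\<infinity>t. lin_factor a s * iq (s - t) * e (of_int (t\<^sup>2)) * bressoud_sum (Suc a) t) = (\<Sum>\<^sub>\<infinity>t. e (of_int s) * (iq (s - t) * e (of_int (t\<^sup>2 + 1 * t)) * bsum 1 ?\<alpha> t))"
    using True by (simp add: lin_factor_def bressoud_sum_def e_add mult_ac)
  also have "\<dots> = e (of_int s) * bsum 1 (\<lambda>j. ?\<alpha> j * e (of_int (j\<^sup>2 + 1 * j))) s"
    by (simp only: infsum_cmult_right' bailey_step)
  also have "(\<lambda>j. ?\<alpha> j * e (of_int (j\<^sup>2 + 1 * j))) = (\<lambda>j. (-1) powi j * e ((real k - real a + real \<delta> / 2) * of_int (j\<^sup>2 + j) - of_int j))"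
    unfolding mult.assoc e_add[symmetric] by (rule ext, rule arg_cong2[where f = "(*)"], rule refl, rule arg_cong[where f = e]) (simp add: ring_distribs)
  finally show ?thesis unfolding bressoud_sum_alt[OF True] ..
qed

text \<open>The coefficient 1 + \<open>\<delta>\<close>/2 is 3/2 or 1, the exponent of the two final
  pairs. For i = k there is no linear factor and the sum is still relative to 1;
  \<open>bsum_base_0_1\<close> covers this case.\<close>

lemma bressoud_sum_last:
  assumes "k \<ge> 2" "i \<le> k" "\<delta> \<in> {0, 1}"
  shows "bressoud_sum (k - 1) s = lin_factor (k - 1) s * iqp (q ^ (2 - \<delta>)) s"
proof -
  let ?b = "\<lambda>j. (-1) powi j * e ((1 + real \<delta> / 2) * of_int (j\<^sup>2 + j) - of_int j)"
  have base: "bsum 1 ?b s = iqp (q ^ (2 - \<delta>)) s"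
  proof (cases "\<delta> = 0")
    case True
    have "bsum 1 (\<lambda>j. (-1) powi j * e (1 * of_int (j\<^sup>2 + j) - of_int j)) s = iqp (q ^ 2) s"
      unfolding bsum_base_0_1[symmetric] by (rule bsum_base_0)
    with True show ?thesis by simp
  next
    case False
    hence "\<delta> = 1" using assms by simp
    thus ?thesis using bsum_base_1[of s] by simp
  qed
  show ?thesis
  proof (cases "i = k")
    case True
    have "bressoud_sum (k - 1) s = bsum 0 (\<lambda>j. (-1) powi j * e ((real k - real i + real \<delta> / 2) * of_int (j\<^sup>2 + j) + (real i - real (k - 1)) * of_int (j\<^sup>2))) s"
      unfolding bressoud_sum_def using True by (intro if_P) simp
    also have "(\<lambda>j. (-1) powi j * e ((real k - real i + real \<delta> / 2) * of_int (j\<^sup>2 + j) + (real i - real (k - 1)) * of_int (j\<^sup>2))) = ?b"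
      by (rule ext, rule arg_cong2[where f = "(*)"], rule refl, rule arg_cong[where f = e]) (use True assms in \<open>simp add: ring_distribs of_nat_diff\<close>)
    finally have "bressoud_sum (k - 1) s = bsum 0 ?b s" .
    moreover have "lin_factor (k - 1) s = 1" unfolding lin_factor_def using True assms by (intro if_not_P) simp
    ultimately show ?thesis by (simp only: bsum_base_0_1 base mult_1_left)
  next
    case False
    hence ik: "i \<le> k - 1" using assms by simp
    have "real k - real (k - 1) = 1" using assms by (simp add: of_nat_diff)
    thus ?thesis unfolding bressoud_sum_alt[OF ik] using ik base by (simp only: lin_factor_def if_True)
  qed
qed

text \<open>The square of r_1 has no factor of its own: with weight 1/N it is absorbed into D. The
  function g stands for the sum over all indices after r_n.\<close>

definition chain :: "(int \<Rightarrow> complex) \<Rightarrow> nat \<Rightarrow> (int \<Rightarrow> complex) \<Rightarrow> (nat \<Rightarrow> int) \<Rightarrow> complex" where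
  "chain D n g r = D (r 1) * (\<Prod>a\<in>{1..<n}. lin_factor a (r a) * iq (r a - r (Suc a)) * e (of_int ((r (Suc a))\<^sup>2))) * g (r n)"

lemma chain_fun_upd:
  assumes "n \<ge> 1"
  shows "chain D (Suc n) g (f(Suc n := x)) =
    D (f 1) * (\<Prod>a\<in>{1..<n}. lin_factor a (f a) * iq (f a - f (Suc a)) * e (of_int ((f (Suc a))\<^sup>2)))
      * (lin_factor n (f n) * iq (f n - x) * e (of_int (x\<^sup>2)) * g x)"
proof -
  let ?f = "f(Suc n := x)"
  have "(\<Prod>a\<in>{1..<n}. lin_factor a (?f a) * iq (?f a - ?f (Suc a)) * e (of_int ((?f (Suc a))\<^sup>2)))
      = (\<Prod>a\<in>{1..<n}. lin_factor a (f a) * iq (f a - f (Suc a)) * e (of_int ((f (Suc a))\<^sup>2)))"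
    by (rule prod.cong) auto
  moreover have "{1..<Suc n} = insert n {1..<n}" using assms by auto
  ultimately show ?thesis using assms by (simp add: chain_def mult_ac)
qed

lemma chain_reduce:
  assumes n: "n \<ge> 1" and sum: "chain D (Suc n) g summable_on Zn (Suc n)"
  defines "g' \<equiv> \<lambda>s. \<Sum>\<^sub>\<infinity>t. lin_factor n s * iq (s - t) * e (of_int (t\<^sup>2)) * g t"
  shows "chain D n g' summable_on Zn n" "infsum (chain D n g') (Zn n) = infsum (chain D (Suc n) g) (Zn (Suc n))"
proof -
  have s: "(\<lambda>(f, x). chain D (Suc n) g (f(Suc n := x))) summable_on (Zn n \<times> UNIV)"
    using sum by (simp only: summable_on_Zn_Suc)
  have eq: "(\<Sum>\<^sub>\<infinity>x. chain D (Suc n) g (f(Suc n := x))) = chain D n g' f" for f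
    by (simp only: chain_fun_upd[OF n] infsum_cmult_right' g'_def) (simp only: chain_def)
  show "chain D n g' summable_on Zn n"
    using summable_on_Sigma_banach[OF s] by (simp only: eq)
  show "infsum (chain D n g') (Zn n) = infsum (chain D (Suc n) g) (Zn (Suc n))"
    using infsum_Sigma'_banach[OF s] by (simp only: eq infsum_Zn_Suc)
qed

text \<open>The innermost index is removed repeatedly; by \<open>bressoud_sum_step\<close> the tail
  keeps its shape.\<close>

lemma chain_total:
  assumes "chain D (Suc n) (bressoud_sum (Suc n)) summable_on Zn (Suc n)"
  shows "infsum (chain D (Suc n) (bressoud_sum (Suc n))) (Zn (Suc n)) = (\<Sum>\<^sub>\<infinity>s. D s * bressoud_sum 1 s)"
  using assms
proof (induction n)
  case 0
  show ?case
    by (rule infsum_reindex_bij_witness[of _ "\<lambda>x. (\<lambda>_. 0)(Suc 0 := x)" "\<lambda>r. r 1"]) (auto simp: chain_def Zn_def)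
next
  case (Suc n)
  have "(\<lambda>s. \<Sum>\<^sub>\<infinity>t. lin_factor (Suc n) s * iq (s - t) * e (of_int (t\<^sup>2)) * bressoud_sum (Suc (Suc n)) t) = bressoud_sum (Suc n)"
    by (rule ext) (rule bressoud_sum_step[symmetric])
  with chain_reduce[OF _ Suc.prems] Suc.IH show ?case by simp
qed

text \<open>The reciprocals force r to decrease and g forces its last entry to be nonnegative. Sums
  over the cone of admissible chains may therefore be extended to the whole lattice.\<close>

lemma chain_nonneg:
  assumes nz: "chain D n g r \<noteq> 0" and g: "\<And>x. x < 0 \<Longrightarrow> g x = 0" and a: "1 \<le> a" "a \<le> n"
  shows "r a \<ge> 0" "a < n \<Longrightarrow> r (Suc a) \<le> r a"
proof -
  have le: "r (Suc a) \<le> r a" if "1 \<le> a" "a < n" for a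
  proof (rule ccontr)
    assume "\<not> r (Suc a) \<le> r a"
    hence "(\<Prod>a\<in>{1..<n}. lin_factor a (r a) * iq (r a - r (Suc a)) * e (of_int ((r (Suc a))\<^sup>2))) = 0"
      using that by (intro prod_zero bexI[of _ a]) auto
    thus False using nz by (simp only: chain_def mult_zero_left mult_zero_right)
  qed
  have "r n \<ge> 0"
  proof (rule ccontr)
    assume "\<not> r n \<ge> 0"
    hence "g (r n) = 0" by (intro g) simp
    thus False using nz by (simp add: chain_def)
  qed
  with a(2) show "r a \<ge> 0" using a(1)
  proof (induction rule: inc_induct)
    case (step m)
    thus ?case using le[of m] by simp
  qed
  show "a < n \<Longrightarrow> r (Suc a) \<le> r a" using le a by simp
qed

text \<open>The linear factors are unbounded at negative arguments, but there the term is 0 by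
  \<open>chain_nonneg\<close>; otherwise they are at most 1, and the squares dominate.\<close>

lemma chain_summable:
  assumes D: "D summable_on UNIV" and g: "\<And>x. x < 0 \<Longrightarrow> g x = 0" "\<And>x. norm (g x) \<le> K"
  shows "chain D (Suc n) g summable_on Zn (Suc n)"
proof -
  define G where "G = (\<lambda>(a :: nat) x. if a = 1 then D x else e (of_int (x\<^sup>2)))"
  have "(\<lambda>x::int. e (of_int (x\<^sup>2))) summable_on UNIV"
    by (rule summable_gauss_bounded[of 1 _ 1 0]) auto
  hence "G a summable_on UNIV" for a
    using D by (cases "a = 1") (simp_all add: G_def)
  hence "(\<lambda>r. \<Prod>a=1..Suc n. G a (r a)) summable_on Zn (Suc n)"
    by (intro Zn_prod(1))
  hence "(\<lambda>r. iqB ^ n * K * norm (\<Prod>a=1..Suc n. G a (r a))) summable_on Zn (Suc n)"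
    by (intro summable_on_cmult_right) (simp only: summable_on_iff_abs_summable_on_complex)
  thus ?thesis
  proof (rule summable_on_norm_bound)
    fix r assume "r \<in> Zn (Suc n)"
    have K: "K \<ge> 0" using order_trans[OF norm_ge_zero g(2)] .
    show "norm (chain D (Suc n) g r) \<le> iqB ^ n * K * norm (\<Prod>a=1..Suc n. G a (r a))"
    proof (cases "chain D (Suc n) g r = 0")
      case True
      thus ?thesis using K iqB(1) by simp
    next
      case False
      have "(\<Prod>a=1..Suc n. G a (r a)) = (\<Prod>a\<in>{1..<Suc (Suc n)}. G a (r a))"
        by (rule prod.cong) auto
      also have "\<dots> = G 1 (r 1) * (\<Prod>a\<in>{Suc 1..<Suc (Suc n)}. G a (r a))"
        by (rule prod.atLeast_Suc_lessThan) simp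
      also have "(\<Prod>a\<in>{Suc 1..<Suc (Suc n)}. G a (r a)) = (\<Prod>a\<in>{1..<Suc n}. G (Suc a) (r (Suc a)))"
        by (rule prod.shift_bounds_Suc_ivl)
      also have "\<dots> = (\<Prod>a\<in>{1..<Suc n}. e (of_int ((r (Suc a))\<^sup>2)))"
        by (rule prod.cong) (auto simp: G_def)
      finally have prod: "(\<Prod>a=1..Suc n. G a (r a)) = D (r 1) * \<dots>" by (simp add: G_def)
      have "norm (\<Prod>a\<in>{1..<Suc n}. lin_factor a (r a) * iq (r a - r (Suc a)) * e (of_int ((r (Suc a))\<^sup>2)))
         \<le> (\<Prod>a\<in>{1..<Suc n}. iqB * norm (e (of_int ((r (Suc a))\<^sup>2))))"
        unfolding prod_norm[symmetric]
      proof (rule prod_mono, intro conjI)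
        fix a assume "a \<in> {1..<Suc n}"
        hence "r a \<ge> 0" by (intro chain_nonneg(1)[OF False g(1)]) auto
        hence "norm (lin_factor a (r a)) \<le> 1" by (simp add: lin_factor_def norm_e_le_1)
        hence "norm (lin_factor a (r a)) * norm (iq (r a - r (Suc a))) \<le> 1 * iqB"
          by (intro mult_mono iqB) auto
        thus "norm (lin_factor a (r a) * iq (r a - r (Suc a)) * e (of_int ((r (Suc a))\<^sup>2))) \<le> iqB * norm (e (of_int ((r (Suc a))\<^sup>2)))"
          unfolding norm_mult by (intro mult_right_mono) auto
      qed auto
      also have "\<dots> = iqB ^ n * norm (\<Prod>a\<in>{1..<Suc n}. e (of_int ((r (Suc a))\<^sup>2)))"
        by (simp only: prod.distrib prod_norm prod_constant) simp
      finally have "norm (D (r 1)) * norm (\<Prod>a\<in>{1..<Suc n}. lin_factor a (r a) * iq (r a - r (Suc a)) * e (of_int ((r (Suc a))\<^sup>2))) * norm (g (r (Suc n)))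
         \<le> norm (D (r 1)) * (iqB ^ n * norm (\<Prod>a\<in>{1..<Suc n}. e (of_int ((r (Suc a))\<^sup>2)))) * K"
        by (intro mult_mono g(2) order_refl mult_nonneg_nonneg) (use iqB(1) in auto)
      also have "\<dots> = iqB ^ n * K * norm (\<Prod>a=1..Suc n. G a (r a))"
        unfolding prod norm_mult by (simp only: mult_ac)
      finally show ?thesis unfolding chain_def norm_mult .
    qed
  qed
qed

end

section \<open>The inverse Cartan matrix\<close>

text \<open>The Green function of the discrete Laplacian on 0..M+1 with zero boundary values, that
  is, the inverse Cartan matrix of A_M.\<close>

definition kmat :: "nat \<Rightarrow> nat \<Rightarrow> nat \<Rightarrow> real" where
  "kmat M a b = real (min a b) - real a * real b / real (Suc M)"

definition kapp :: "nat \<Rightarrow> (nat \<Rightarrow> real) \<Rightarrow> nat \<Rightarrow> real" where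
  "kapp M w a = (\<Sum>b=1..M. kmat M a b * w b)"

lemma kmat_sym: "kmat M a b = kmat M b a"
  by (simp add: kmat_def min.commute mult.commute)

lemma kmat_0: "kmat M a 0 = 0" "kmat M 0 a = 0"
  by (simp_all add: kmat_def)

lemma kmat_top: "a \<le> Suc M \<Longrightarrow> kmat M a (Suc M) = 0"
  by (simp add: kmat_def)

lemma kmat_laplace:
  assumes "1 \<le> b"
  shows "2 * kmat M a b - kmat M a (b - 1) - kmat M a (Suc b) = of_bool (a = b)"
proof -
  obtain c where b: "b = Suc c" using assms by (cases b) auto
  define t where "t = real a / real (Suc M)"
  have K: "kmat M a x = real (min a x) - t * real x" for x by (simp add: kmat_def t_def)
  consider "a \<le> c" | "a = Suc c" | "a \<ge> Suc (Suc c)" by linarith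
  thus ?thesis
    unfolding b K by cases (simp_all add: min_def algebra_simps)
qed

text \<open>The discrete second Green identity; the sum telescopes to its boundary terms.\<close>

lemma green:
  fixes f g :: "nat \<Rightarrow> real"
  shows "(\<Sum>b=1..M. g b * (2 * f b - f (b - 1) - f (Suc b)) - (2 * g b - g (b - 1) - g (Suc b)) * f b)
     = (g (Suc M) * f M - g M * f (Suc M)) - (g 1 * f 0 - g 0 * f 1)"
proof (induction M)
  case (Suc M)
  show ?case unfolding sum.cl_ivl_Suc[of _ 1 M] using Suc.IH by (simp add: algebra_simps)
qed simp

lemma kapp_laplace:
  assumes "f 0 = 0" "f (Suc M) = 0" "1 \<le> a" "a \<le> M"
  shows "kapp M (\<lambda>b. 2 * f b - f (b - 1) - f (Suc b)) a = f a"
proof -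
  have "(\<Sum>b=1..M. kmat M a b * (2 * f b - f (b - 1) - f (Suc b)) - of_bool (a = b) * f b) = 0"
  proof -
    have "(\<Sum>b=1..M. kmat M a b * (2 * f b - f (b - 1) - f (Suc b)) - of_bool (a = b) * f b)
        = (\<Sum>b=1..M. kmat M a b * (2 * f b - f (b - 1) - f (Suc b)) - (2 * kmat M a b - kmat M a (b - 1) - kmat M a (Suc b)) * f b)"
      by (intro sum.cong refl) (simp only: kmat_laplace atLeastAtMost_iff)
    also have "\<dots> = 0"
      unfolding green using assms by (simp add: kmat_0 kmat_top)
    finally show ?thesis .
  qed
  moreover have "(\<Sum>b=1..M. of_bool (a = b) * f b) = f a"
  proof -
    have "(\<Sum>b=1..M. of_bool (a = b) * f b) = (\<Sum>b=1..M. if a = b then f b else 0)"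
      by (intro sum.cong refl) simp
    thus ?thesis using assms by simp
  qed
  ultimately show ?thesis by (simp add: kapp_def sum_subtractf)
qed

lemma kapp_add: "kapp M (\<lambda>b. u b + v b) a = kapp M u a + kapp M v a"
  by (simp add: kapp_def ring_distribs sum.distrib)

lemma kapp_diff: "kapp M (\<lambda>b. u b - v b) a = kapp M u a - kapp M v a"
  by (simp add: kapp_def ring_distribs sum_subtractf)

lemma kapp_cmult: "kapp M (\<lambda>b. c * u b) a = c * kapp M u a"
  by (simp add: kapp_def sum_distrib_left mult.left_commute)

lemma kapp_cong: "(\<And>b. b \<in> {1..M} \<Longrightarrow> u b = v b) \<Longrightarrow> kapp M u a = kapp M v a"
  unfolding kapp_def by (intro sum.cong) auto

lemma kapp_sym: "(\<Sum>a=1..M. u a * kapp M v a) = (\<Sum>a=1..M. v a * kapp M u a)"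
  unfolding kapp_def sum_distrib_left
  by (subst sum.swap) (intro sum.cong refl, simp add: kmat_sym mult_ac)

definition kmatrix :: "nat \<Rightarrow> real Matrix.mat" where
  "kmatrix M = Matrix.mat M M (\<lambda>(i, j). kmat M (Suc i) (Suc j))"

lemma tridiagonal_sum:
  fixes f :: "nat \<Rightarrow> real"
  assumes "f 0 = 0" "f (Suc M) = 0" "j < M"
  shows "(\<Sum>l\<in>{0..<M}. (2 * of_bool (j = l) - of_bool (j + 1 = l) - of_bool (j = l + 1)) * f (Suc l))
    = 2 * f (Suc j) - f (Suc j - 1) - f (Suc (Suc j))"
proof -
  have 1: "(\<Sum>l\<in>{0..<M}. of_bool (j = l) * f (Suc l)) = f (Suc j)"
    using assms by (simp add: of_bool_def if_distrib[of "\<lambda>x. x * _"] cong: if_cong)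
  have 2: "(\<Sum>l\<in>{0..<M}. of_bool (j + 1 = l) * f (Suc l)) = f (Suc (Suc j))"
    using assms by (cases "Suc j = M") (auto simp: of_bool_def if_distrib[of "\<lambda>x. x * _"] cong: if_cong)
  have 3: "(\<Sum>l\<in>{0..<M}. of_bool (j = l + 1) * f (Suc l)) = f j"
  proof (cases j)
    case 0
    thus ?thesis using assms by simp
  next
    case (Suc m)
    thus ?thesis using assms by (simp add: of_bool_def if_distrib[of "\<lambda>x. x * _"] cong: if_cong)
  qed
  have "(\<Sum>l\<in>{0..<M}. (2 * of_bool (j = l) - of_bool (j + 1 = l) - of_bool (j = l + 1)) * f (Suc l))
     = 2 * (\<Sum>l\<in>{0..<M}. of_bool (j = l) * f (Suc l)) - (\<Sum>l\<in>{0..<M}. of_bool (j + 1 = l) * f (Suc l)) - (\<Sum>l\<in>{0..<M}. of_bool (j = l + 1) * f (Suc l))"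
    by (simp only: left_diff_distrib sum_subtractf sum_distrib_left mult.assoc)
  thus ?thesis unfolding 1 2 3 by simp
qed

lemma cartan_kmatrix: "cartan (Suc M) * kmatrix M = 1\<^sub>m M"
proof (rule eq_matI)
  fix j k assume "j < dim_row (1\<^sub>m M)" "k < dim_col (1\<^sub>m M)"
  hence jk: "j < M" "k < M" by auto
  have "(cartan (Suc M) * kmatrix M) $$ (j, k)
     = (\<Sum>l\<in>{0..<M}. (2 * of_bool (j = l) - of_bool (j + 1 = l) - of_bool (j = l + 1)) * kmat M (Suc k) (Suc l))"
    using jk by (simp add: cartan_def kmatrix_def scalar_prod_def kmat_sym[of M _ "Suc k"])
  also have "\<dots> = 2 * kmat M (Suc k) (Suc j) - kmat M (Suc k) (Suc j - 1) - kmat M (Suc k) (Suc (Suc j))"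
    using jk by (intro tridiagonal_sum) (auto simp: kmat_0 kmat_top)
  also have "\<dots> = of_bool (Suc k = Suc j)" by (rule kmat_laplace) simp
  also have "\<dots> = 1\<^sub>m M $$ (j, k)" using jk by auto
  finally show "(cartan (Suc M) * kmatrix M) $$ (j, k) = 1\<^sub>m M $$ (j, k)" .
qed (auto simp: cartan_def kmatrix_def)

lemma cartan_sym: "transpose_mat (cartan N) = cartan N"
  by (rule eq_matI) (auto simp: cartan_def)

lemma kmatrix_sym: "transpose_mat (kmatrix N) = kmatrix N"
  by (rule eq_matI) (auto simp: kmatrix_def kmat_sym)

text \<open>Symmetry of both matrices turns the right inverse into a two-sided one. Hence
  \<open>mat_inverse\<close> succeeds, and uniqueness of inverses identifies its value.\<close>

lemma cartan_inv_eq: "cartan_inv (Suc M) = kmatrix M"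
proof -
  have C: "cartan (Suc M) \<in> carrier_mat M M" and K: "kmatrix M \<in> carrier_mat M M"
    by (auto simp: cartan_def kmatrix_def)
  have "kmatrix M * cartan (Suc M) = transpose_mat (cartan (Suc M) * kmatrix M)"
    by (simp only: transpose_mult[OF C K] cartan_sym kmatrix_sym)
  hence KC: "kmatrix M * cartan (Suc M) = 1\<^sub>m M" by (simp add: cartan_kmatrix)
  have "cartan (Suc M) \<in> Units (ring_mat TYPE(real) M undefined)"
    using C K KC cartan_kmatrix by (auto simp: Units_def ring_mat_def)
  then obtain B where B: "mat_inverse (cartan (Suc M)) = Some B"
    using mat_inverse(1)[OF C, of undefined] by (cases "mat_inverse (cartan (Suc M))") auto
  from mat_inverse(2)[OF C this] have "B * cartan (Suc M) = 1\<^sub>m M" "B \<in> carrier_mat M M" by auto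
  hence "B = B * (cartan (Suc M) * kmatrix M)" by (simp add: cartan_kmatrix)
  also have "\<dots> = (B * cartan (Suc M)) * kmatrix M"
    using \<open>B \<in> carrier_mat M M\<close> C K by (simp add: assoc_mult_mat)
  also have "\<dots> = kmatrix M" using \<open>B * cartan (Suc M) = 1\<^sub>m M\<close> K by simp
  finally show ?thesis by (simp add: cartan_inv_def B)
qed

definition rcomp :: "int Matrix.vec \<Rightarrow> nat \<Rightarrow> real" where
  "rcomp v b = of_int (v $ (b - 1))"

lemma sum_0_lessThan_Suc: "(\<Sum>l\<in>{0..<M}. f (Suc l)) = (\<Sum>b=1..M. f b)" for f :: "nat \<Rightarrow> 'a :: comm_monoid_add"
  by (simp add: sum.atLeast1_atMost_eq atLeast0LessThan)

lemma cartan_inv_vec: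
  assumes "v \<in> carrier_vec M" "i < M"
  shows "(cartan_inv (Suc M) *\<^sub>v rvec v) $ i = kapp M (rcomp v) (Suc i)"
proof -
  have "(cartan_inv (Suc M) *\<^sub>v rvec v) $ i = (\<Sum>l\<in>{0..<M}. kmat M (Suc i) (Suc l) * of_int (v $ l))"
    using assms by (simp add: cartan_inv_eq kmatrix_def scalar_prod_def)
  also have "\<dots> = (\<Sum>l\<in>{0..<M}. kmat M (Suc i) (Suc l) * rcomp v (Suc l))"
    by (simp add: rcomp_def)
  also have "\<dots> = kapp M (rcomp v) (Suc i)"
    unfolding kapp_def by (rule sum_0_lessThan_Suc)
  finally show ?thesis .
qed

lemma cform_eq:
  assumes "v \<in> carrier_vec M" "w \<in> carrier_vec M"
  shows "cform (Suc M) v w = (\<Sum>a=1..M. rcomp v a * kapp M (rcomp w) a)"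
proof -
  have "dim_vec (cartan_inv (Suc M) *\<^sub>v rvec w) = M" by (simp add: cartan_inv_eq kmatrix_def)
  hence "cform (Suc M) v w = (\<Sum>l\<in>{0..<M}. of_int (v $ l) * (cartan_inv (Suc M) *\<^sub>v rvec w) $ l)"
    using assms by (simp add: cform_def scalar_prod_def)
  also have "\<dots> = (\<Sum>l\<in>{0..<M}. rcomp v (Suc l) * kapp M (rcomp w) (Suc l))"
    using assms by (intro sum.cong refl) (simp add: cartan_inv_vec rcomp_def)
  also have "\<dots> = (\<Sum>a=1..M. rcomp v a * kapp M (rcomp w) a)"
    by (rule sum_0_lessThan_Suc)
  finally show ?thesis .
qed

lemma evec_carrier: "evec (Suc M) p \<in> carrier_vec M"
  by (simp add: evec_def)

lemma evec_part_Cons: "evec_part N (p # lam) = evec N p + evec_part N lam"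
  by (simp add: evec_part_def)

lemma evec_part_carrier: "evec_part (Suc M) lam \<in> carrier_vec M"
proof (induction lam)
  case (Cons p lam)
  thus ?case unfolding evec_part_Cons using evec_carrier by (rule add_carrier_vec[rotated])
qed (simp add: evec_part_def)

lemma evec_part_nonneg: "i < M \<Longrightarrow> evec_part (Suc M) lam $ i \<ge> 0"
proof (induction lam)
  case (Cons p lam)
  have "evec (Suc M) p $ i \<ge> 0" using Cons.prems by (auto simp: evec_def unit_vec_def)
  thus ?case using Cons evec_part_carrier[of M lam] by (auto simp: evec_part_Cons)
qed (simp add: evec_part_def)

lemma sum_list_evec_part:
  assumes "\<forall>p\<in>set lam. p \<le> M"
  shows "real (sum_list lam) = (\<Sum>b=1..M. real b * rcomp (evec_part (Suc M) lam) b)"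
  using assms
proof (induction lam)
  case Nil
  have "(\<Sum>b=1..M. real b * rcomp (evec_part (Suc M) []) b) = 0"
    by (intro sum.neutral) (auto simp: evec_part_def rcomp_def)
  thus ?case by simp
next
  case (Cons p lam)
  have "(\<Sum>b=1..M. real b * rcomp (evec (Suc M) p) b) = (\<Sum>b=1..M. if b = p then real p else 0)"
    by (intro sum.cong refl) (auto simp: rcomp_def evec_def unit_vec_def)
  also have "\<dots> = real p" using Cons.prems by (auto simp: not_le)
  finally have "real p = (\<Sum>b=1..M. real b * rcomp (evec (Suc M) p) b)" ..
  moreover have "rcomp (evec_part (Suc M) (p # lam)) b = rcomp (evec (Suc M) p) b + rcomp (evec_part (Suc M) lam) b" if "b \<in> {1..M}" for b
  proof -
    have "b - 1 < M" using that by auto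
    thus ?thesis using carrier_vecD[OF evec_part_carrier[of M lam]] by (simp add: rcomp_def evec_part_Cons)
  qed
  ultimately show ?case using Cons by (simp add: ring_distribs sum.distrib)
qed

text \<open>The differences of y are minus the Laplacian of the function c b -
  \<open>psum y b\<close> with the sign reversed in the second difference; the slope c is chosen so
  that this function vanishes at both ends, as \<open>kapp_laplace\<close> demands.\<close>

lemma kapp_difference:
  assumes "a \<le> M"
  shows "kapp M (\<lambda>b. of_int (y (Suc b)) - of_int (y b)) a = real a / real (Suc M) * of_int (psum y (Suc M)) - of_int (psum y a)"
proof (cases "a = 0")
  case True
  thus ?thesis by (simp add: kapp_def kmat_0)
next
  case False
  define c where "c = of_int (psum y (Suc M)) / real (Suc M)"
  have c: "real (Suc M) * c = of_int (psum y (Suc M))" by (simp add: c_def del: psum_Suc)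
  define f where "f = (\<lambda>a. real a * c - of_int (psum y a))"
  have "kapp M (\<lambda>b. of_int (y (Suc b)) - of_int (y b)) a = kapp M (\<lambda>b. 2 * f b - f (b - 1) - f (Suc b)) a"
  proof (rule kapp_cong)
    fix b assume "b \<in> {1..M}"
    then obtain d where b: "b = Suc d" by (cases b) auto
    show "of_int (y (Suc b)) - of_int (y b) = 2 * f b - f (b - 1) - f (Suc b)"
      by (simp add: b f_def algebra_simps)
  qed
  also have "\<dots> = f a"
    using False assms by (intro kapp_laplace) (auto simp: f_def c simp del: psum_Suc of_nat_Suc)
  finally show ?thesis by (simp add: f_def c_def del: psum_Suc of_nat_Suc)
qed

text \<open>Summation by parts. The slope c stays arbitrary for the induction; for c =
  \<open>psum y (Suc M)\<close>/(M+1) the last term drops out.\<close>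

lemma abel_squares:
  fixes y :: "nat \<Rightarrow> int" and c :: real
  shows "(\<Sum>a=1..M. (of_int (y (Suc a)) - of_int (y a)) * (real a * c - of_int (psum y a)))
    = (\<Sum>a=1..Suc M. (of_int (y a))\<^sup>2) - c * of_int (psum y (Suc M)) + of_int (y (Suc M)) * (real (Suc M) * c - of_int (psum y (Suc M)))"
proof (induction M)
  case 0
  show ?case by (simp add: power2_eq_square algebra_simps)
next
  case (Suc M)
  show ?case
    unfolding sum.cl_ivl_Suc[of _ 1 M] sum.cl_ivl_Suc[of _ 1 "Suc M"] Suc.IH
    by (simp add: power2_eq_square algebra_simps)
qed

section \<open>Occupation numbers and lattice points\<close>

definition mults :: "nat \<Rightarrow> nat list \<Rightarrow> nat \<Rightarrow> int" where
  "mults M lam a = (if a \<in> {1..M} then evec_part (Suc M) lam $ (a - 1) else 0)"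

text \<open>Neighbouring classes differ by the multiplicity L_a, which makes n_a = (L_a + y_{a+1} -
  y_a)/2 an integer; the class of y_N is that of \<open>\<sigma>\<close>.\<close>

definition parity_class :: "nat \<Rightarrow> nat list \<Rightarrow> nat \<Rightarrow> nat \<Rightarrow> int" where
  "parity_class M lam \<sigma> a = int \<sigma> + (\<Sum>b=a..M. mults M lam b)"

text \<open>The prescribed total is the boundary value m_N = 2b, which in the vector m corresponds
  to the source term 2 r_1 e_{N-1}.\<close>

definition lattice_pts :: "nat \<Rightarrow> nat list \<Rightarrow> nat \<Rightarrow> int \<Rightarrow> (nat \<Rightarrow> int) set" where
  "lattice_pts M lam \<sigma> b =
     {y \<in> Zn (Suc M). (\<forall>a\<in>{1..Suc M}. even (y a - parity_class M lam \<sigma> a)) \<and> psum y (Suc M) = 2 * b}"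

definition occ_vec :: "nat \<Rightarrow> nat list \<Rightarrow> (nat \<Rightarrow> int) \<Rightarrow> int Matrix.vec" where
  "occ_vec M lam y = Matrix.vec M (\<lambda>i. occ (mults M lam) y (Suc i))"

lemma mults_nonneg: "mults M lam a \<ge> 0"
  using evec_part_nonneg[of "a - 1" M lam] by (auto simp: mults_def)

lemma rcomp_evec_part: "b \<in> {1..M} \<Longrightarrow> rcomp (evec_part (Suc M) lam) b = of_int (mults M lam b)"
  by (simp add: rcomp_def mults_def)

lemma parity_class_Suc: "a \<in> {1..M} \<Longrightarrow> parity_class M lam \<sigma> a = mults M lam a + parity_class M lam \<sigma> (Suc a)"
  by (simp add: parity_class_def sum.atLeast_Suc_atMost)

lemma even_parity_class: "a \<in> {1..M} \<Longrightarrow> even (mults M lam a + parity_class M lam \<sigma> (Suc a) - parity_class M lam \<sigma> a)"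
  by (simp add: parity_class_Suc)

lemma occ_real:
  assumes "even (l a + y (Suc a) - y a)"
  shows "2 * occ l y a = l a + y (Suc a) - y a"
  using assms by (simp add: occ_def)

lemma occ_vec_carrier: "occ_vec M lam y \<in> carrier_vec M"
  by (simp add: occ_vec_def)

lemma rcomp_occ_vec: "b \<in> {1..M} \<Longrightarrow> rcomp (occ_vec M lam y) b = of_int (occ (mults M lam) y b)"
proof -
  assume "b \<in> {1..M}"
  hence "b - 1 < M" "Suc (b - 1) = b" by auto
  thus ?thesis unfolding rcomp_def occ_vec_def by simp
qed

lemma lattice_even:
  assumes "\<forall>a\<in>{1..Suc M}. even (y a - parity_class M lam \<sigma> a)" "a \<in> {1..M}"
  shows "even (mults M lam a + y (Suc a) - y a)"
proof -
  have "even (y a - parity_class M lam \<sigma> a)" "even (y (Suc a) - parity_class M lam \<sigma> (Suc a))"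
    using assms by auto
  with even_parity_class[OF assms(2), of lam \<sigma>] show ?thesis by presburger
qed

lemma rcomp_occ_vec_real:
  assumes "even (mults M lam b + y (Suc b) - y b)" "b \<in> {1..M}"
  shows "rcomp (occ_vec M lam y) b = 1/2 * (of_int (mults M lam b) + (of_int (y (Suc b)) - of_int (y b)))"
proof -
  have "2 * occ (mults M lam) y b = mults M lam b + y (Suc b) - y b"
    by (rule occ_real[where l = "mults M lam" and y = y and a = b, OF assms(1)])
  hence "real_of_int (2 * occ (mults M lam) y b) = of_int (mults M lam b + y (Suc b) - y b)" by (rule arg_cong)
  thus ?thesis using assms(2) by (simp add: rcomp_occ_vec)
qed

lemma kapp_difference_1:
  "kapp M (\<lambda>b. of_int (y (Suc b)) - of_int (y b)) 1 = of_int (psum y (Suc M)) / real (Suc M) - of_int (y 1)"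
proof (cases "M = 0")
  case True
  thus ?thesis by (simp add: kapp_def)
next
  case False
  hence "kapp M (\<lambda>b. of_int (y (Suc b)) - of_int (y b)) 1 = real 1 / real (Suc M) * of_int (psum y (Suc M)) - of_int (psum y 1)"
    by (intro kapp_difference) simp
  moreover have "psum y 1 = y 1" by simp
  ultimately show ?thesis by simp
qed

lemma kapp_mults_1:
  assumes "\<forall>p\<in>set lam. p \<le> M"
  shows "kapp M (\<lambda>b. of_int (mults M lam b)) 1 = of_int (\<Sum>b=1..M. mults M lam b) - real (sum_list lam) / real (Suc M)"
proof -
  have "real (sum_list lam) = (\<Sum>b=1..M. real b * of_int (mults M lam b))"
    unfolding sum_list_evec_part[OF assms] by (intro sum.cong refl) (simp add: rcomp_evec_part)
  hence "real (sum_list lam) / real (Suc M) = (\<Sum>b=1..M. 1 * real b / real (Suc M) * of_int (mults M lam b))"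
    by (simp add: sum_divide_distrib)
  moreover have "kapp M (\<lambda>b. of_int (mults M lam b)) 1 = (\<Sum>b=1..M. of_int (mults M lam b) - 1 * real b / real (Suc M) * of_int (mults M lam b))"
    unfolding kapp_def by (intro sum.cong refl) (simp add: kmat_def min_def algebra_simps)
  ultimately show ?thesis by (simp add: sum_subtractf)
qed

text \<open>In terms of y, (C^{-1} n)_1 is half of (sum of the L_b) - |lambda|/N + (total)/N - y_1.
  The terms with |lambda|/N cancel, and once the total is 2b only the parity of y_1 is
  prescribed.\<close>

lemma restricted_iff:
  assumes lam: "\<forall>p\<in>set lam. p \<le> M" and v: "v \<in> carrier_vec M"
    and occ: "\<And>b. b \<in> {1..M} \<Longrightarrow> rcomp v b = 1/2 * (of_int (mults M lam b) + (of_int (y (Suc b)) - of_int (y b)))"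
  shows "(real_of_int b - real (sum_list lam) / 2) / real (Suc M)
          - (if Suc M = 1 then 0 else (cartan_inv (Suc M) *\<^sub>v rvec v) $ 0) = real_of_int z + real \<sigma> / 2
     \<longleftrightarrow> (2 * real_of_int b - of_int (psum y (Suc M))) / real (Suc M) + of_int (y 1) = of_int (\<Sum>b=1..M. mults M lam b) + 2 * of_int z + real \<sigma>"
proof -
  have "(if Suc M = 1 then 0 else (cartan_inv (Suc M) *\<^sub>v rvec v) $ 0) = kapp M (rcomp v) 1"
    using v by (cases "M = 0") (simp_all add: cartan_inv_vec kapp_def)
  also have "\<dots> = kapp M (\<lambda>b. 1/2 * (of_int (mults M lam b) + (of_int (y (Suc b)) - of_int (y b)))) 1"
    by (rule kapp_cong) (rule occ)
  also have "\<dots> = 1/2 * ((of_int (\<Sum>b=1..M. mults M lam b) - real (sum_list lam) / real (Suc M)) + (of_int (psum y (Suc M)) / real (Suc M) - of_int (y 1)))"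
    unfolding kapp_cmult kapp_add kapp_mults_1[OF lam] kapp_difference_1 ..
  finally have *: "(if Suc M = 1 then 0 else (cartan_inv (Suc M) *\<^sub>v rvec v) $ 0) = \<dots>" .
  define B where "B = real_of_int b / real (Suc M)"
  define T where "T = real (sum_list lam) / real (Suc M)"
  define Y where "Y = real_of_int (psum y (Suc M)) / real (Suc M)"
  have 1: "(real_of_int b - real (sum_list lam) / 2) / real (Suc M) = B - T / 2"
    by (simp add: B_def T_def diff_divide_distrib)
  have 2: "(2 * real_of_int b - of_int (psum y (Suc M))) / real (Suc M) = 2 * B - Y"
    by (simp add: B_def Y_def diff_divide_distrib)
  have 3: "(B - T / 2 - 1/2 * ((S - T) + (Y - u)) = w + v / 2) \<longleftrightarrow> (2 * B - Y + u = S + 2 * w + v)" for S u w v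
    by (auto simp: field_simps)
  show ?thesis
    unfolding * 1 2 T_def[symmetric] Y_def[symmetric] by (rule 3)
qed

lemma occ_vec_restricted:
  assumes lam: "\<forall>p\<in>set lam. p \<le> M" and y: "y \<in> lattice_pts M lam \<sigma> b"
  shows "occ_vec M lam y \<in> restricted (Suc M) lam \<sigma> b"
proof -
  have ev: "\<forall>a\<in>{1..Suc M}. even (y a - parity_class M lam \<sigma> a)" and sum: "psum y (Suc M) = 2 * b"
    using y by (auto simp: lattice_pts_def)
  have occ: "rcomp (occ_vec M lam y) c = 1/2 * (of_int (mults M lam c) + (of_int (y (Suc c)) - of_int (y c)))" if "c \<in> {1..M}" for c
    by (rule rcomp_occ_vec_real[OF lattice_even[OF ev that] that])
  have "even (y 1 - parity_class M lam \<sigma> 1)" using ev by simp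
  then obtain z where "y 1 - parity_class M lam \<sigma> 1 = 2 * z" by (rule evenE)
  hence "real_of_int (y 1) = of_int (\<Sum>b=1..M. mults M lam b) + 2 * of_int z + real \<sigma>"
    unfolding parity_class_def by linarith
  hence "(2 * real_of_int b - of_int (psum y (Suc M))) / real (Suc M) + of_int (y 1) = of_int (\<Sum>b=1..M. mults M lam b) + 2 * of_int z + real \<sigma>"
    unfolding sum by simp
  hence "(real_of_int b - real (sum_list lam) / 2) / real (Suc M)
          - (if Suc M = 1 then 0 else (cartan_inv (Suc M) *\<^sub>v rvec (occ_vec M lam y)) $ 0) = real_of_int z + real \<sigma> / 2"
    using restricted_iff[where y = y and b = b and z = z and \<sigma> = \<sigma>, OF lam occ_vec_carrier occ] by (simp only:)
  thus ?thesis unfolding restricted_def using occ_vec_carrier[of M lam y] by (auto simp del: One_nat_def)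
qed

lemma occ_vec_surj:
  assumes lam: "\<forall>p\<in>set lam. p \<le> M" and v: "v \<in> restricted (Suc M) lam \<sigma> b"
  shows "\<exists>y\<in>lattice_pts M lam \<sigma> b. occ_vec M lam y = v"
proof -
  have vc: "v \<in> carrier_vec M" using v by (simp add: restricted_def)
  obtain z where z: "(real_of_int b - real (sum_list lam) / 2) / real (Suc M)
          - (if Suc M = 1 then 0 else (cartan_inv (Suc M) *\<^sub>v rvec v) $ 0) = real_of_int z + real \<sigma> / 2"
    using v unfolding restricted_def by blast
  \<comment> \<open>The value that \<open>restricted_iff\<close> forces on y_1 if the total is 2b;
    conversely, this choice makes the total equal to 2b. The next definition solves y_{a+1} = y_a +
    2 v_a - L_a.\<close>
  define y1 where "y1 = (\<Sum>b=1..M. mults M lam b) + 2 * z + int \<sigma>"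
  define y where "y = (\<lambda>a. if a \<in> {1..Suc M} then y1 + (\<Sum>c\<in>{1..<a}. 2 * v $ (c - 1) - mults M lam c) else 0)"
  have Z: "y \<in> Zn (Suc M)" by (auto simp: Zn_def y_def)
  have y1: "y 1 = y1" by (simp add: y_def)
  have step: "y (Suc a) = y a + (2 * v $ (a - 1) - mults M lam a)" if "a \<in> {1..M}" for a
    using that by (simp add: y_def)
  have occ: "rcomp v c = 1/2 * (of_int (mults M lam c) + (of_int (y (Suc c)) - of_int (y c)))" if "c \<in> {1..M}" for c
    using step[OF that] by (simp add: rcomp_def)
  have "(2 * real_of_int b - of_int (psum y (Suc M))) / real (Suc M) + of_int (y 1) = of_int (\<Sum>b=1..M. mults M lam b) + 2 * of_int z + real \<sigma>"
    by (rule restricted_iff[where y = y, OF lam vc occ, THEN iffD1, OF _ z])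
  hence "(2 * real_of_int b - of_int (psum y (Suc M))) / real (Suc M) = 0"
    unfolding y1 by (simp add: y1_def)
  hence "real_of_int (psum y (Suc M)) = real_of_int (2 * b)" by simp
  hence sum: "psum y (Suc M) = 2 * b" by (simp only: of_int_eq_iff)
  have ev: "even (y (Suc a) - parity_class M lam \<sigma> (Suc a))" if "a \<le> M" for a
    using that
  proof (induction a)
    case 0
    have "y (Suc 0) = y1" using y1 by simp
    thus ?case by (simp add: y1_def parity_class_def)
  next
    case (Suc a)
    hence a: "Suc a \<in> {1..M}" by simp
    have "y (Suc (Suc a)) - parity_class M lam \<sigma> (Suc (Suc a)) = (y (Suc a) - parity_class M lam \<sigma> (Suc a)) + 2 * (v $ (Suc a - 1))"
      using step[OF a] parity_class_Suc[OF a, of lam \<sigma>] by linarith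
    moreover have "even (y (Suc a) - parity_class M lam \<sigma> (Suc a))" using Suc by simp
    ultimately show ?case by (simp only: dvd_add dvd_triv_left)
  qed
  have ev': "even (y a - parity_class M lam \<sigma> a)" if "a \<in> {1..Suc M}" for a
    using that ev[of "a - 1"] by (cases a) auto
  have "y \<in> lattice_pts M lam \<sigma> b" using Z ev' sum unfolding lattice_pts_def by blast
  moreover have "occ_vec M lam y = v"
  proof (rule eq_vecI)
    fix i assume "i < dim_vec v"
    hence i: "Suc i \<in> {1..M}" using vc by simp
    have "occ (mults M lam) y (Suc i) = v $ i" using step[OF i] by (simp add: occ_def)
    thus "occ_vec M lam y $ i = v $ i" using i by (simp add: occ_vec_def)
  qed (use vc in \<open>simp add: occ_vec_def\<close>)
  ultimately show ?thesis by blast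
qed

text \<open>Occupation numbers determine the differences of y, so two preimages differ by a
  constant, which the common total forces to be 0.\<close>

lemma occ_vec_inj: "inj_on (occ_vec M lam) (lattice_pts M lam \<sigma> b)"
proof (rule inj_onI)
  fix y y' assume y: "y \<in> lattice_pts M lam \<sigma> b" and y': "y' \<in> lattice_pts M lam \<sigma> b" and eq: "occ_vec M lam y = occ_vec M lam y'"
  have ev: "\<forall>a\<in>{1..Suc M}. even (y a - parity_class M lam \<sigma> a)" "\<forall>a\<in>{1..Suc M}. even (y' a - parity_class M lam \<sigma> a)"
    and Z: "y \<in> Zn (Suc M)" "y' \<in> Zn (Suc M)" and sum: "psum y (Suc M) = 2 * b" "psum y' (Suc M) = 2 * b"
    using y y' by (auto simp: lattice_pts_def)
  have step: "y (Suc a) - y a = y' (Suc a) - y' a" if a: "a \<in> {1..M}" for a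
  proof -
    have "occ_vec M lam y $ (a - 1) = occ_vec M lam y' $ (a - 1)" by (simp only: eq)
    moreover have "a - 1 < M" "Suc (a - 1) = a" using a by auto
    ultimately have "occ (mults M lam) y a = occ (mults M lam) y' a" by (simp add: occ_vec_def)
    with occ_real[where l = "mults M lam" and y = y, OF lattice_even[OF ev(1) a]] occ_real[where l = "mults M lam" and y = y', OF lattice_even[OF ev(2) a]] show ?thesis by linarith
  qed
  define c where "c = y 1 - y' 1"
  have const: "y (Suc a) = y' (Suc a) + c" if "a \<le> M" for a
    using that
  proof (induction a)
    case (Suc a)
    thus ?case using step[of "Suc a"] by simp
  qed (simp add: c_def)
  have "psum y (Suc M) = psum y' (Suc M) + int (Suc M) * c"
  proof -
    have "psum y (Suc M) = (\<Sum>a=1..Suc M. y' a + c)"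
      unfolding psum_def
    proof (rule sum.cong[OF refl])
      fix a assume "a \<in> {1..Suc M}"
      thus "y a = y' a + c" using const[of "a - 1"] by (cases a) auto
    qed
    thus ?thesis by (simp only: sum.distrib psum_def) simp
  qed
  hence "c = 0" using sum by simp
  show "y = y'"
  proof
    fix a
    show "y a = y' a"
    proof (cases "a \<in> {1..Suc M}")
      case True
      thus ?thesis using const[of "a - 1"] \<open>c = 0\<close> by (cases a) auto
    next
      case False
      hence "a < 1 \<or> a > Suc M" by auto
      thus ?thesis using Zn_D[OF Z(1)] Zn_D[OF Z(2)] by metis
    qed
  qed
qed

lemma bij_occ_vec:
  assumes "\<forall>p\<in>set lam. p \<le> M"
  shows "bij_betw (occ_vec M lam) (lattice_pts M lam \<sigma> b) (restricted (Suc M) lam \<sigma> b)"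
  unfolding bij_betw_def
proof (intro conjI occ_vec_inj subset_antisym subsetI)
  fix v assume "v \<in> occ_vec M lam ` lattice_pts M lam \<sigma> b"
  thus "v \<in> restricted (Suc M) lam \<sigma> b" using occ_vec_restricted[OF assms] by blast
next
  fix v assume "v \<in> restricted (Suc M) lam \<sigma> b"
  thus "v \<in> occ_vec M lam ` lattice_pts M lam \<sigma> b" using occ_vec_surj[OF assms] by blast
qed

section \<open>The quadratic form and the vector m in lattice coordinates\<close>

text \<open>One quarter of e_lambda C^{-1} e_lambda, the constant from completing the square in n
  C^{-1} (n - e_lambda). It is the same for both sides of the theorem.\<close>

definition kappa :: "nat \<Rightarrow> nat list \<Rightarrow> real" where
  "kappa M lam = 1/4 * (\<Sum>a=1..M. of_int (mults M lam a) * kapp M (\<lambda>b. of_int (mults M lam b)) a)"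

text \<open>With n = (L + d)/2, where d holds the differences of y, symmetry of C^{-1} gives (d
  C^{-1} d - L C^{-1} L)/4, and \<open>abel_squares\<close> evaluates d C^{-1} d.\<close>

lemma cform_occ_vec:
  assumes y: "y \<in> lattice_pts M lam \<sigma> b"
  shows "cform (Suc M) (occ_vec M lam y) (occ_vec M lam y - evec_part (Suc M) lam)
    = (\<Sum>a=1..Suc M. (of_int (y a))\<^sup>2 / 4) - (of_int b)\<^sup>2 / real (Suc M) - kappa M lam"
proof -
  have ev: "\<forall>a\<in>{1..Suc M}. even (y a - parity_class M lam \<sigma> a)" and sum: "psum y (Suc M) = 2 * b"
    using y by (auto simp: lattice_pts_def)
  define l d :: "nat \<Rightarrow> real" where "l = (\<lambda>a. of_int (mults M lam a))" and "d = (\<lambda>a. of_int (y (Suc a)) - of_int (y a))"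
  have n: "rcomp (occ_vec M lam y) a = 1/2 * (l a + d a)" if "a \<in> {1..M}" for a
    unfolding l_def d_def by (rule rcomp_occ_vec_real[OF lattice_even[OF ev that] that])
  have n': "rcomp (occ_vec M lam y - evec_part (Suc M) lam) a = 1/2 * (d a - l a)" if a: "a \<in> {1..M}" for a
  proof -
    have "a - 1 < M" using a by auto
    hence "rcomp (occ_vec M lam y - evec_part (Suc M) lam) a = rcomp (occ_vec M lam y) a - rcomp (evec_part (Suc M) lam) a"
      using carrier_vecD[OF evec_part_carrier[of M lam]] by (simp add: rcomp_def)
    thus ?thesis unfolding n[OF a] rcomp_evec_part[OF a] by (simp add: l_def field_simps)
  qed
  have "cform (Suc M) (occ_vec M lam y) (occ_vec M lam y - evec_part (Suc M) lam)
     = (\<Sum>a=1..M. 1/2 * (l a + d a) * (1/2 * (kapp M d a - kapp M l a)))"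
  proof -
    have "kapp M (rcomp (occ_vec M lam y - evec_part (Suc M) lam)) a = 1/2 * (kapp M d a - kapp M l a)" for a
      unfolding kapp_diff[symmetric] kapp_cmult[symmetric] by (rule kapp_cong) (rule n')
    moreover have "occ_vec M lam y - evec_part (Suc M) lam \<in> carrier_vec M"
      using occ_vec_carrier evec_part_carrier by (rule minus_carrier_vec)
    ultimately show ?thesis
      using n by (simp add: cform_eq occ_vec_carrier del: times_divide_eq_left)
  qed
  also have "\<dots> = (\<Sum>a=1..M. 1/4 * (l a * kapp M d a) - 1/4 * (l a * kapp M l a) + 1/4 * (d a * kapp M d a) - 1/4 * (d a * kapp M l a))"
    by (intro sum.cong refl) (simp add: algebra_simps add_divide_distrib diff_divide_distrib)
  also have "\<dots> = 1/4 * (\<Sum>a=1..M. l a * kapp M d a) - 1/4 * (\<Sum>a=1..M. l a * kapp M l a) + 1/4 * (\<Sum>a=1..M. d a * kapp M d a) - 1/4 * (\<Sum>a=1..M. d a * kapp M l a)"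
    by (simp only: sum.distrib sum_subtractf sum_distrib_left)
  also have "(\<Sum>a=1..M. d a * kapp M l a) = (\<Sum>a=1..M. l a * kapp M d a)" by (rule kapp_sym)
  also have "(\<Sum>a=1..M. d a * kapp M d a) = (\<Sum>a=1..Suc M. (of_int (y a))\<^sup>2) - 4 * (of_int b)\<^sup>2 / real (Suc M)"
  proof -
    define c where "c = 2 * of_int b / real (Suc M)"
    have c: "real (Suc M) * c = 2 * of_int b" by (simp add: c_def)
    have "(\<Sum>a=1..M. d a * kapp M d a) = (\<Sum>a=1..M. (of_int (y (Suc a)) - of_int (y a)) * (real a * c - of_int (psum y a)))"
      unfolding d_def
      by (intro sum.cong refl) (simp add: kapp_difference sum c_def del: psum_Suc of_nat_Suc)
    also have "\<dots> = (\<Sum>a=1..Suc M. (of_int (y a))\<^sup>2) - c * (2 * of_int b)"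
      unfolding abel_squares c sum by simp
    also have "c * (2 * of_int b) = 4 * (of_int b)\<^sup>2 / real (Suc M)"
      by (simp add: c_def power2_eq_square)
    finally show ?thesis .
  qed
  moreover have "kappa M lam = 1/4 * (\<Sum>a=1..M. l a * kapp M l a)" by (simp only: kappa_def l_def)
  ultimately show ?thesis
    unfolding sum_divide_distrib[symmetric] by (simp add: algebra_simps add_divide_distrib diff_divide_distrib)
qed

text \<open>The column C^{-1} e_{N-1} has entries a/N, so the source term contributes 2ba/N; the
  same amount comes from \<open>kapp_difference\<close> with the opposite sign. The floor is thus
  taken of an integer.\<close>

lemma mvec_occ_vec:
  assumes y: "y \<in> lattice_pts M lam \<sigma> b" and a: "a \<in> {1..M}"
  shows "\<lfloor>mvec (Suc M) lam b (occ_vec M lam y) $ (a - 1)\<rfloor> = psum y a"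
proof -
  have ev: "\<forall>a\<in>{1..Suc M}. even (y a - parity_class M lam \<sigma> a)" and sum: "psum y (Suc M) = 2 * b"
    using y by (auto simp: lattice_pts_def)
  define l d :: "nat \<Rightarrow> real" where "l = (\<lambda>a. of_int (mults M lam a))" and "d = (\<lambda>a. of_int (y (Suc a)) - of_int (y a))"
  let ?w = "(2 * b) \<cdot>\<^sub>v evec (Suc M) (Suc M - 1) + evec_part (Suc M) lam - 2 \<cdot>\<^sub>v occ_vec M lam y"
  have w: "?w \<in> carrier_vec M"
    by (intro minus_carrier_vec add_carrier_vec smult_carrier_vec[THEN iffD2] evec_carrier evec_part_carrier occ_vec_carrier)
  have rw: "rcomp ?w c = 2 * of_int b * of_bool (c = M) - d c" if c: "c \<in> {1..M}" for c
  proof -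
    have i: "c - 1 < M" using c by auto
    have "rcomp ?w c = 2 * of_int b * of_int (evec (Suc M) M $ (c - 1)) + rcomp (evec_part (Suc M) lam) c - 2 * rcomp (occ_vec M lam y) c"
      using i carrier_vecD[OF evec_part_carrier[of M lam]] carrier_vecD[OF evec_carrier[of M M]] carrier_vecD[OF occ_vec_carrier[of M lam y]]
      by (simp add: rcomp_def)
    also have "evec (Suc M) M $ (c - 1) = of_bool (c = M)"
      using c i by (auto simp: evec_def unit_vec_def)
    finally show ?thesis
      unfolding rcomp_occ_vec_real[OF lattice_even[OF ev c] c] rcomp_evec_part[OF c] d_def of_int_of_bool by (simp add: algebra_simps add_divide_distrib diff_divide_distrib)
  qed
  have "mvec (Suc M) lam b (occ_vec M lam y) $ (a - 1) = kapp M (rcomp ?w) a"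
    using a cartan_inv_vec[OF w, of "a - 1"] by (auto simp: mvec_def)
  also have "\<dots> = kapp M (\<lambda>c. 2 * of_int b * of_bool (c = M) - d c) a"
    by (rule kapp_cong) (rule rw)
  also have "\<dots> = 2 * of_int b * kapp M (\<lambda>c. of_bool (c = M)) a - kapp M d a"
    unfolding kapp_diff kapp_cmult ..
  also have "kapp M (\<lambda>c. of_bool (c = M)) a = real a / real (Suc M)"
  proof -
    have "kapp M (\<lambda>c. of_bool (c = M)) a = (\<Sum>c=1..M. if c = M then kmat M a M else 0)"
      unfolding kapp_def by (intro sum.cong refl) auto
    also have "\<dots> = kmat M a M" using a by auto
    also have "\<dots> = real a / real (Suc M)" using a by (simp add: kmat_def field_simps)
    finally show ?thesis .
  qed
  also have "kapp M d a = real a / real (Suc M) * of_int (2 * b) - of_int (psum y a)"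
    unfolding d_def using a by (subst kapp_difference) (auto simp: sum simp del: psum_Suc of_nat_Suc)
  finally have "mvec (Suc M) lam b (occ_vec M lam y) $ (a - 1) = of_int (psum y a)" by simp
  thus ?thesis by simp
qed

section \<open>The conjugate Bailey pair of level $N$\<close>

lemma fiber_summable:
  fixes f :: "'a \<Rightarrow> complex" and h :: "'a \<Rightarrow> int"
  assumes "f summable_on A"
  shows "(\<lambda>(y, m). f y * of_bool (h y = m)) summable_on (A \<times> UNIV)"
proof -
  have "(\<lambda>(y, m). f y * of_bool (h y = m)) summable_on ((\<lambda>y. (y, h y)) ` A)"
    by (subst summable_on_reindex) (use assms in \<open>auto simp: inj_on_def o_def\<close>)
  thus ?thesis
    by (rule summable_on_cong_neutral[THEN iffD1, rotated -1]) auto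
qed

text \<open>Regrouping by the value of h; a bounded weight preserves summability over the pairs (y,
  m), so the exchange is legitimate.\<close>

lemma fiber_sum:
  fixes f :: "'a \<Rightarrow> complex" and h :: "'a \<Rightarrow> int"
  assumes f: "f summable_on A" and w: "\<And>m. norm (w m) \<le> K"
  shows "(\<Sum>\<^sub>\<infinity>y\<in>A. f y * w (h y)) = (\<Sum>\<^sub>\<infinity>m. (\<Sum>\<^sub>\<infinity>y\<in>A. f y * of_bool (h y = m)) * w m)"
    and "(\<lambda>m. \<Sum>\<^sub>\<infinity>y\<in>A. f y * of_bool (h y = m)) summable_on UNIV"
proof -
  note s = fiber_summable[OF f, of h]
  have "(\<lambda>z. (case z of (y, m) \<Rightarrow> f y * of_bool (h y = m)) * w (snd z)) summable_on (A \<times> UNIV)"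
    by (rule summable_on_mult_bounded[OF s w])
  hence s': "(\<lambda>(y, m). f y * of_bool (h y = m) * w m) summable_on (A \<times> UNIV)"
    by (simp add: case_prod_unfold)
  have "(\<Sum>\<^sub>\<infinity>y\<in>A. f y * w (h y)) = (\<Sum>\<^sub>\<infinity>y\<in>A. \<Sum>\<^sub>\<infinity>m. f y * of_bool (h y = m) * w m)"
  proof (rule infsum_cong)
    fix y
    have "(\<Sum>\<^sub>\<infinity>m. f y * of_bool (h y = m) * w m) = (\<Sum>\<^sub>\<infinity>m\<in>{h y}. f y * of_bool (h y = m) * w m)"
      by (rule infsum_cong_neutral) auto
    thus "f y * w (h y) = (\<Sum>\<^sub>\<infinity>m. f y * of_bool (h y = m) * w m)" by simp
  qed
  also have "\<dots> = (\<Sum>\<^sub>\<infinity>m. \<Sum>\<^sub>\<infinity>y\<in>A. f y * of_bool (h y = m) * w m)"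
    by (rule infsum_swap_banach[OF s'])
  finally show "(\<Sum>\<^sub>\<infinity>y\<in>A. f y * w (h y)) = (\<Sum>\<^sub>\<infinity>m. (\<Sum>\<^sub>\<infinity>y\<in>A. f y * of_bool (h y = m)) * w m)"
    by (simp only: infsum_cmult_left')
  have "(\<lambda>(m, y). f y * of_bool (h y = m)) summable_on (UNIV \<times> A)"
    using s by (subst summable_on_swap) (simp add: case_prod_unfold)
  thus "(\<lambda>m. \<Sum>\<^sub>\<infinity>y\<in>A. f y * of_bool (h y = m)) summable_on UNIV"
    by (rule summable_on_Sigma_banach)
qed

context nome
begin

text \<open>The only denominator is 1/(q)_{m+n} with m + n >= 0, and its inverse converges because
  \<open>iq_inf\<close> is nonzero.\<close>

lemma qbinom_bounded: "\<exists>K. \<forall>m n. norm (qbinom q m n) \<le> K"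
proof -
  have "(\<lambda>n. 1 / iq (int n)) \<longlonglongrightarrow> 1 / iq_inf"
    by (intro tendsto_intros iq_tendsto iq_inf_nonzero)
  hence "Bseq (\<lambda>n. 1 / iq (int n))" by (rule convergent_imp_Bseq[OF convergentI])
  then obtain C where C: "C > 0" "\<And>n. norm (1 / iq (int n)) \<le> C" by (auto simp: Bseq_def)
  have "norm (qbinom q m n) \<le> iqB * iqB * C" for m n
  proof (cases "m \<ge> 0 \<and> n \<ge> 0")
    case True
    have "norm (qbinom q m n) = norm (iq m) * norm (iq n) * norm (1 / iq (int (nat (m + n))))"
      using True by (simp add: qbinom_eq norm_mult norm_divide)
    also have "\<dots> \<le> iqB * iqB * C"
      by (intro mult_mono iqB C mult_nonneg_nonneg) (use iqB(1) in auto)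
    finally show ?thesis .
  next
    case False
    thus ?thesis using iqB(1) C(1) by (auto simp: qbinom_eq)
  qed
  thus ?thesis by blast
qed

definition fsum :: "nat \<Rightarrow> nat list \<Rightarrow> nat \<Rightarrow> (nat \<Rightarrow> int) \<Rightarrow> complex" where
  "fsum M lam \<sigma> y = Theta (parity_class M lam \<sigma>) (Suc M) y * (\<Prod>a=1..M. qbinom q (psum y a) (occ (mults M lam) y a))"

definition gsum :: "nat \<Rightarrow> nat list \<Rightarrow> nat \<Rightarrow> (nat \<Rightarrow> int) \<Rightarrow> complex" where
  "gsum M lam \<sigma> y = Theta (parity_class M lam \<sigma>) (Suc M) y * (\<Prod>a=1..M. iq (occ (mults M lam) y a))"

lemma summable_fsum: "fsum M lam \<sigma> summable_on Zn (Suc M)"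
proof -
  obtain K where K: "\<And>m n. norm (qbinom q m n) \<le> K" using qbinom_bounded by blast
  have "norm (\<Prod>a=1..M. qbinom q (psum y a) (occ (mults M lam) y a)) \<le> (\<Prod>a=1..M. K)" for y
    unfolding prod_norm[symmetric] by (rule prod_mono) (auto simp: K)
  thus ?thesis unfolding fsum_def[abs_def] by (rule summable_on_mult_bounded[OF summable_Theta])
qed

lemma summable_gsum: "gsum M lam \<sigma> summable_on Zn (Suc M)"
  unfolding gsum_def[abs_def] by (rule summable_on_mult_bounded[OF summable_Theta]) (rule norm_prod_iq)

text \<open>Up to the constant q^(-kappa), the conjugate Bailey sequence including its factor
  q^(b^2/N); \<open>hsum\<close> plays the same role for the sums over eta.\<close>

definition dsum :: "nat \<Rightarrow> nat list \<Rightarrow> nat \<Rightarrow> int \<Rightarrow> complex" where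
  "dsum M lam \<sigma> b = (\<Sum>\<^sub>\<infinity>y\<in>Zn (Suc M). fsum M lam \<sigma> y * of_bool (psum y (Suc M) = 2 * b))"

definition hsum :: "nat \<Rightarrow> nat list \<Rightarrow> nat \<Rightarrow> int \<Rightarrow> complex" where
  "hsum M lam \<sigma> b = (\<Sum>\<^sub>\<infinity>y\<in>Zn (Suc M). gsum M lam \<sigma> y * of_bool (psum y (Suc M) = 2 * b))"

lemma summable_dsum: "dsum M lam \<sigma> summable_on UNIV"
proof -
  have "(\<lambda>m. \<Sum>\<^sub>\<infinity>y\<in>Zn (Suc M). fsum M lam \<sigma> y * of_bool (psum y (Suc M) = m)) summable_on range (\<lambda>b. 2 * b)"
    by (rule summable_on_subset_banach[OF fiber_sum(2)[OF summable_fsum, of "\<lambda>_. 0" 0]]) auto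
  thus ?thesis
    by (subst (asm) summable_on_reindex) (auto simp: inj_on_def o_def dsum_def[abs_def])
qed

text \<open>The bound is uniform in b, because the sum over all totals dominates each fibre. This
  makes the sum over j converge.\<close>

lemma norm_hsum_le: "norm (hsum M lam \<sigma> b) \<le> (\<Sum>\<^sub>\<infinity>y\<in>Zn (Suc M). norm (gsum M lam \<sigma> y))"
proof -
  have g: "(\<lambda>y. norm (gsum M lam \<sigma> y)) summable_on Zn (Suc M)"
    using summable_gsum by (simp only: summable_on_iff_abs_summable_on_complex)
  have g': "(\<lambda>y. norm (gsum M lam \<sigma> y * of_bool (psum y (Suc M) = 2 * b))) summable_on Zn (Suc M)"
    by (rule summable_on_comparison_test[OF g]) (auto simp: norm_mult)
  have "norm (hsum M lam \<sigma> b) \<le> (\<Sum>\<^sub>\<infinity>y\<in>Zn (Suc M). norm (gsum M lam \<sigma> y * of_bool (psum y (Suc M) = 2 * b)))"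
    unfolding hsum_def by (rule norm_infsum_bound[OF g'])
  also have "\<dots> \<le> (\<Sum>\<^sub>\<infinity>y\<in>Zn (Suc M). norm (gsum M lam \<sigma> y))"
    by (rule infsum_mono[OF g' g]) (auto simp: norm_mult)
  finally show ?thesis .
qed

text \<open>The level \<open>Suc M\<close> conjugate Bailey pair relative to \<open>1\<close>.\<close>

lemma conjugate_bailey_pair:
  "(\<Sum>\<^sub>\<infinity>r. dsum M lam \<sigma> r * (iq (r - j) * iq (r + j))) = iq_inf * hsum M lam \<sigma> j"
proof -
  have "iq_inf * hsum M lam \<sigma> j = (\<Sum>\<^sub>\<infinity>y\<in>Zn (Suc M). fsum M lam \<sigma> y * E (psum y (Suc M)) (2 * j))"
    unfolding hsum_def gsum_def fsum_def
    by (rule string_function_identity[where l = "mults M lam" and \<epsilon> = "parity_class M lam \<sigma>", symmetric])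
       (auto simp: even_parity_class mults_nonneg simp del: even_diff even_add)
  also have "\<dots> = (\<Sum>\<^sub>\<infinity>m. (\<Sum>\<^sub>\<infinity>y\<in>Zn (Suc M). fsum M lam \<sigma> y * of_bool (psum y (Suc M) = m)) * E m (2 * j))"
    by (rule fiber_sum(1)[OF summable_fsum]) (rule norm_E)
  \<comment> \<open>Odd totals drop out since \<open>E m (2 * j)\<close> is 0 for odd m.\<close>
  also have "\<dots> = (\<Sum>\<^sub>\<infinity>r. (\<Sum>\<^sub>\<infinity>y\<in>Zn (Suc M). fsum M lam \<sigma> y * of_bool (psum y (Suc M) = 0 + 2 * r)) * E (0 + 2 * r) (2 * j))"
    by (rule infsum_int_parity) (simp add: E_odd)
  finally show ?thesis by (simp add: dsum_def E_even)
qed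

lemma Theta_lattice_pts:
  "y \<in> lattice_pts M lam \<sigma> b \<Longrightarrow> Theta (parity_class M lam \<sigma>) (Suc M) y = e (\<Sum>a=1..Suc M. (of_int (y a))\<^sup>2 / 4)"
  unfolding Theta_eq lattice_pts_def by (rule if_P) blast

lemma infsum_lattice_pts:
  fixes w :: "(nat \<Rightarrow> int) \<Rightarrow> complex"
  shows "(\<Sum>\<^sub>\<infinity>y\<in>lattice_pts M lam \<sigma> b. Theta (parity_class M lam \<sigma>) (Suc M) y * w y) =
    (\<Sum>\<^sub>\<infinity>y\<in>Zn (Suc M). Theta (parity_class M lam \<sigma>) (Suc M) y * w y * of_bool (psum y (Suc M) = 2 * b))"
proof (rule infsum_cong_neutral)
  fix y assume y: "y \<in> Zn (Suc M) - lattice_pts M lam \<sigma> b"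
  show "Theta (parity_class M lam \<sigma>) (Suc M) y * w y * of_bool (psum y (Suc M) = 2 * b) = 0"
  proof (cases "psum y (Suc M) = 2 * b")
    case True
    hence "\<not> (\<forall>a\<in>{1..Suc M}. even (y a - parity_class M lam \<sigma> a))" using y unfolding lattice_pts_def by blast
    hence "Theta (parity_class M lam \<sigma>) (Suc M) y = 0" unfolding Theta_eq by (rule if_not_P)
    thus ?thesis by simp
  qed (simp del: psum_Suc)
next
  fix y assume "y \<in> lattice_pts M lam \<sigma> b \<inter> Zn (Suc M)"
  hence "psum y (Suc M) = 2 * b" unfolding lattice_pts_def by blast
  thus "Theta (parity_class M lam \<sigma>) (Suc M) y * w y = Theta (parity_class M lam \<sigma>) (Suc M) y * w y * of_bool (psum y (Suc M) = 2 * b)"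
    by (simp del: psum_Suc)
qed (auto simp: lattice_pts_def)

lemma e_cform_occ_vec:
  assumes "y \<in> lattice_pts M lam \<sigma> b"
  shows "e (cform (Suc M) (occ_vec M lam y) (occ_vec M lam y - evec_part (Suc M) lam))
    = e (- (of_int b)\<^sup>2 / real (Suc M) - kappa M lam) * Theta (parity_class M lam \<sigma>) (Suc M) y"
  unfolding cform_occ_vec[OF assms] Theta_lattice_pts[OF assms] e_add[symmetric]
  by (rule arg_cong[where f = e]) simp

lemma e_cancel: "e (x / n) * e (- x / n - y) = e (- y)"
  unfolding e_add[symmetric] by (rule arg_cong[where f = e]) simp

lemma n_summand_sum:
  assumes lam: "\<forall>p\<in>set lam. p \<le> M"
  shows "n_summand q L (Suc M) lam b summable_on restricted (Suc M) lam \<sigma> b"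
    and "e ((of_int b)\<^sup>2 / real (Suc M)) * infsum (n_summand q L (Suc M) lam b) (restricted (Suc M) lam \<sigma> b)
       = e (- kappa M lam) * dsum M lam \<sigma> b"
proof -
  let ?c = "e (- (of_int b)\<^sup>2 / real (Suc M) - kappa M lam)"
  have eq: "n_summand q L (Suc M) lam b (occ_vec M lam y) = ?c * fsum M lam \<sigma> y" if y: "y \<in> lattice_pts M lam \<sigma> b" for y
  proof -
    have "(\<Prod>j=1..Suc M - 1. qbinom q \<lfloor>mvec (Suc M) lam b (occ_vec M lam y) $ (j - 1)\<rfloor> (occ_vec M lam y $ (j - 1)))
        = (\<Prod>a=1..M. qbinom q (psum y a) (occ (mults M lam) y a))"
    proof (rule prod.cong)
      fix a assume a: "a \<in> {1..M}"
      hence "a - 1 < M" "Suc (a - 1) = a" by auto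
      thus "qbinom q \<lfloor>mvec (Suc M) lam b (occ_vec M lam y) $ (a - 1)\<rfloor> (occ_vec M lam y $ (a - 1)) = qbinom q (psum y a) (occ (mults M lam) y a)"
        unfolding mvec_occ_vec[OF y a] by (simp add: occ_vec_def)
    qed simp
    thus ?thesis unfolding n_summand_def fsum_def e_cform_occ_vec[OF y] by (simp only: mult.assoc)
  qed
  have sub: "lattice_pts M lam \<sigma> b \<subseteq> Zn (Suc M)" by (auto simp: lattice_pts_def)
  have "(\<lambda>y. ?c * fsum M lam \<sigma> y) summable_on lattice_pts M lam \<sigma> b"
    by (intro summable_on_cmult_right summable_on_subset_banach[OF summable_fsum sub])
  hence "(\<lambda>y. n_summand q L (Suc M) lam b (occ_vec M lam y)) summable_on lattice_pts M lam \<sigma> b"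
    by (rule summable_on_cong[THEN iffD1, rotated]) (simp add: eq)
  thus "n_summand q L (Suc M) lam b summable_on restricted (Suc M) lam \<sigma> b"
    by (rule summable_on_reindex_bij_betw[OF bij_occ_vec[OF lam], THEN iffD1])
  have "infsum (n_summand q L (Suc M) lam b) (restricted (Suc M) lam \<sigma> b)
      = (\<Sum>\<^sub>\<infinity>y\<in>lattice_pts M lam \<sigma> b. n_summand q L (Suc M) lam b (occ_vec M lam y))"
    by (rule infsum_reindex_bij_betw[OF bij_occ_vec[OF lam], symmetric])
  also have "\<dots> = (\<Sum>\<^sub>\<infinity>y\<in>lattice_pts M lam \<sigma> b. ?c * fsum M lam \<sigma> y)"
    by (rule infsum_cong) (rule eq)
  also have "\<dots> = ?c * dsum M lam \<sigma> b"
    unfolding infsum_cmult_right' dsum_def fsum_def infsum_lattice_pts ..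
  finally show "e ((of_int b)\<^sup>2 / real (Suc M)) * infsum (n_summand q L (Suc M) lam b) (restricted (Suc M) lam \<sigma> b)
       = e (- kappa M lam) * dsum M lam \<sigma> b"
    by (simp only: mult.assoc[symmetric] e_cancel)
qed

lemma eta_summand_sum:
  assumes lam: "\<forall>p\<in>set lam. p \<le> M"
  shows "eta_summand q L (Suc M) lam summable_on restricted (Suc M) lam \<sigma> b"
    and "e ((of_int b)\<^sup>2 / real (Suc M)) * infsum (eta_summand q L (Suc M) lam) (restricted (Suc M) lam \<sigma> b)
       = e (- kappa M lam) * hsum M lam \<sigma> b"
proof -
  let ?c = "e (- (of_int b)\<^sup>2 / real (Suc M) - kappa M lam)"
  have eq: "eta_summand q L (Suc M) lam (occ_vec M lam y) = ?c * gsum M lam \<sigma> y" if y: "y \<in> lattice_pts M lam \<sigma> b" for y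
  proof -
    \<comment> \<open>For a negative entry \<open>qpoch\<close> is 0 and its inverse is again 0, in
      agreement with \<open>iq\<close>.\<close>
    have "inverse (\<Prod>j=1..Suc M - 1. qpoch q q (occ_vec M lam y $ (j - 1))) = (\<Prod>j=1..Suc M - 1. iq (occ_vec M lam y $ (j - 1)))"
      by (simp add: iqp_def prod_dividef inverse_eq_divide)
    also have "\<dots> = (\<Prod>a=1..M. iq (occ (mults M lam) y a))"
    proof (rule prod.cong)
      fix a assume a: "a \<in> {1..M}"
      hence "a - 1 < M" "Suc (a - 1) = a" by auto
      thus "iq (occ_vec M lam y $ (a - 1)) = iq (occ (mults M lam) y a)"
        by (simp add: occ_vec_def)
    qed simp
    finally show ?thesis unfolding eta_summand_def gsum_def e_cform_occ_vec[OF y] divide_inverse by (simp only: mult.assoc)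
  qed
  have sub: "lattice_pts M lam \<sigma> b \<subseteq> Zn (Suc M)" by (auto simp: lattice_pts_def)
  have "(\<lambda>y. ?c * gsum M lam \<sigma> y) summable_on lattice_pts M lam \<sigma> b"
    by (intro summable_on_cmult_right summable_on_subset_banach[OF summable_gsum sub])
  hence "(\<lambda>y. eta_summand q L (Suc M) lam (occ_vec M lam y)) summable_on lattice_pts M lam \<sigma> b"
    by (rule summable_on_cong[THEN iffD1, rotated]) (simp add: eq)
  thus "eta_summand q L (Suc M) lam summable_on restricted (Suc M) lam \<sigma> b"
    by (rule summable_on_reindex_bij_betw[OF bij_occ_vec[OF lam], THEN iffD1])
  have "infsum (eta_summand q L (Suc M) lam) (restricted (Suc M) lam \<sigma> b)
      = (\<Sum>\<^sub>\<infinity>y\<in>lattice_pts M lam \<sigma> b. eta_summand q L (Suc M) lam (occ_vec M lam y))"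
    by (rule infsum_reindex_bij_betw[OF bij_occ_vec[OF lam], symmetric])
  also have "\<dots> = (\<Sum>\<^sub>\<infinity>y\<in>lattice_pts M lam \<sigma> b. ?c * gsum M lam \<sigma> y)"
    by (rule infsum_cong) (rule eq)
  also have "\<dots> = ?c * hsum M lam \<sigma> b"
    unfolding infsum_cmult_right' hsum_def gsum_def infsum_lattice_pts ..
  finally show "e ((of_int b)\<^sup>2 / real (Suc M)) * infsum (eta_summand q L (Suc M) lam) (restricted (Suc M) lam \<sigma> b)
       = e (- kappa M lam) * hsum M lam \<sigma> b"
    by (simp only: mult.assoc[symmetric] e_cancel)
qed

end

section \<open>The two sides of the theorem and their comparison\<close>

context bressoud
begin

text \<open>The coefficients of the full chain. The term j^2/N of the theorem is missing because it
  joins the sum over eta to form \<open>hsum\<close>.\<close>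

definition alpha :: "int \<Rightarrow> complex" where
  "alpha j = (-1) powi j * e ((real k - real i + real \<delta> / 2) * of_int (j\<^sup>2 + j) + (real i - 1) * of_int (j\<^sup>2))"

lemma bressoud_sum_1: "1 \<le> i \<Longrightarrow> bressoud_sum 1 s = bsum 0 alpha s"
  unfolding bressoud_sum_def alpha_def[abs_def] by simp

lemma summable_alpha:
  assumes "k \<ge> 2"
  shows "alpha summable_on UNIV"
proof (rule summable_gauss_bounded[of "real k - 1 + real \<delta> / 2" _ 1 "real k - real i + real \<delta> / 2"])
  fix j :: int
  have "(real k - real i + real \<delta> / 2) * of_int (j\<^sup>2 + j) + (real i - 1) * of_int (j\<^sup>2)
    = (real k - 1 + real \<delta> / 2) * (of_int j)\<^sup>2 + (real k - real i + real \<delta> / 2) * of_int j"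
    by (simp add: algebra_simps)
  hence "alpha j = (-1) powi j * e ((real k - 1 + real \<delta> / 2) * (of_int j)\<^sup>2 + (real k - real i + real \<delta> / 2) * of_int j)"
    unfolding alpha_def by (rule arg_cong)
  thus "norm (alpha j) \<le> 1 * norm (e ((real k - 1 + real \<delta> / 2) * (of_int j)\<^sup>2 + (real k - real i + real \<delta> / 2) * of_int j))"
    by (simp add: norm_mult)
qed (use assms in auto)

lemma j_summand_eq:
  assumes lam: "\<forall>p\<in>set lam. p \<le> M"
  shows "j_summand q L (Suc M) \<delta> k i lam \<sigma> j = e (- kappa M lam) * (alpha j * hsum M lam \<sigma> j)"
proof -
  define n where "n = real (Suc M)"
  have "((2 * real k + real \<delta> - 2 + 2 / n) * of_int j + 2 * real k - 2 * real i + real \<delta>) * of_int j / 2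
     = ((real k - real i + real \<delta> / 2) * of_int (j\<^sup>2 + j) + (real i - 1) * of_int (j\<^sup>2)) + (of_int j)\<^sup>2 / n"
    by (simp add: power2_eq_square algebra_simps add_divide_distrib diff_divide_distrib)
  hence "j_summand q L (Suc M) \<delta> k i lam \<sigma> j = alpha j * (e ((of_int j)\<^sup>2 / n) * infsum (eta_summand q L (Suc M) lam) (restricted (Suc M) lam \<sigma> j))"
    unfolding j_summand_def alpha_def n_def[symmetric] by (simp only: e_add mult.assoc)
  thus ?thesis unfolding n_def eta_summand_sum(2)[OF lam] by (simp only: mult.left_commute)
qed

lemma summable_j_summand:
  assumes lam: "\<forall>p\<in>set lam. p \<le> M" and "k \<ge> 2"
  shows "j_summand q L (Suc M) \<delta> k i lam \<sigma> summable_on UNIV"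
proof -
  have "(\<lambda>j. alpha j * hsum M lam \<sigma> j) summable_on UNIV"
    by (rule summable_on_mult_bounded[OF summable_alpha[OF assms(2)]]) (rule norm_hsum_le)
  hence "(\<lambda>j. e (- kappa M lam) * (alpha j * hsum M lam \<sigma> j)) summable_on UNIV"
    by (rule summable_on_cmult_right)
  thus ?thesis
    by (rule summable_on_cong[THEN iffD1, rotated]) (simp only: j_summand_eq[OF lam])
qed

text \<open>Insert \<open>conjugate_bailey_pair\<close> and exchange the sums over j and r: both
  sequences are summable and the reciprocals between them are bounded.\<close>

lemma bailey_lemma:
  assumes "k \<ge> 2" "1 \<le> i"
  shows "iq_inf * (\<Sum>\<^sub>\<infinity>j. alpha j * hsum M lam \<sigma> j) = (\<Sum>\<^sub>\<infinity>r. dsum M lam \<sigma> r * bressoud_sum 1 r)"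
proof -
  have "(\<lambda>z. (case z of (j, r) \<Rightarrow> alpha j * dsum M lam \<sigma> r) * (case z of (j, r) \<Rightarrow> iq (r - j) * iq (r + j))) summable_on (UNIV \<times> UNIV)"
    by (rule summable_on_mult_bounded[OF summable_on_times[OF summable_alpha[OF assms(1)] summable_dsum], where K = "iqB * iqB"])
       (auto intro: norm_iq_mult_le iqB)
  hence s: "(\<lambda>(j, r). alpha j * dsum M lam \<sigma> r * (iq (r - j) * iq (r + j))) summable_on (UNIV \<times> UNIV)"
    by (simp add: case_prod_unfold)
  have "iq_inf * (\<Sum>\<^sub>\<infinity>j. alpha j * hsum M lam \<sigma> j) = (\<Sum>\<^sub>\<infinity>j. alpha j * (iq_inf * hsum M lam \<sigma> j))"
    unfolding infsum_cmult_right'[symmetric] by (simp only: mult.left_commute)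
  also have "\<dots> = (\<Sum>\<^sub>\<infinity>j. \<Sum>\<^sub>\<infinity>r. alpha j * dsum M lam \<sigma> r * (iq (r - j) * iq (r + j)))"
    unfolding conjugate_bailey_pair[symmetric] infsum_cmult_right'[symmetric] by (simp only: mult.assoc)
  also have "\<dots> = (\<Sum>\<^sub>\<infinity>r. \<Sum>\<^sub>\<infinity>j. alpha j * dsum M lam \<sigma> r * (iq (r - j) * iq (r + j)))"
    by (rule infsum_swap_banach[OF s])
  also have "\<dots> = (\<Sum>\<^sub>\<infinity>r. \<Sum>\<^sub>\<infinity>j. dsum M lam \<sigma> r * (alpha j * (iq (r - j) * iq (r + j))))"
    by (simp only: mult_ac)
  also have "\<dots> = (\<Sum>\<^sub>\<infinity>r. dsum M lam \<sigma> r * bressoud_sum 1 r)"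
    unfolding bressoud_sum_1[OF assms(2)] bsum_def infsum_cmult_right' by simp
  finally show ?thesis .
qed

text \<open>Replaces the padding by \<open>undefined\<close> in \<open>r_chains\<close> with the
  padding by 0 in \<open>Zn\<close>.\<close>

definition zext :: "(nat \<Rightarrow> int) \<Rightarrow> nat \<Rightarrow> int" where
  "zext r a = (if a \<in> {1..k - 1} then r a else 0)"

definition dchains :: "(nat \<Rightarrow> int) set" where
  "dchains = {f \<in> Zn (k - 1). (\<forall>a\<in>{1..k - 1}. 0 \<le> f a) \<and> (\<forall>a. 1 \<le> a \<and> a + 1 \<le> k - 1 \<longrightarrow> f (a + 1) \<le> f a)}"

lemma bij_zext: "bij_betw zext (r_chains k) dchains"
proof (rule bij_betw_byWitness[where f' = "\<lambda>f. restrict f {1..k - 1}"])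
  show "\<forall>r\<in>r_chains k. restrict (zext r) {1..k - 1} = r"
  proof (intro ballI ext)
    fix r a assume "r \<in> r_chains k"
    hence "r \<in> extensional {1..k - 1}" by (auto simp: r_chains_def PiE_def)
    thus "restrict (zext r) {1..k - 1} a = r a"
      by (cases "a \<in> {1..k - 1}") (auto simp: zext_def extensional_def)
  qed
  show "\<forall>f\<in>dchains. zext (restrict f {1..k - 1}) = f"
  proof (intro ballI ext)
    fix f a assume "f \<in> dchains"
    hence "f \<in> Zn (k - 1)" by (simp add: dchains_def)
    thus "zext (restrict f {1..k - 1}) a = f a"
      by (cases "a \<in> {1..k - 1}") (auto simp: zext_def Zn_def)
  qed
  show "zext ` r_chains k \<subseteq> dchains"
  proof (intro image_subsetI)
    fix r assume r: "r \<in> r_chains k"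
    have "zext r \<in> Zn (k - 1)" by (simp add: zext_def Zn_def)
    moreover have "0 \<le> r a" if "a \<in> {1..k - 1}" for a
      using r that unfolding r_chains_def by (auto simp: PiE_def Pi_def)
    moreover have "r (a + 1) \<le> r a" if "1 \<le> a \<and> a + 1 \<le> k - 1" for a
      using r that unfolding r_chains_def by blast
    ultimately show "zext r \<in> dchains" by (simp add: dchains_def zext_def)
  qed
  show "(\<lambda>f. restrict f {1..k - 1}) ` dchains \<subseteq> r_chains k"
  proof (intro image_subsetI)
    fix f assume "f \<in> dchains"
    thus "restrict f {1..k - 1} \<in> r_chains k"
      by (simp add: dchains_def r_chains_def)
  qed
qed

lemma prod_lin_factor:
  assumes "1 \<le> i"
  shows "(\<Prod>a=1..n. lin_factor a (r a)) = e (\<Sum>a=i..n. of_int (r a))"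
proof -
  have "(\<Prod>a=1..n. lin_factor a (r a)) = (\<Prod>a=i..n. lin_factor a (r a))"
    by (rule prod.mono_neutral_right) (use assms in \<open>auto simp: lin_factor_def\<close>)
  also have "\<dots> = (\<Prod>a=i..n. e (of_int (r a)))"
    by (rule prod.cong) (auto simp: lin_factor_def)
  finally show ?thesis by (simp only: prod_e)
qed

text \<open>The factor q^(r_1^2/N) joins the sum over n to give \<open>dsum\<close>; the linear
  factors are distributed over the links of the chain, the last one being part of
  \<open>bressoud_sum_last\<close>.\<close>

lemma r_summand_eq:
  assumes lam: "\<forall>p\<in>set lam. p \<le> M" and k: "k = Suc (Suc n)" and i: "1 \<le> i" "i \<le> k" and \<delta>: "\<delta> \<in> {0, 1}"
  shows "r_summand q L (Suc M) \<delta> k i lam \<sigma> r = e (- kappa M lam) * chain (dsum M lam \<sigma>) (Suc n) (bressoud_sum (Suc n)) (zext r)"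
proof -
  have last: "bressoud_sum (Suc n) s = lin_factor (Suc n) s * iqp (q ^ (2 - \<delta>)) s" for s
    using bressoud_sum_last[of s] k i \<delta> by simp
  have k1: "k - 1 = Suc n" by (simp add: k)
  have z: "zext r a = r a" if "a \<in> {1..Suc n}" for a using that by (simp only: zext_def k1 if_True)
  define D where "D = dsum M lam \<sigma> (r 1)"
  define P where "P = (\<Prod>a\<in>{1..<Suc n}. iq (r a - r (Suc a)))"
  define S where "S = (\<Sum>a=2..Suc n. (real_of_int (r a))\<^sup>2)"
  define T where "T = (\<Sum>a=i..Suc n. real_of_int (r a))"
  define Q where "Q = iqp (q ^ (2 - \<delta>)) (r (Suc n))"
  have "(\<Prod>a\<in>{1..<Suc n}. lin_factor a (zext r a) * iq (zext r a - zext r (Suc a)) * e (of_int ((zext r (Suc a))\<^sup>2)))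
      = (\<Prod>a\<in>{1..<Suc n}. lin_factor a (r a) * iq (r a - r (Suc a)) * e (of_int ((r (Suc a))\<^sup>2)))"
    by (rule prod.cong) (auto simp: z)
  also have "\<dots> = (\<Prod>a\<in>{1..<Suc n}. lin_factor a (r a)) * P * (\<Prod>a\<in>{1..<Suc n}. e (of_int ((r (Suc a))\<^sup>2)))"
    unfolding P_def by (simp only: prod.distrib)
  also have "(\<Prod>a\<in>{1..<Suc n}. e (of_int ((r (Suc a))\<^sup>2))) = e S"
  proof -
    have "(\<Sum>a\<in>{1..<Suc n}. real_of_int ((r (Suc a))\<^sup>2)) = (\<Sum>a\<in>{Suc 1..<Suc (Suc n)}. real_of_int ((r a)\<^sup>2))"
      by (rule sum.shift_bounds_Suc_ivl[symmetric])
    also have "\<dots> = S" unfolding S_def by (rule sum.cong) auto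
    finally show ?thesis by (simp only: prod_e)
  qed
  finally have "chain (dsum M lam \<sigma>) (Suc n) (bressoud_sum (Suc n)) (zext r)
     = D * ((\<Prod>a\<in>{1..<Suc n}. lin_factor a (r a)) * P * e S) * (lin_factor (Suc n) (r (Suc n)) * Q)"
    unfolding chain_def last D_def Q_def by (simp add: z)
  also have "\<dots> = D * P * e S * Q * (\<Prod>a=1..Suc n. lin_factor a (r a))"
    by (simp add: prod.cl_ivl_Suc atLeastLessThanSuc_atLeastAtMost mult_ac)
  also have "(\<Prod>a=1..Suc n. lin_factor a (r a)) = e T"
    unfolding T_def by (rule prod_lin_factor[OF i(1)])
  finally have chain: "chain (dsum M lam \<sigma>) (Suc n) (bressoud_sum (Suc n)) (zext r) = D * P * e S * Q * e T" .
  have P: "inverse (\<Prod>a=1..k-2. qpoch q q (r a - r (a + 1))) = P"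
    unfolding P_def k by (simp add: iqp_def prod_dividef inverse_eq_divide atLeastLessThanSuc_atLeastAtMost)
  have Q: "inverse (qpoch (q ^ (2 - \<delta>)) (q ^ (2 - \<delta>)) (r (k - 1))) = Q"
    unfolding Q_def k by (simp add: iqp_def inverse_eq_divide)
  have "r_summand q L (Suc M) \<delta> k i lam \<sigma> r
     = e ((of_int (r 1))\<^sup>2 / real (Suc M) + S + T) * (P * Q) * infsum (n_summand q L (Suc M) lam (r 1)) (restricted (Suc M) lam \<sigma> (r 1))"
    unfolding r_summand_def divide_inverse[of "e _"] inverse_mult_distrib P Q unfolding k1 S_def T_def ..
  also have "\<dots> = (e ((of_int (r 1))\<^sup>2 / real (Suc M)) * infsum (n_summand q L (Suc M) lam (r 1)) (restricted (Suc M) lam \<sigma> (r 1))) * (e S * e T * (P * Q))"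
    by (simp only: e_add mult_ac)
  also have "\<dots> = e (- kappa M lam) * (D * P * e S * Q * e T)"
    unfolding n_summand_sum(2)[OF lam] D_def by (simp only: mult_ac)
  finally show ?thesis unfolding chain .
qed

lemma iqd_bounded:
  assumes "\<delta> \<in> {0, 1}"
  shows "\<exists>K. \<forall>s. norm (iqp (q ^ (2 - \<delta>)) s) \<le> K" "s < 0 \<Longrightarrow> iqp (q ^ (2 - \<delta>)) s = 0"
proof -
  have p: "norm (q ^ (2 - \<delta>)) < 1" "q ^ (2 - \<delta>) \<noteq> 0"
    using assms norm_q_less q_nonzero by (auto simp: norm_power power_less_one_iff)
  show "\<exists>K. \<forall>s. norm (iqp (q ^ (2 - \<delta>)) s) \<le> K"
    using iqp_bounded[OF p] by metis
  show "s < 0 \<Longrightarrow> iqp (q ^ (2 - \<delta>)) s = 0" using p by simp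
qed

lemma bressoud_sum_last_bounded:
  assumes "k = Suc (Suc n)" "i \<le> k" "\<delta> \<in> {0, 1}"
  shows "\<exists>K. \<forall>s. norm (bressoud_sum (Suc n) s) \<le> K"
proof -
  obtain K where K: "\<And>s. norm (iqp (q ^ (2 - \<delta>)) s) \<le> K" using iqd_bounded(1)[OF assms(3)] by blast
  have "norm (bressoud_sum (Suc n) s) \<le> K" for s
  proof (cases "s < 0")
    case True
    thus ?thesis using order_trans[OF norm_ge_zero K] by (simp add: bressoud_sum_neg)
  next
    case False
    have "bressoud_sum (Suc n) s = lin_factor (Suc n) s * iqp (q ^ (2 - \<delta>)) s"
      using bressoud_sum_last[of s] assms by simp
    moreover have "norm (lin_factor (Suc n) s) \<le> 1" using False by (simp add: lin_factor_def norm_e_le_1)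
    ultimately have "norm (bressoud_sum (Suc n) s) \<le> 1 * K" by (simp only: norm_mult) (intro mult_mono K, auto)
    thus ?thesis by simp
  qed
  thus ?thesis by blast
qed

lemma r_summand_sum:
  assumes lam: "\<forall>p\<in>set lam. p \<le> M" and k: "k = Suc (Suc n)" and i: "1 \<le> i" "i \<le> k" and \<delta>: "\<delta> \<in> {0, 1}"
  shows "r_summand q L (Suc M) \<delta> k i lam \<sigma> summable_on r_chains k"
    and "infsum (r_summand q L (Suc M) \<delta> k i lam \<sigma>) (r_chains k) = e (- kappa M lam) * (\<Sum>\<^sub>\<infinity>r. dsum M lam \<sigma> r * bressoud_sum 1 r)"
proof -
  let ?F = "chain (dsum M lam \<sigma>) (Suc n) (bressoud_sum (Suc n))"
  obtain K where K: "\<And>s. norm (bressoud_sum (Suc n) s) \<le> K" using bressoud_sum_last_bounded[OF k i(2) \<delta>] by blast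
  have F: "?F summable_on Zn (Suc n)"
    by (rule chain_summable[OF summable_dsum bressoud_sum_neg K])
  have k1: "k - 1 = Suc n" by (simp add: k)
  have sub: "dchains \<subseteq> Zn (Suc n)" unfolding dchains_def k1 by blast
  have F': "?F summable_on dchains" by (rule summable_on_subset_banach[OF F sub])
  have eq: "r_summand q L (Suc M) \<delta> k i lam \<sigma> r = e (- kappa M lam) * ?F (zext r)" for r
    by (rule r_summand_eq[OF lam k i \<delta>])
  have "(\<lambda>r. ?F (zext r)) summable_on r_chains k"
    by (rule summable_on_reindex_bij_betw[OF bij_zext, THEN iffD2, OF F'])
  hence "(\<lambda>r. e (- kappa M lam) * ?F (zext r)) summable_on r_chains k"
    by (rule summable_on_cmult_right)
  thus "r_summand q L (Suc M) \<delta> k i lam \<sigma> summable_on r_chains k"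
    by (rule summable_on_cong[THEN iffD1, rotated]) (simp only: eq)
  have "infsum (r_summand q L (Suc M) \<delta> k i lam \<sigma>) (r_chains k) = (\<Sum>\<^sub>\<infinity>r\<in>r_chains k. e (- kappa M lam) * ?F (zext r))"
    by (rule infsum_cong) (rule eq)
  also have "\<dots> = e (- kappa M lam) * infsum ?F dchains"
    unfolding infsum_cmult_right' infsum_reindex_bij_betw[OF bij_zext] ..
  \<comment> \<open>By \<open>chain_nonneg\<close>, a nonzero term satisfies the inequalities that
    define \<open>dchains\<close>.\<close>
  also have "infsum ?F dchains = infsum ?F (Zn (Suc n))"
  proof (rule infsum_cong_neutral)
    fix f assume f: "f \<in> Zn (Suc n) - dchains"
    show "?F f = 0"
    proof (rule ccontr)
      assume nz: "?F f \<noteq> 0"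
      have "0 \<le> f a" if "a \<in> {1..k - 1}" for a
        using chain_nonneg(1)[OF nz bressoud_sum_neg] that by (simp add: k)
      moreover have "f (a + 1) \<le> f a" if "1 \<le> a \<and> a + 1 \<le> k - 1" for a
        using chain_nonneg(2)[OF nz bressoud_sum_neg, of a] that by (simp add: k)
      moreover have "f \<in> Zn (k - 1)" using f by (simp only: k1 DiffD1)
      ultimately have "f \<in> dchains" unfolding dchains_def by blast
      thus False using f by simp
    qed
  qed (use sub in auto)
  also have "\<dots> = (\<Sum>\<^sub>\<infinity>s. dsum M lam \<sigma> s * bressoud_sum 1 s)" by (rule chain_total[OF F])
  finally show "infsum (r_summand q L (Suc M) \<delta> k i lam \<sigma>) (r_chains k) = e (- kappa M lam) * (\<Sum>\<^sub>\<infinity>r. dsum M lam \<sigma> r * bressoud_sum 1 r)" .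
qed

end

theorem theorem1:
  fixes q L :: complex and N \<delta> k i \<sigma> :: nat and lam :: "nat list"
  assumes "0 < norm q" and "norm q < 1" and "exp L = q"
    and "N \<ge> 1" and "\<delta> \<in> {0, 1}" and "k \<ge> 2" and "1 \<le> i" and "i \<le> k"
    and "is_partition lam" and "\<forall>p\<in>set lam. p \<le> N - 1"
    and "\<sigma> \<in> {0, 1}" and "even (sum_list lam + \<sigma> * N)"
  shows "(\<forall>j::int. eta_summand q L N lam summable_on restricted N lam \<sigma> j)
    \<and> j_summand q L N \<delta> k i lam \<sigma> summable_on UNIV
    \<and> (\<forall>r\<in>r_chains k. n_summand q L N lam (r 1) summable_on restricted N lam \<sigma> (r 1))
    \<and> r_summand q L N \<delta> k i lam \<sigma> summable_on r_chains k
    \<and> 1 / qpoch_inf q q * (\<Sum>\<^sub>\<infinity>j. j_summand q L N \<delta> k i lam \<sigma> j)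
      = (\<Sum>\<^sub>\<infinity>r\<in>r_chains k. r_summand q L N \<delta> k i lam \<sigma> r)"
proof -
  interpret bressoud q L k i \<delta> using assms(1-3) by unfold_locales
  define M where "M = N - 1"
  have N: "N = Suc M" using assms(4) by (simp add: M_def)
  have lam: "\<forall>p\<in>set lam. p \<le> M" using assms(10) by (simp add: M_def)
  define n where "n = k - 2"
  have k: "k = Suc (Suc n)" using assms(6) by (simp add: n_def)
  have "1 / qpoch_inf q q * (\<Sum>\<^sub>\<infinity>j. j_summand q L N \<delta> k i lam \<sigma> j)
      = qpow L (- kappa M lam) * (iq_inf * (\<Sum>\<^sub>\<infinity>j. alpha j * hsum M lam \<sigma> j))"
    unfolding N j_summand_eq[OF lam] infsum_cmult_right' iq_inf_def[symmetric] by (rule mult.left_commute)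
  \<comment> \<open>Both sides carry the same constant q^(-kappa), so the Bailey lemma finishes the
    comparison.\<close>
  also have "\<dots> = (\<Sum>\<^sub>\<infinity>r\<in>r_chains k. r_summand q L N \<delta> k i lam \<sigma> r)"
    unfolding bailey_lemma[OF assms(6,7)] N r_summand_sum(2)[OF lam k assms(7,8,5)] ..
  finally show ?thesis
    unfolding N
    using eta_summand_sum(1)[OF lam] summable_j_summand[OF lam assms(6)] n_summand_sum(1)[OF lam]
      r_summand_sum(1)[OF lam k assms(7,8,5)] by blast
qed

end
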